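(* Let $n \geq 1$ and let $Q_n$ be the quiver with one vertex and $n$ loops. Then $Q_n$ has finite or tame representation type if and only if for every dimension $p \geq 1$ the algebra $\mathbb{C}[\mathrm{Rep}(Q_n,p)]^{\mathrm{SL}_p(\mathbb{C})}$ contains a polynomial or hypersurface separating set.
   Context: Representations are over $\mathbb{C}$. $\mathrm{Rep}(Q_n,p)$ is identified with $\mathcal{V} = \mathcal{M}_p^n$, the space of $n$-tuples of complex $p\times p$ matrices, on which $\mathrm{SL}_p(\mathbb{C})$ (and $\mathrm{GL}_p(\mathbb{C})$) acts by simultaneous conjugation; two representations are isomorphic iff they lie in the same $\mathrm{GL}_p(\mathbb{C})$-orbit. A quiver has finite representation type if it has only finitely many isomorphism classes of indecomposable representations; tame representation type if the indecomposable representations in each dimension vector occur, up to isomorphism, in finitely many one-parameter families; and wild representation type otherwise. For a group $H$ acting on $\mathcal{V}$, a subset $S \subseteq \mathbb{C}[\mathcal{V}]^H$ is a separating set if for all $v,w\in\mathcal{V}$: $s(v)=s(w)$ for all $s\in S$ iff $f(v)=f(w)$ for all $f\in\mathbb{C}[\mathcal{V}]^H$. A polynomial separating set is a separating set of cardinality $\dim(\mathbb{C}[\mathcal{V}]^H)$ (Krull dimension), and a hypersurface separating set is a separating set of cardinality $\dim(\mathbb{C}[\mathcal{V}]^H)+1$. *)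

theory Defs
  imports
    "HOL-Algebra.Ideal"
    "HOL-Library.FuncSet"
    "HOL-Library.Extended_Nat"
    "HOL-Computational_Algebra.Polynomial"
    "Graph_Theory.Digraph"
    "Jordan_Normal_Form.Determinant"
begin

section \<open>Quiver representations over the complex numbers\<close>

definition GL :: "nat \<Rightarrow> complex mat monoid" where
  "GL p = units_of (ring_mat TYPE(complex) p ())"

definition SL :: "nat \<Rightarrow> complex mat monoid" where
  "SL p = (GL p)\<lparr>carrier := {g \<in> carrier (GL p). det g = 1}\<rparr>"

text \<open>Dimension vectors and representations are extensional, so that each of them is represented by
  exactly one function. The matrix of an arrow maps the space at its tail to the space at its head.\<close>

definition dim_vectors :: "('v, 'e) pre_digraph \<Rightarrow> ('v \<Rightarrow> nat) set" where
  "dim_vectors Q = verts Q \<rightarrow>\<^sub>E UNIV"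

definition arrow_mats ::
  "('v, 'e) pre_digraph \<Rightarrow> ('v \<Rightarrow> nat) \<Rightarrow> ('e \<Rightarrow> 'a mat) set" where
  "arrow_mats Q d = (\<Pi>\<^sub>E a \<in> arcs Q. carrier_mat (d (head Q a)) (d (tail Q a)))"

abbreviation Rep :: "('v, 'e) pre_digraph \<Rightarrow> ('v \<Rightarrow> nat) \<Rightarrow> ('e \<Rightarrow> complex mat) set" where
  "Rep Q d \<equiv> arrow_mats Q d"

definition base_change ::
  "('v, 'e) pre_digraph \<Rightarrow> ('v \<Rightarrow> nat) \<Rightarrow> ('v \<Rightarrow> complex mat) \<Rightarrow> ('e \<Rightarrow> complex mat) \<Rightarrow> 'e \<Rightarrow> complex mat" where
  "base_change Q d g A =
    (\<lambda>a \<in> arcs Q. g (head Q a) * A a * inv\<^bsub>GL (d (tail Q a))\<^esub> g (tail Q a))"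

definition rep_iso ::
  "('v, 'e) pre_digraph \<Rightarrow> ('v \<Rightarrow> nat) \<Rightarrow> ('e \<Rightarrow> complex mat) \<Rightarrow> ('e \<Rightarrow> complex mat) \<Rightarrow> bool" where
  "rep_iso Q d A B \<longleftrightarrow>
    (\<exists>g \<in> (\<Pi>\<^sub>E v \<in> verts Q. carrier (GL (d v))). B = base_change Q d g A)"

definition direct_sum ::
  "('v, 'e) pre_digraph \<Rightarrow> ('v \<Rightarrow> nat) \<Rightarrow> ('v \<Rightarrow> nat) \<Rightarrow>
    ('e \<Rightarrow> complex mat) \<Rightarrow> ('e \<Rightarrow> complex mat) \<Rightarrow> 'e \<Rightarrow> complex mat" where
  "direct_sum Q d1 d2 A1 A2 =
    (\<lambda>a \<in> arcs Q. four_block_mat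
      (A1 a) (0\<^sub>m (d1 (head Q a)) (d2 (tail Q a)))
      (0\<^sub>m (d2 (head Q a)) (d1 (tail Q a))) (A2 a))"

definition nonzero_dim :: "('v, 'e) pre_digraph \<Rightarrow> ('v \<Rightarrow> nat) \<Rightarrow> bool" where
  "nonzero_dim Q d \<longleftrightarrow> (\<exists>v \<in> verts Q. d v \<noteq> 0)"

definition indecomposable ::
  "('v, 'e) pre_digraph \<Rightarrow> ('v \<Rightarrow> nat) \<Rightarrow> ('e \<Rightarrow> complex mat) \<Rightarrow> bool" where
  "indecomposable Q d A \<longleftrightarrow>
    A \<in> Rep Q d \<and> nonzero_dim Q d \<and>
    \<not> (\<exists>d1 \<in> dim_vectors Q. \<exists>d2 \<in> dim_vectors Q. \<exists>A1 \<in> Rep Q d1. \<exists>A2 \<in> Rep Q d2.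
        nonzero_dim Q d1 \<and> nonzero_dim Q d2 \<and>
        (\<forall>v \<in> verts Q. d v = d1 v + d2 v) \<and>
        rep_iso Q d A (direct_sum Q d1 d2 A1 A2))"

section \<open>Representation type\<close>

definition finite_rep_type :: "('v, 'e) pre_digraph \<Rightarrow> bool" where
  "finite_rep_type Q \<longleftrightarrow>
    finite {(d, {B \<in> Rep Q d. rep_iso Q d A B}) | d A. d \<in> dim_vectors Q \<and> indecomposable Q d A}"

text \<open>A one-parameter family of representations is algebraic: it is given by matrices over the
  polynomial ring in the parameter. Families may be constant, so finitely many exceptional
  isomorphism classes in a dimension vector need no separate clause in the definition of tameness.\<close>

definition family_member ::
  "('v, 'e) pre_digraph \<Rightarrow> ('e \<Rightarrow> complex poly mat) \<Rightarrow> complex \<Rightarrow> 'e \<Rightarrow> complex mat" where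
  "family_member Q M c = (\<lambda>a \<in> arcs Q. map_mat (\<lambda>q. poly q c) (M a))"

definition tame_rep_type :: "('v, 'e) pre_digraph \<Rightarrow> bool" where
  "tame_rep_type Q \<longleftrightarrow>
    (\<forall>d \<in> dim_vectors Q. \<exists>\<F> :: ('e \<Rightarrow> complex poly mat) set.
      finite \<F> \<and> \<F> \<subseteq> arrow_mats Q d \<and>
      (\<forall>A. indecomposable Q d A \<longrightarrow> (\<exists>M \<in> \<F>. \<exists>c. rep_iso Q d A (family_member Q M c))))"

section \<open>Coordinate rings, invariants and separating sets\<close>

inductive_set poly_funs ::
  "('v, 'e) pre_digraph \<Rightarrow> ('v \<Rightarrow> nat) \<Rightarrow> (('e \<Rightarrow> complex mat) \<Rightarrow> complex) set"
  for Q d where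
    const: "(\<lambda>A \<in> Rep Q d. c) \<in> poly_funs Q d"
  | coord: "\<lbrakk>a \<in> arcs Q; i < d (head Q a); j < d (tail Q a)\<rbrakk> \<Longrightarrow>
      (\<lambda>A \<in> Rep Q d. A a $$ (i, j)) \<in> poly_funs Q d"
  | add: "\<lbrakk>f \<in> poly_funs Q d; h \<in> poly_funs Q d\<rbrakk> \<Longrightarrow>
      (\<lambda>A \<in> Rep Q d. f A + h A) \<in> poly_funs Q d"
  | mult: "\<lbrakk>f \<in> poly_funs Q d; h \<in> poly_funs Q d\<rbrakk> \<Longrightarrow>
      (\<lambda>A \<in> Rep Q d. f A * h A) \<in> poly_funs Q d"

text \<open>Since the complex numbers are infinite, polynomials on the affine space of representations may
  be identified with polynomial functions.\<close>

definition coord_ring ::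
  "('v, 'e) pre_digraph \<Rightarrow> ('v \<Rightarrow> nat) \<Rightarrow> (('e \<Rightarrow> complex mat) \<Rightarrow> complex) ring" where
  "coord_ring Q d =
    \<lparr>carrier = poly_funs Q d,
     monoid.mult = (\<lambda>f h. \<lambda>A \<in> Rep Q d. f A * h A),
     one = (\<lambda>A \<in> Rep Q d. 1),
     zero = (\<lambda>A \<in> Rep Q d. 0),
     add = (\<lambda>f h. \<lambda>A \<in> Rep Q d. f A + h A)\<rparr>"

definition invariant_ring ::
  "'x set \<Rightarrow> ('x \<Rightarrow> complex) ring \<Rightarrow> 'g monoid \<Rightarrow> ('g \<Rightarrow> 'x \<Rightarrow> 'x) \<Rightarrow> ('x \<Rightarrow> complex) ring" where
  "invariant_ring V R H \<phi> =
    R\<lparr>carrier := {f \<in> carrier R. \<forall>g \<in> carrier H. \<forall>v \<in> V. f (\<phi> g v) = f v}\<rparr>"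

definition separating_set ::
  "'x set \<Rightarrow> ('x \<Rightarrow> complex) ring \<Rightarrow> ('x \<Rightarrow> complex) set \<Rightarrow> bool" where
  "separating_set V I S \<longleftrightarrow>
    S \<subseteq> carrier I \<and>
    (\<forall>v \<in> V. \<forall>w \<in> V. (\<forall>s \<in> S. s v = s w) \<longleftrightarrow> (\<forall>f \<in> carrier I. f v = f w))"

definition krull_dim :: "('a, 'b) ring_scheme \<Rightarrow> enat" where
  "krull_dim R = Sup {enat k | k. \<exists>P :: nat \<Rightarrow> 'a set.
    (\<forall>i \<le> k. primeideal (P i) R) \<and> (\<forall>i < k. P i \<subset> P (Suc i))}"

definition polynomial_separating_set ::
  "'x set \<Rightarrow> ('x \<Rightarrow> complex) ring \<Rightarrow> ('x \<Rightarrow> complex) set \<Rightarrow> bool" where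
  "polynomial_separating_set V I S \<longleftrightarrow>
    separating_set V I S \<and> finite S \<and> enat (card S) = krull_dim I"

definition hypersurface_separating_set ::
  "'x set \<Rightarrow> ('x \<Rightarrow> complex) ring \<Rightarrow> ('x \<Rightarrow> complex) set \<Rightarrow> bool" where
  "hypersurface_separating_set V I S \<longleftrightarrow>
    separating_set V I S \<and> finite S \<and> enat (card S) = krull_dim I + 1"

section \<open>The quiver with one vertex and several loops\<close>

definition loop_quiver :: "nat \<Rightarrow> (unit, nat) pre_digraph" where
  "loop_quiver n = \<lparr>verts = {()}, arcs = {..<n}, tail = (\<lambda>_. ()), head = (\<lambda>_. ())\<rparr>"

abbreviation loop_rep :: "nat \<Rightarrow> nat \<Rightarrow> (nat \<Rightarrow> complex mat) set" where
  "loop_rep n p \<equiv> Rep (loop_quiver n) (\<lambda>_. p)"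

definition simultaneous_conj ::
  "nat \<Rightarrow> nat \<Rightarrow> complex mat \<Rightarrow> (nat \<Rightarrow> complex mat) \<Rightarrow> nat \<Rightarrow> complex mat" where
  "simultaneous_conj n p g = (\<lambda>A \<in> loop_rep n p. \<lambda>i \<in> {..<n}. g * A i * inv\<^bsub>GL p\<^esub> g)"

definition SL_invariants :: "nat \<Rightarrow> nat \<Rightarrow> ((nat \<Rightarrow> complex mat) \<Rightarrow> complex) ring" where
  "SL_invariants n p =
    invariant_ring (loop_rep n p) (coord_ring (loop_quiver n) (\<lambda>_. p)) (SL p) (simultaneous_conj n p)"

lemma loop_rep_eq: "loop_rep n p = ({..<n} \<rightarrow>\<^sub>E carrier_mat p p)"
  by (simp add: arrow_mats_def loop_quiver_def)

lemma rep_iso_loop_quiver_iff: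
  assumes "A \<in> loop_rep n p"
  shows "rep_iso (loop_quiver n) (\<lambda>_. p) A B \<longleftrightarrow> (\<exists>g \<in> carrier (GL p). B = simultaneous_conj n p g A)"
proof
  assume "rep_iso (loop_quiver n) (\<lambda>_. p) A B"
  then obtain g where "g \<in> (\<Pi>\<^sub>E v \<in> {()}. carrier (GL p))"
    and "B = base_change (loop_quiver n) (\<lambda>_. p) g A"
    by (auto simp: rep_iso_def loop_quiver_def)
  with assms show "\<exists>g \<in> carrier (GL p). B = simultaneous_conj n p g A"
    by (intro bexI[of _ "g ()"]) (auto simp: base_change_def simultaneous_conj_def loop_quiver_def)
next
  assume "\<exists>g \<in> carrier (GL p). B = simultaneous_conj n p g A"
  then obtain g where "g \<in> carrier (GL p)" "B = simultaneous_conj n p g A" by blast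
  with assms show "rep_iso (loop_quiver n) (\<lambda>_. p) A B"
    unfolding rep_iso_def
    by (intro bexI[of _ "\<lambda>_. g"])
      (auto simp: base_change_def simultaneous_conj_def loop_quiver_def PiE_def extensional_def)
qed

end

theory Submission
  imports
    Defs
    "HOL-Analysis.Continuum_Not_Denumerable"
    "Jordan_Normal_Form.Jordan_Normal_Form_Existence"
begin

text \<open>For \<open>n = 1\<close> the Jordan blocks form one polynomial family in each dimension, and the invariants of a
  single matrix are the symmetric functions of its eigenvalues, so \<open>p\<close> values of the characteristic
  polynomial separate while the Krull dimension is \<open>p\<close>.

  For \<open>n \<ge> 2\<close> the \<open>1\<close>-dimensional representations already form an affine
  space of dimension at least \<open>2\<close>, so \<open>Q\<^sub>n\<close> is neither finite nor tame. In dimension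
  \<open>p = 4\<close> a slice for the conjugation action bounds the Krull dimension by \<open>D = 16 (n - 1) + 1\<close>. If \<open>S\<close>
  separates, then the equations \<open>s v = s w\<close> with \<open>s \<in> S\<close> cut out the variety of pairs with equal invariants.
  This variety contains the pairs of iterated extensions of three simple representations in the same
  order, which generically form a component of codimension \<open>D + 2\<close>: an affine space of that dimension
  meets the variety in a single point. Such a point is not cut out by fewer than \<open>D + 2\<close> equations, so
  \<open>S\<close> has at least \<open>D + 2\<close> elements.\<close>

section \<open>Polynomial functions on affine space\<close>

text \<open>The bound D = 16 (n - 1) + 1 is 16 n - 15, the dimension of the space of tuples minus
  that of PGL_4. Generically, pairs of iterated extensions of the same r simples in the same order
  form a locus of codimension D + r - 1, whatever the dimensions of the simples. So r = 3 is the
  first value that defeats a hypersurface separating set. The dimensions of the simples are dictated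
  by n = 2: between nonisomorphic simples of dimensions a and b the space Ext^1 has dimension (n -
  1) a b. For two one-dimensional simples and n = 2 it is a line, so that any two nonsplit
  extensions are isomorphic. Dimensions 1, 2, 1 leave room for different extension classes already
  for n = 2, and this gives p = 4. Dimension theory of varieties is replaced throughout by counting:
  monomials with bounded exponents on two sides are compared, and an underdetermined linear system
  yields a relation. For n \<ge> 2 an upper bound on the Krull dimension suffices, because the lower
  bound on the size of S is obtained independently of it.\<close>

definition box :: "'i set \<Rightarrow> nat \<Rightarrow> ('i \<Rightarrow> nat) set" where
  "box I d = I \<rightarrow>\<^sub>E {..d}"

definition monom_at :: "'i set \<Rightarrow> ('i \<Rightarrow> nat) \<Rightarrow> ('i \<Rightarrow> 'a) \<Rightarrow> 'a::comm_monoid_mult" where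
  "monom_at I \<alpha> x = (\<Prod>i\<in>I. x i ^ \<alpha> i)"

inductive_set pfun :: "'i set \<Rightarrow> (('i \<Rightarrow> complex) \<Rightarrow> complex) set" for I where
  const: "(\<lambda>_. c) \<in> pfun I"
| coord: "i \<in> I \<Longrightarrow> (\<lambda>x. x i) \<in> pfun I"
| add: "\<lbrakk>f \<in> pfun I; g \<in> pfun I\<rbrakk> \<Longrightarrow> (\<lambda>x. f x + g x) \<in> pfun I"
| mult: "\<lbrakk>f \<in> pfun I; g \<in> pfun I\<rbrakk> \<Longrightarrow> (\<lambda>x. f x * g x) \<in> pfun I"

text \<open>Each exponent is bounded separately rather than the total degree, so the number of
  monomials is exactly \<open>Suc d ^ card I\<close> and a single variable can be split off by
  \<open>sum_box_insert\<close>.\<close>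

definition poly_le :: "'i set \<Rightarrow> nat \<Rightarrow> (('i \<Rightarrow> complex) \<Rightarrow> complex) set" where
  "poly_le I d = {f. \<exists>c. f = (\<lambda>x. \<Sum>\<alpha>\<in>box I d. c \<alpha> * monom_at I \<alpha> x)}"

lemma finite_box [simp]: "finite I \<Longrightarrow> finite (box I d)"
  by (simp add: box_def finite_PiE)

lemma card_box: "finite I \<Longrightarrow> card (box I d) = Suc d ^ card I"
  by (simp add: box_def card_PiE)

lemma box_mono: "d \<le> e \<Longrightarrow> box I d \<subseteq> box I e"
  unfolding box_def by (rule PiE_mono) auto

lemma sum_box_insert:
  assumes "i \<notin> I"
  shows "(\<Sum>\<beta>\<in>box (insert i I) d. g \<beta>) = (\<Sum>e\<le>d. \<Sum>\<alpha>\<in>box I d. g (\<alpha>(i := e)))"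
proof -
  have "(\<Sum>\<beta>\<in>box (insert i I) d. g \<beta>) = (\<Sum>z\<in>{..d} \<times> box I d. g ((\<lambda>(e, \<alpha>). \<alpha>(i := e)) z))"
    unfolding box_def PiE_insert_eq
    by (subst sum.reindex) (use inj_combinator[OF assms, of "\<lambda>_. {..d}"] in auto)
  also have "\<dots> = (\<Sum>e\<le>d. \<Sum>\<alpha>\<in>box I d. g (\<alpha>(i := e)))"
    by (simp add: sum.cartesian_product case_prod_unfold)
  finally show ?thesis .
qed

lemma monom_at_insert:
  assumes "finite I" "i \<notin> I"
  shows "monom_at (insert i I) (\<alpha>(i := e)) x = x i ^ e * monom_at I \<alpha> x"
proof -
  have "(\<Prod>j\<in>I. x j ^ (\<alpha>(i := e)) j) = (\<Prod>j\<in>I. x j ^ \<alpha> j)"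
    by (rule prod.cong) (use assms in auto)
  with assms show ?thesis by (simp add: monom_at_def)
qed

lemma monom_at_cong: "(\<And>i. i \<in> I \<Longrightarrow> x i = y i) \<Longrightarrow> monom_at I \<alpha> x = monom_at I \<alpha> y"
  by (simp add: monom_at_def)

lemma monom_at_times: "monom_at I \<alpha> x * monom_at I \<beta> x = monom_at I (\<lambda>i\<in>I. \<alpha> i + \<beta> i) x"
  by (simp add: monom_at_def power_add prod.distrib)

lemma restrict_add_box: "\<alpha> \<in> box I d \<Longrightarrow> \<beta> \<in> box I e \<Longrightarrow> (\<lambda>i\<in>I. \<alpha> i + \<beta> i) \<in> box I (d + e)"
  by (auto simp: box_def PiE_iff intro!: add_mono)

lemma poly_leI: "f = (\<lambda>x. \<Sum>\<alpha>\<in>box I d. c \<alpha> * monom_at I \<alpha> x) \<Longrightarrow> f \<in> poly_le I d"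
  by (auto simp: poly_le_def)

lemma poly_leE:
  assumes "f \<in> poly_le I d"
  obtains c where "\<And>x. f x = (\<Sum>\<alpha>\<in>box I d. c \<alpha> * monom_at I \<alpha> x)"
  using assms by (auto simp: poly_le_def)

lemma poly_le_monomial:
  assumes "finite I" "\<alpha> \<in> box I d"
  shows "(\<lambda>x. k * monom_at I \<alpha> x) \<in> poly_le I d"
proof (rule poly_leI[where c = "\<lambda>\<beta>. if \<beta> = \<alpha> then k else 0"], rule ext)
  fix x :: "'a \<Rightarrow> complex"
  have "(\<Sum>\<beta>\<in>box I d. (if \<beta> = \<alpha> then k else 0) * monom_at I \<beta> x) =
      (\<Sum>\<beta>\<in>box I d. if \<beta> = \<alpha> then k * monom_at I \<beta> x else 0)"
    by (rule sum.cong) auto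
  also have "\<dots> = k * monom_at I \<alpha> x"
    using assms by (subst sum.delta) auto
  finally show "k * monom_at I \<alpha> x = (\<Sum>\<beta>\<in>box I d. (if \<beta> = \<alpha> then k else 0) * monom_at I \<beta> x)" by simp
qed

lemma poly_le_add:
  assumes "f \<in> poly_le I d" "g \<in> poly_le I d"
  shows "(\<lambda>x. f x + g x) \<in> poly_le I d"
proof -
  obtain a where "\<And>x. f x = (\<Sum>\<alpha>\<in>box I d. a \<alpha> * monom_at I \<alpha> x)"
    by (rule poly_leE[OF assms(1)]) blast
  moreover obtain b where "\<And>x. g x = (\<Sum>\<alpha>\<in>box I d. b \<alpha> * monom_at I \<alpha> x)"
    by (rule poly_leE[OF assms(2)]) blast
  ultimately show ?thesis
    by (intro poly_leI[where c = "\<lambda>\<alpha>. a \<alpha> + b \<alpha>"]) (simp add: distrib_right sum.distrib)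
qed

lemma poly_le_zero: "(\<lambda>_. 0) \<in> poly_le I d"
  by (rule poly_leI[where c = "\<lambda>_. 0"]) simp

lemma poly_le_sum:
  assumes "\<And>a. a \<in> A \<Longrightarrow> f a \<in> poly_le I d"
  shows "(\<lambda>x. \<Sum>a\<in>A. f a x) \<in> poly_le I d"
  using assms by (induction A rule: infinite_finite_induct) (auto simp: poly_le_zero poly_le_add)

lemma poly_le_mult:
  assumes "finite I" "f \<in> poly_le I d" "g \<in> poly_le I e"
  shows "(\<lambda>x. f x * g x) \<in> poly_le I (d + e)"
proof -
  obtain a where a: "\<And>x. f x = (\<Sum>\<alpha>\<in>box I d. a \<alpha> * monom_at I \<alpha> x)"
    by (rule poly_leE[OF assms(2)]) blast
  obtain b where b: "\<And>x. g x = (\<Sum>\<alpha>\<in>box I e. b \<alpha> * monom_at I \<alpha> x)"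
    by (rule poly_leE[OF assms(3)]) blast
  have "f x * g x = (\<Sum>\<alpha>\<in>box I d. \<Sum>\<beta>\<in>box I e. (a \<alpha> * b \<beta>) * monom_at I (\<lambda>i\<in>I. \<alpha> i + \<beta> i) x)" for x
    unfolding a b sum_product
    by (intro sum.cong refl) (simp flip: monom_at_times)
  hence "(\<lambda>x. f x * g x) =
      (\<lambda>x. \<Sum>\<alpha>\<in>box I d. \<Sum>\<beta>\<in>box I e. (a \<alpha> * b \<beta>) * monom_at I (\<lambda>i\<in>I. \<alpha> i + \<beta> i) x)" by blast
  thus ?thesis
    using assms by (auto intro!: poly_le_sum poly_le_monomial restrict_add_box)
qed

lemma poly_le_mono:
  assumes "finite I" "d \<le> e" "f \<in> poly_le I d"
  shows "f \<in> poly_le I e"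
proof -
  obtain a where a: "\<And>x. f x = (\<Sum>\<alpha>\<in>box I d. a \<alpha> * monom_at I \<alpha> x)"
    by (rule poly_leE[OF assms(3)]) blast
  have "(\<lambda>x. \<Sum>\<alpha>\<in>box I d. a \<alpha> * monom_at I \<alpha> x) \<in> poly_le I e"
    using assms box_mono[of d e I] by (intro poly_le_sum poly_le_monomial) auto
  moreover have "f = (\<lambda>x. \<Sum>\<alpha>\<in>box I d. a \<alpha> * monom_at I \<alpha> x)" using a by blast
  ultimately show ?thesis by simp
qed

lemma poly_le_const:
  assumes "finite I"
  shows "(\<lambda>_. c) \<in> poly_le I d"
  using poly_le_monomial[OF assms, of "\<lambda>i\<in>I. 0" d c] by (simp add: box_def monom_at_def)

lemma poly_le_coord:
  assumes "finite I" "i \<in> I"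
  shows "(\<lambda>x. x i) \<in> poly_le I 1"
proof -
  have "monom_at I (\<lambda>j\<in>I. if j = i then 1 else 0) x = x i" for x :: "'a \<Rightarrow> complex"
  proof -
    have "monom_at I (\<lambda>j\<in>I. if j = i then 1 else 0) x = (\<Prod>j\<in>I. if j = i then x j else 1)"
      unfolding monom_at_def by (rule prod.cong) auto
    thus ?thesis using assms by simp
  qed
  with poly_le_monomial[OF assms(1), of "\<lambda>j\<in>I. if j = i then 1 else 0" 1 1] show ?thesis
    by (simp add: box_def)
qed

lemma poly_le_power:
  assumes "finite I" "f \<in> poly_le I d"
  shows "(\<lambda>x. f x ^ k) \<in> poly_le I (d * k)"
proof (induction k)
  case 0
  show ?case using poly_le_const[OF assms(1), of 1 0] by simp
next
  case (Suc k)
  from poly_le_mult[OF assms(1) assms(2) this] show ?case by (simp add: add.commute)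
qed

lemma poly_le_monom_at:
  assumes "finite I" "finite J" "\<And>j. j \<in> J \<Longrightarrow> f j \<in> poly_le I d" "\<beta> \<in> box J e"
  shows "(\<lambda>x. monom_at J \<beta> (\<lambda>j. f j x)) \<in> poly_le I (card J * (d * e))"
proof -
  have "finite K \<Longrightarrow> K \<subseteq> J \<Longrightarrow> (\<lambda>x. \<Prod>j\<in>K. f j x ^ \<beta> j) \<in> poly_le I (card K * (d * e))" for K
  proof (induction K rule: finite_induct)
    case empty
    show ?case using poly_le_const[OF assms(1)] by simp
  next
    case (insert j K)
    have "d * \<beta> j \<le> d * e" using insert.prems assms(4) by (auto simp: box_def PiE_iff)
    hence "(\<lambda>x. f j x ^ \<beta> j) \<in> poly_le I (d * e)"
      using poly_le_mono[OF assms(1) _ poly_le_power[OF assms(1) assms(3)]] insert.prems by blast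
    from poly_le_mult[OF assms(1) this insert.IH] insert show ?case by simp
  qed
  thus ?thesis using assms(2) unfolding monom_at_def by blast
qed

lemma pfun_sum:
  assumes "\<And>a. a \<in> A \<Longrightarrow> f a \<in> pfun I"
  shows "(\<lambda>x. \<Sum>a\<in>A. f a x) \<in> pfun I"
  using assms by (induction A rule: infinite_finite_induct) (auto intro: pfun.intros)

lemma pfun_prod:
  assumes "\<And>a. a \<in> A \<Longrightarrow> f a \<in> pfun I"
  shows "(\<lambda>x. \<Prod>a\<in>A. f a x) \<in> pfun I"
  using assms by (induction A rule: infinite_finite_induct) (auto intro: pfun.intros)

lemma pfun_power: "f \<in> pfun I \<Longrightarrow> (\<lambda>x. f x ^ k) \<in> pfun I"
  by (induction k) (auto intro: pfun.intros)

lemma pfun_diff: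
  assumes "f \<in> pfun I" "g \<in> pfun I"
  shows "(\<lambda>x. f x - g x) \<in> pfun I"
  using pfun.add[OF assms(1) pfun.mult[OF pfun.const[of "-1"] assms(2)]] by simp

lemma pfun_monom_at: "(\<And>j. j \<in> J \<Longrightarrow> f j \<in> pfun I) \<Longrightarrow> (\<lambda>x. monom_at J \<beta> (\<lambda>j. f j x)) \<in> pfun I"
  unfolding monom_at_def by (intro pfun_prod pfun_power) auto

lemma pfun_poly_le:
  assumes "finite I" "f \<in> pfun I"
  shows "\<exists>d. f \<in> poly_le I d"
  using assms(2)
proof induction
  case (const c)
  show ?case using poly_le_const[OF assms(1)] by blast
next
  case (coord i)
  show ?case using poly_le_coord[OF assms(1) coord] by blast
next
  case (add f g)
  then obtain d e where "f \<in> poly_le I d" "g \<in> poly_le I e" by blast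
  hence "f \<in> poly_le I (max d e)" "g \<in> poly_le I (max d e)"
    using poly_le_mono[OF assms(1)] by (meson max.cobounded1 max.cobounded2)+
  thus ?case using poly_le_add by blast
next
  case (mult f g)
  thus ?case using poly_le_mult[OF assms(1)] by blast
qed

lemma pfun_finite_poly_le:
  assumes "finite I" "finite J" "\<And>j. j \<in> J \<Longrightarrow> f j \<in> pfun I"
  obtains d where "\<And>j. j \<in> J \<Longrightarrow> f j \<in> poly_le I d"
proof -
  have "\<forall>j\<in>J. \<exists>d. f j \<in> poly_le I d" using assms pfun_poly_le by blast
  then obtain d where d: "\<forall>j\<in>J. f j \<in> poly_le I (d j)" by metis
  have "f j \<in> poly_le I (Max (d ` J))" if "j \<in> J" for j
    using poly_le_mono[OF assms(1), of "d j"] d that assms(2) by auto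
  with that show thesis by blast
qed

section \<open>Counting unknowns, independence of monomials, restriction to lines\<close>

text \<open>All dimension counts rest on this. The induction eliminates one equation: if some
  unknown \<open>p\<close> occurs in it, a multiple of its coefficient vector is subtracted from the
  others, and one equation disappears together with one unknown.\<close>

lemma underdetermined_system:
  fixes c :: "'a \<Rightarrow> 'b \<Rightarrow> 'k::field"
  assumes "finite B" "finite A" "card B < card A"
  shows "\<exists>a. (\<exists>\<alpha>\<in>A. a \<alpha> \<noteq> 0) \<and> (\<forall>\<beta>\<in>B. (\<Sum>\<alpha>\<in>A. a \<alpha> * c \<alpha> \<beta>) = 0)"
  using assms
proof (induction B arbitrary: A c rule: finite_induct)
  case empty
  then obtain \<alpha> where "\<alpha> \<in> A" by fastforce
  thus ?case by (intro exI[of _ "\<lambda>_. 1"]) auto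
next
  case (insert b B)
  show ?case
  proof (cases "\<forall>\<alpha>\<in>A. c \<alpha> b = 0")
    case True
    have "card B < card A" using insert by simp
    then obtain a where "\<exists>\<alpha>\<in>A. a \<alpha> \<noteq> 0" "\<forall>\<beta>\<in>B. (\<Sum>\<alpha>\<in>A. a \<alpha> * c \<alpha> \<beta>) = 0"
      using insert.IH[OF insert.prems(1)] by blast
    with True show ?thesis by (intro exI[of _ a]) auto
  next
    case False
    then obtain p where p: "p \<in> A" "c p b \<noteq> 0" by blast
    have "card B < card (A - {p})" using insert p by simp
    with insert.IH[of "A - {p}" "\<lambda>\<alpha> \<beta>. c \<alpha> \<beta> - c \<alpha> b / c p b * c p \<beta>"] insert.prems(1)
    obtain a where a: "\<exists>\<alpha>\<in>A - {p}. a \<alpha> \<noteq> 0"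
      "\<forall>\<beta>\<in>B. (\<Sum>\<alpha>\<in>A - {p}. a \<alpha> * (c \<alpha> \<beta> - c \<alpha> b / c p b * c p \<beta>)) = 0" by auto
    \<comment> \<open>The value of the eliminated unknown that makes equation \<open>b\<close>
      hold.\<close>
    define s where "s = - (\<Sum>\<alpha>\<in>A - {p}. a \<alpha> * c \<alpha> b) / c p b"
    have split: "(\<Sum>\<alpha>\<in>A. (a(p := s)) \<alpha> * c \<alpha> \<beta>) = s * c p \<beta> + (\<Sum>\<alpha>\<in>A - {p}. a \<alpha> * c \<alpha> \<beta>)" for \<beta>
    proof -
      have "(\<Sum>\<alpha>\<in>A - {p}. (a(p := s)) \<alpha> * c \<alpha> \<beta>) = (\<Sum>\<alpha>\<in>A - {p}. a \<alpha> * c \<alpha> \<beta>)"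
        by (rule sum.cong) auto
      thus ?thesis using insert.prems(1) p by (subst sum.remove[of _ p]) auto
    qed
    have "(\<Sum>\<alpha>\<in>A. (a(p := s)) \<alpha> * c \<alpha> \<beta>) = 0" if "\<beta> \<in> insert b B" for \<beta>
    proof (cases "\<beta> = b")
      case True
      thus ?thesis unfolding split using p by (simp add: s_def)
    next
      case False
      have "s * c p \<beta> = - (\<Sum>\<alpha>\<in>A - {p}. a \<alpha> * (c \<alpha> b / c p b * c p \<beta>))"
        by (simp add: s_def sum_distrib_right sum_distrib_left sum_divide_distrib mult.assoc sum_negf)
      hence "(\<Sum>\<alpha>\<in>A. (a(p := s)) \<alpha> * c \<alpha> \<beta>) = (\<Sum>\<alpha>\<in>A - {p}. a \<alpha> * (c \<alpha> \<beta> - c \<alpha> b / c p b * c p \<beta>))"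
        unfolding split by (simp add: right_diff_distrib sum_subtractf)
      with a(2) False that show ?thesis by auto
    qed
    moreover have "\<exists>\<alpha>\<in>A. (a(p := s)) \<alpha> \<noteq> 0" using a(1) by auto
    ultimately show ?thesis by blast
  qed
qed

lemma univariate_coeffs_zero:
  fixes c :: "nat \<Rightarrow> complex"
  assumes "\<And>t. (\<Sum>e\<le>d. c e * t ^ e) = 0" "e \<le> d"
  shows "c e = 0"
proof -
  have "poly (\<Sum>e\<le>d. monom (c e) e) t = 0" for t
    using assms(1) by (simp add: poly_sum poly_monom)
  hence "(\<Sum>e\<le>d. monom (c e) e) = 0" using poly_all_0_iff_0 by blast
  hence "coeff (\<Sum>e\<le>d. monom (c e) e) e = 0" by simp
  thus ?thesis using assms(2) by (simp add: coeff_sum)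
qed

text \<open>With all variables but one fixed, the relation is a polynomial in one variable. Its
  coefficients vanish for every choice of the other variables, so they are relations in fewer
  variables.\<close>

lemma monom_at_independent:
  fixes c :: "('i \<Rightarrow> nat) \<Rightarrow> complex"
  assumes "finite I" "\<And>x. (\<Sum>\<alpha>\<in>box I d. c \<alpha> * monom_at I \<alpha> x) = 0" "\<alpha> \<in> box I d"
  shows "c \<alpha> = 0"
  using assms
proof (induction I arbitrary: c \<alpha> rule: finite_induct)
  case empty
  thus ?case by (simp add: box_def monom_at_def)
next
  case (insert i I)
  have "(\<Sum>\<gamma>\<in>box I d. c (\<gamma>(i := e)) * monom_at I \<gamma> x) = 0" if "e \<le> d" for e x
  proof (rule univariate_coeffs_zero[OF _ that])
    fix t
    have "0 = (\<Sum>\<beta>\<in>box (insert i I) d. c \<beta> * monom_at (insert i I) \<beta> (x(i := t)))"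
      using insert.prems(1) by simp
    also have "\<dots> = (\<Sum>e\<le>d. \<Sum>\<gamma>\<in>box I d. c (\<gamma>(i := e)) * (t ^ e * monom_at I \<gamma> x))"
    proof -
      have "monom_at I \<gamma> (x(i := t)) = monom_at I \<gamma> x" for \<gamma>
        by (rule monom_at_cong) (use insert in auto)
      thus ?thesis using insert by (simp add: sum_box_insert monom_at_insert)
    qed
    also have "\<dots> = (\<Sum>e\<le>d. (\<Sum>\<gamma>\<in>box I d. c (\<gamma>(i := e)) * monom_at I \<gamma> x) * t ^ e)"
      by (simp add: sum_distrib_left sum_distrib_right mult_ac)
    finally show "(\<Sum>e\<le>d. (\<Sum>\<gamma>\<in>box I d. c (\<gamma>(i := e)) * monom_at I \<gamma> x) * t ^ e) = 0" by simp
  qed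
  hence "c (\<gamma>(i := e)) = 0" if "e \<le> d" "\<gamma> \<in> box I d" for e \<gamma>
    using insert.IH[of "\<lambda>\<gamma>. c (\<gamma>(i := e))" \<gamma>] that by blast
  moreover obtain e \<gamma> where "\<alpha> = \<gamma>(i := e)" "e \<le> d" "\<gamma> \<in> box I d"
    using insert.prems(2) unfolding box_def PiE_insert_eq by auto
  ultimately show ?case by blast
qed

lemma pfun_line:
  assumes "f \<in> pfun I"
  obtains q where "\<And>t. f (\<lambda>i. x i + t * (y i - x i)) = poly q t"
proof -
  have "\<exists>q. \<forall>t. f (\<lambda>i. x i + t * (y i - x i)) = poly q t"
    using assms
  proof induction
    case (const c)
    show ?case by (intro exI[of _ "[:c:]"]) simp
  next
    case (coord i)
    show ?case by (intro exI[of _ "[:x i, y i - x i:]"]) simp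
  next
    case (add f g)
    then obtain q r where "\<forall>t. f (\<lambda>i. x i + t * (y i - x i)) = poly q t"
      "\<forall>t. g (\<lambda>i. x i + t * (y i - x i)) = poly r t" by blast
    thus ?case by (intro exI[of _ "q + r"]) simp
  next
    case (mult f g)
    then obtain q r where "\<forall>t. f (\<lambda>i. x i + t * (y i - x i)) = poly q t"
      "\<forall>t. g (\<lambda>i. x i + t * (y i - x i)) = poly r t" by blast
    thus ?case by (intro exI[of _ "q * r"]) simp
  qed
  with that show thesis by blast
qed

text \<open>On the line through a point where \<open>f\<close> is nonzero and one where
  \<open>g\<close> is nonzero, both become nonzero polynomials in one variable.\<close>

lemma pfun_domain:
  assumes "f \<in> pfun I" "g \<in> pfun I" "\<And>x. f x * g x = 0"
  shows "(\<forall>x. f x = 0) \<or> (\<forall>x. g x = 0)"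
proof (rule ccontr)
  assume "\<not> ?thesis"
  then obtain x y where xy: "f x \<noteq> 0" "g y \<noteq> 0" by blast
  obtain q where q: "\<And>t. f (\<lambda>i. x i + t * (y i - x i)) = poly q t" using pfun_line[OF assms(1)] by blast
  obtain r where r: "\<And>t. g (\<lambda>i. x i + t * (y i - x i)) = poly r t" using pfun_line[OF assms(2)] by blast
  have "poly q 0 \<noteq> 0" "poly r 1 \<noteq> 0" using xy by (simp_all flip: q r)
  hence "q * r \<noteq> 0" by auto
  then obtain t where "poly (q * r) t \<noteq> 0" using poly_all_0_iff_0 by blast
  with assms(3)[of "\<lambda>i. x i + t * (y i - x i)"] show False by (simp add: q r)
qed

section \<open>Ideals of polynomial functions and their zeros\<close>

definition pideal :: "'i set \<Rightarrow> (('i \<Rightarrow> complex) \<Rightarrow> complex) set \<Rightarrow> bool" where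
  "pideal I P \<longleftrightarrow> P \<subseteq> pfun I \<and> (\<lambda>_. 0) \<in> P \<and> (\<forall>f\<in>P. \<forall>g\<in>P. (\<lambda>x. f x + g x) \<in> P) \<and>
    (\<forall>f\<in>P. \<forall>r\<in>pfun I. (\<lambda>x. r x * f x) \<in> P)"

lemma pideal_add: "pideal I P \<Longrightarrow> f \<in> P \<Longrightarrow> g \<in> P \<Longrightarrow> (\<lambda>x. f x + g x) \<in> P"
  by (simp add: pideal_def)

lemma pideal_mult: "pideal I P \<Longrightarrow> r \<in> pfun I \<Longrightarrow> f \<in> P \<Longrightarrow> (\<lambda>x. r x * f x) \<in> P"
  by (simp add: pideal_def)

lemma pideal_zero: "pideal I P \<Longrightarrow> (\<lambda>_. 0) \<in> P"
  by (simp add: pideal_def)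

lemma pideal_pfun: "pideal I P \<Longrightarrow> f \<in> P \<Longrightarrow> f \<in> pfun I"
  by (auto simp: pideal_def)

lemma pideal_diff:
  assumes "pideal I P" "f \<in> P" "g \<in> P"
  shows "(\<lambda>x. f x - g x) \<in> P"
  using pideal_add[OF assms(1,2) pideal_mult[OF assms(1) pfun.const[of "-1"] assms(3)]] by simp

lemma pideal_sum:
  assumes "pideal I P" "\<And>a. a \<in> A \<Longrightarrow> f a \<in> P"
  shows "(\<lambda>x. \<Sum>a\<in>A. f a x) \<in> P"
  using assms(2)
  by (induction A rule: infinite_finite_induct)
    (auto simp: pideal_zero[OF assms(1)] intro: pideal_add[OF assms(1)])

definition adjoin :: "'i set \<Rightarrow> (('i \<Rightarrow> complex) \<Rightarrow> complex) set \<Rightarrow> (('i \<Rightarrow> complex) \<Rightarrow> complex) \<Rightarrow>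
    (('i \<Rightarrow> complex) \<Rightarrow> complex) set" where
  "adjoin I P a = {f. \<exists>p\<in>P. \<exists>r\<in>pfun I. \<forall>x. f x = p x + r x * a x}"

lemma adjoinI: "p \<in> P \<Longrightarrow> r \<in> pfun I \<Longrightarrow> (\<And>x. f x = p x + r x * a x) \<Longrightarrow> f \<in> adjoin I P a"
  unfolding adjoin_def by blast

lemma adjoinE:
  assumes "f \<in> adjoin I P a"
  obtains p r where "p \<in> P" "r \<in> pfun I" "f = (\<lambda>x. p x + r x * a x)"
proof -
  from assms obtain p r where *: "p \<in> P" "r \<in> pfun I" "\<forall>x. f x = p x + r x * a x"
    unfolding adjoin_def by blast
  from *(3) have "f = (\<lambda>x. p x + r x * a x)" by (intro ext) simp
  with * that show thesis by blast
qed

lemma pideal_adjoin: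
  assumes "pideal I P" "a \<in> pfun I"
  shows "pideal I (adjoin I P a)"
  unfolding pideal_def
proof (intro conjI ballI)
  show "adjoin I P a \<subseteq> pfun I"
    by (auto elim!: adjoinE intro!: pfun.add pfun.mult assms(2) intro: pideal_pfun[OF assms(1)])
  show "(\<lambda>_. 0) \<in> adjoin I P a"
    by (rule adjoinI[OF pideal_zero[OF assms(1)] pfun.const[of 0]]) simp
next
  fix f g
  assume "f \<in> adjoin I P a" "g \<in> adjoin I P a"
  then obtain p r p' r' where *: "f = (\<lambda>x. p x + r x * a x)" "p \<in> P" "r \<in> pfun I"
    "g = (\<lambda>x. p' x + r' x * a x)" "p' \<in> P" "r' \<in> pfun I" by (auto elim!: adjoinE)
  show "(\<lambda>x. f x + g x) \<in> adjoin I P a"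
    by (rule adjoinI[OF pideal_add[OF assms(1) *(2,5)] pfun.add[OF *(3,6)]])
      (simp add: * algebra_simps)
next
  fix f s
  assume "f \<in> adjoin I P a" and s: "s \<in> pfun I"
  then obtain p r where *: "f = (\<lambda>x. p x + r x * a x)" "p \<in> P" "r \<in> pfun I" by (auto elim!: adjoinE)
  show "(\<lambda>x. s x * f x) \<in> adjoin I P a"
    by (rule adjoinI[OF pideal_mult[OF assms(1) s *(2)] pfun.mult[OF s *(3)]])
      (simp add: * algebra_simps)
qed

text \<open>The last clause is the form in which maximality is used: modulo \<open>P\<close> and
  after inverting \<open>h\<close>, every element outside \<open>P\<close> is a unit. Keeping the
  powers of \<open>h\<close> explicit replaces localization and the extra variable of the
  Rabinowitsch trick.\<close>

definition maximal_avoiding :: "'i set \<Rightarrow> (('i \<Rightarrow> complex) \<Rightarrow> complex) \<Rightarrow> (('i \<Rightarrow> complex) \<Rightarrow> complex) set \<Rightarrow> bool" where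
  "maximal_avoiding I h P \<longleftrightarrow> pideal I P \<and> h \<in> pfun I \<and> (\<forall>k. (\<lambda>x. h x ^ k) \<notin> P) \<and>
    (\<forall>a\<in>pfun I - P. \<exists>u\<in>pfun I. \<exists>k. (\<lambda>x. h x ^ k - u x * a x) \<in> P)"

lemma maximal_avoidingD:
  assumes "maximal_avoiding I h P" "a \<in> pfun I" "a \<notin> P"
  shows "\<exists>u\<in>pfun I. \<exists>k. (\<lambda>x. h x ^ k - u x * a x) \<in> P"
  using assms by (simp add: maximal_avoiding_def)

text \<open>Zorn's lemma. Enlarging the maximal ideal by \<open>a\<close> must capture a power of
  \<open>h\<close>, and this membership is the required unit relation.\<close>

lemma maximal_pideal_avoiding_powers:
  assumes "pideal I J" "h \<in> pfun I" "\<And>k. (\<lambda>x. h x ^ k) \<notin> J"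
  obtains P where "J \<subseteq> P" "maximal_avoiding I h P"
proof -
  define \<A> where "\<A> = {P. pideal I P \<and> J \<subseteq> P \<and> (\<forall>k. (\<lambda>x. h x ^ k) \<notin> P)}"
  have "\<exists>M\<in>\<A>. \<forall>X\<in>\<A>. M \<subseteq> X \<longrightarrow> X = M"
  proof (rule subset_Zorn_nonempty)
    show "\<A> \<noteq> {}" using assms by (auto simp: \<A>_def)
    fix C assume C: "C \<noteq> {}" "subset.chain \<A> C"
    hence CA: "C \<subseteq> \<A>" by (simp add: subset_chain_def)
    have "pideal I (\<Union>C)"
      unfolding pideal_def
    proof (intro conjI ballI)
      show "\<Union>C \<subseteq> pfun I" using CA by (auto simp: \<A>_def pideal_def)
      show "(\<lambda>_. 0) \<in> \<Union>C" using CA C(1) by (auto simp: \<A>_def pideal_def)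
    next
      fix f g assume "f \<in> \<Union>C" "g \<in> \<Union>C"
      then obtain X Y where XY: "X \<in> C" "Y \<in> C" "f \<in> X" "g \<in> Y" by blast
      have "X \<subseteq> Y \<or> Y \<subseteq> X" using C(2) XY by (auto simp: subset_chain_def)
      then obtain Z where "Z \<in> C" "f \<in> Z" "g \<in> Z" using XY by blast
      moreover from this have "pideal I Z" using CA by (auto simp: \<A>_def)
      ultimately show "(\<lambda>x. f x + g x) \<in> \<Union>C" using pideal_add[of I Z f g] by blast
    next
      fix f r assume "f \<in> \<Union>C" "r \<in> pfun I"
      then obtain X where X: "X \<in> C" "f \<in> X" by blast
      hence "pideal I X" using CA by (auto simp: \<A>_def)
      with X \<open>r \<in> pfun I\<close> show "(\<lambda>x. r x * f x) \<in> \<Union>C" using pideal_mult[of I X r f] by blast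
    qed
    thus "\<Union>C \<in> \<A>" using CA C(1) unfolding \<A>_def by blast
  qed
  then obtain P where P: "P \<in> \<A>" "\<And>X. X \<in> \<A> \<Longrightarrow> P \<subseteq> X \<Longrightarrow> X = P" by blast
  have id: "pideal I P" using P(1) by (simp add: \<A>_def)
  have "\<exists>u\<in>pfun I. \<exists>k. (\<lambda>x. h x ^ k - u x * a x) \<in> P" if a: "a \<in> pfun I" "a \<notin> P" for a
  proof -
    have PQ: "P \<subseteq> adjoin I P a"
    proof
      fix p assume "p \<in> P"
      thus "p \<in> adjoin I P a" by (rule adjoinI[OF _ pfun.const[of 0]]) simp
    qed
    have "a \<in> adjoin I P a"
      by (rule adjoinI[OF pideal_zero[OF id] pfun.const[of 1]]) simp
    hence "adjoin I P a \<notin> \<A>" using P(2)[of "adjoin I P a"] PQ a by blast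
    moreover have "pideal I (adjoin I P a)" by (rule pideal_adjoin[OF id a(1)])
    ultimately obtain k where "(\<lambda>x. h x ^ k) \<in> adjoin I P a" using PQ P(1) by (auto simp: \<A>_def)
    then obtain p r where pr: "p \<in> P" "r \<in> pfun I" "(\<lambda>x. h x ^ k) = (\<lambda>x. p x + r x * a x)"
      by (rule adjoinE)
    have "(\<lambda>x. h x ^ k - r x * a x) = p" using fun_cong[OF pr(3)] by simp
    hence "(\<lambda>x. h x ^ k - r x * a x) \<in> P" using pr(1) by simp
    with pr(2) show ?thesis by blast
  qed
  with P(1) id assms(2) have "maximal_avoiding I h P" by (simp add: \<A>_def maximal_avoiding_def)
  moreover have "J \<subseteq> P" using P(1) by (simp add: \<A>_def)
  ultimately show thesis using that by blast
qed

text \<open>If \<open>u a\<close> and \<open>v b\<close> agree with powers of \<open>h\<close>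
  modulo \<open>P\<close>, then so does \<open>u v a b\<close>. Hence \<open>a b\<close> in
  \<open>P\<close> would put a power of \<open>h\<close> into \<open>P\<close>.\<close>

lemma prime_of_maximal_avoiding_powers:
  assumes max: "maximal_avoiding I h P" and ab: "a \<in> pfun I" "b \<in> pfun I" "(\<lambda>x. a x * b x) \<in> P"
  shows "a \<in> P \<or> b \<in> P"
proof (rule ccontr)
  assume "\<not> ?thesis"
  have P: "pideal I P" and h: "h \<in> pfun I" using max by (simp_all add: maximal_avoiding_def)
  obtain u k v l where u: "u \<in> pfun I" "(\<lambda>x. h x ^ k - u x * a x) \<in> P"
    and v: "v \<in> pfun I" "(\<lambda>x. h x ^ l - v x * b x) \<in> P"
    using max ab \<open>\<not> (a \<in> P \<or> b \<in> P)\<close> unfolding maximal_avoiding_def by blast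
  note 1 = pideal_mult[OF P pfun_power[OF h, of l] u(2)]
  note 2 = pideal_mult[OF P pfun.mult[OF u(1) ab(1)] v(2)]
  note 3 = pideal_mult[OF P pfun.mult[OF u(1) v(1)] ab(3)]
  from pideal_add[OF P pideal_add[OF P 1 2] 3] have "(\<lambda>x. h x ^ (k + l)) \<in> P" by (simp add: algebra_simps power_add)
  with max show False by (simp add: maximal_avoiding_def)
qed

section \<open>Residue fields and the Nullstellensatz\<close>

text \<open>Pigeonhole for uncountably many points and countably many values. Applied to the
  exponent and degree of an inverse of \<open>g - z\<close>, it puts infinitely many inverses into
  one finite-dimensional space.\<close>

lemma infinite_level_set:
  fixes \<kappa> :: "complex \<Rightarrow> 'b::countable"
  obtains y where "infinite {z. \<kappa> z = y}"
proof -
  have "uncountable (UNIV :: complex set)"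
  proof
    assume "countable (UNIV :: complex set)"
    hence "countable (range complex_of_real)" by (rule countable_subset[rotated]) simp
    hence "countable (UNIV :: real set)" by (rule countable_image_inj_on) (auto intro: inj_onI)
    thus False using uncountable_UNIV_real by blast
  qed
  moreover have "(UNIV :: complex set) = (\<Union>y\<in>range \<kappa>. {z. \<kappa> z = y})" by auto
  ultimately have "\<exists>y. infinite {z. \<kappa> z = y}"
    using countable_UN[of "range \<kappa>" "\<lambda>y. {z. \<kappa> z = y}"] countable_finite by (metis countableI_type)
  with that show thesis by blast
qed

text \<open>An ideal that is maximal among those avoiding the powers of \<open>h\<close> has residue field \<open>\<complex>\<close> after
  inverting \<open>h\<close>: otherwise the uncountably many inverses of \<open>g - \<lambda>\<close> would be linearly independent in a
  space of countable dimension.\<close>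

lemma constant_modulo_maximal:
  assumes I: "finite I" and max: "maximal_avoiding I h P" and g: "g \<in> pfun I"
  shows "\<exists>w. (\<lambda>x. g x - w) \<in> P"
proof (rule ccontr)
  assume no: "\<not> ?thesis"
  have P: "pideal I P" and h: "h \<in> pfun I" and avoid: "\<And>k. (\<lambda>x. h x ^ k) \<notin> P"
    using max by (simp_all add: maximal_avoiding_def)
  have glin: "(\<lambda>x. g x - z) \<in> pfun I" for z by (intro pfun_diff g pfun.const)
  have gq: "(\<lambda>x. poly q (g x)) \<in> pfun I" for q
    by (induction q) (auto intro!: pfun.intros g)
  have "\<exists>u k d. u \<in> poly_le I d \<and> (\<lambda>x. h x ^ k - u x * (g x - z)) \<in> P" for z
  proof -
    have "(\<lambda>x. g x - z) \<notin> P" using no by blast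
    from maximal_avoidingD[OF max glin this]
    obtain u k where "u \<in> pfun I" "(\<lambda>x. h x ^ k - u x * (g x - z)) \<in> P" by blast
    thus ?thesis using pfun_poly_le[OF I] by blast
  qed
  then obtain u k d where u: "\<And>z. u z \<in> poly_le I (d z)"
    and uP: "\<And>z. (\<lambda>x. h x ^ k z - u z x * (g x - z)) \<in> P" by metis
  obtain y where y: "infinite {z. (k z, d z) = y}" by (rule infinite_level_set)
  then obtain \<Lambda> where \<Lambda>: "\<Lambda> \<subseteq> {z. (k z, d z) = y}" "finite \<Lambda>" "card \<Lambda> = Suc (card (box I (snd y)))"
    using infinite_arbitrarily_large by blast
  have "\<forall>z\<in>\<Lambda>. \<exists>c. \<forall>x. u z x = (\<Sum>\<alpha>\<in>box I (snd y). c \<alpha> * monom_at I \<alpha> x)"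
  proof
    fix z assume "z \<in> \<Lambda>"
    hence "u z \<in> poly_le I (snd y)" using u[of z] \<Lambda>(1) by auto
    thus "\<exists>c. \<forall>x. u z x = (\<Sum>\<alpha>\<in>box I (snd y). c \<alpha> * monom_at I \<alpha> x)" by (auto simp: poly_le_def)
  qed
  then obtain c where c: "\<And>z x. z \<in> \<Lambda> \<Longrightarrow> u z x = (\<Sum>\<alpha>\<in>box I (snd y). c z \<alpha> * monom_at I \<alpha> x)" by metis
  obtain a where a: "\<exists>z\<in>\<Lambda>. a z \<noteq> 0" "\<forall>\<alpha>\<in>box I (snd y). (\<Sum>z\<in>\<Lambda>. a z * c z \<alpha>) = 0"
    using underdetermined_system[of "box I (snd y)" \<Lambda> c] I \<Lambda> by auto
  have au: "(\<Sum>z\<in>\<Lambda>. a z * u z x) = 0" for x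
  proof -
    have "(\<Sum>z\<in>\<Lambda>. a z * u z x) = (\<Sum>z\<in>\<Lambda>. \<Sum>\<alpha>\<in>box I (snd y). a z * c z \<alpha> * monom_at I \<alpha> x)"
      by (simp add: c sum_distrib_left mult.assoc)
    also have "\<dots> = (\<Sum>\<alpha>\<in>box I (snd y). (\<Sum>z\<in>\<Lambda>. a z * c z \<alpha>) * monom_at I \<alpha> x)"
      by (subst sum.swap) (simp add: sum_distrib_right)
    finally show ?thesis using a(2) by simp
  qed
  \<comment> \<open>The numerator of the sum of \<open>a z / (g - z)\<close> over the common
    denominator. Evaluation at a \<open>z\<close> with \<open>a z \<noteq> 0\<close> shows that it
    is nonzero, while the relation among the \<open>u z\<close> puts \<open>q (g)\<close> times a
    power of \<open>h\<close> into \<open>P\<close>.\<close>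
  define q where "q = (\<Sum>z\<in>\<Lambda>. smult (a z) (\<Prod>w\<in>\<Lambda> - {z}. [:-w, 1:]))"
  have pq: "poly q t = (\<Sum>z\<in>\<Lambda>. a z * (\<Prod>w\<in>\<Lambda> - {z}. t - w))" for t
    by (simp add: q_def poly_sum poly_prod)
  have "q \<noteq> 0"
  proof -
    obtain z where z: "z \<in> \<Lambda>" "a z \<noteq> 0" using a(1) by blast
    have "(\<Prod>w\<in>\<Lambda> - {v}. z - w) = 0" if "v \<in> \<Lambda>" "v \<noteq> z" for v
      using \<Lambda>(2) z that by (intro prod_zero) auto
    hence "poly q z = (\<Sum>v\<in>\<Lambda>. if v = z then a z * (\<Prod>w\<in>\<Lambda> - {z}. z - w) else 0)"
      unfolding pq by (intro sum.cong) auto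
    also have "\<dots> \<noteq> 0" using z \<Lambda>(2) by auto
    finally show ?thesis by auto
  qed
  have "(\<lambda>x. \<Sum>z\<in>\<Lambda>. (a z * (\<Prod>w\<in>\<Lambda> - {z}. g x - w)) * (h x ^ fst y - u z x * (g x - z))) \<in> P"
  proof (rule pideal_sum[OF P])
    fix z assume "z \<in> \<Lambda>"
    hence *: "(\<lambda>x. h x ^ fst y - u z x * (g x - z)) \<in> P" using uP[of z] \<Lambda>(1) by auto
    show "(\<lambda>x. (a z * (\<Prod>w\<in>\<Lambda> - {z}. g x - w)) * (h x ^ fst y - u z x * (g x - z))) \<in> P"
      by (rule pideal_mult[OF P _ *]) (intro pfun.mult pfun.const pfun_prod glin)
  qed
  also have "(\<lambda>x. \<Sum>z\<in>\<Lambda>. (a z * (\<Prod>w\<in>\<Lambda> - {z}. g x - w)) * (h x ^ fst y - u z x * (g x - z))) =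
      (\<lambda>x. poly q (g x) * h x ^ fst y)"
  proof
    fix x
    have "(\<Sum>z\<in>\<Lambda>. (a z * (\<Prod>w\<in>\<Lambda> - {z}. g x - w)) * (u z x * (g x - z))) =
        (\<Sum>z\<in>\<Lambda>. (a z * u z x) * (\<Prod>w\<in>\<Lambda>. g x - w))"
      by (rule sum.cong) (use \<Lambda>(2) in \<open>auto simp: prod.remove\<close>)
    also have "\<dots> = 0" using au[of x] by (simp flip: sum_distrib_right)
    finally show "(\<Sum>z\<in>\<Lambda>. (a z * (\<Prod>w\<in>\<Lambda> - {z}. g x - w)) * (h x ^ fst y - u z x * (g x - z))) =
        poly q (g x) * h x ^ fst y"
      by (simp add: right_diff_distrib sum_subtractf pq sum_distrib_right)
  qed
  finally have "(\<lambda>x. poly q (g x) * h x ^ fst y) \<in> P" .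
  note prime = prime_of_maximal_avoiding_powers[OF max]
  have qP: "(\<lambda>x. poly q (g x)) \<in> P"
    using prime[OF gq pfun_power[OF h] \<open>(\<lambda>x. poly q (g x) * h x ^ fst y) \<in> P\<close>] avoid by blast
  \<comment> \<open>Over the complex numbers \<open>q\<close> splits into linear factors, and
    primality passes membership in \<open>P\<close> on to one of them.\<close>
  have "\<exists>z. (\<lambda>x. g x - z) \<in> P" if "q \<noteq> 0" "(\<lambda>x. poly q (g x)) \<in> P" for q
    using that
  proof (induction "degree q" arbitrary: q)
    case 0
    then obtain r where r: "q = [:r:]" "r \<noteq> 0" by (metis degree_eq_zeroE pCons_0_0)
    have "(\<lambda>x. inverse r * poly q (g x)) \<in> P"
      by (rule pideal_mult[OF P pfun.const 0(3)])
    hence "(\<lambda>x. h x ^ 0) \<in> P" using r by simp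
    with avoid show ?case by blast
  next
    case (Suc m)
    have "\<not> constant (poly q)" using Suc(2) by (simp add: constant_degree)
    then obtain z where "poly q z = 0" using fundamental_theorem_of_algebra by blast
    then obtain r where r: "q = [:-z, 1:] * r" by (auto simp: poly_eq_0_iff_dvd)
    hence "r \<noteq> 0" using Suc.prems by auto
    moreover have "m = degree r" using Suc(2) r \<open>r \<noteq> 0\<close> by (simp add: degree_mult_eq del: mult_pCons_left)
    moreover have "(\<lambda>x. (g x - z) * poly r (g x)) \<in> P" using Suc.prems(2) by (simp add: r algebra_simps)
    ultimately show ?case
      using prime[OF glin gq, of z r] Suc(1) by blast
  qed
  with no \<open>q \<noteq> 0\<close> qP show False by blast
qed

text \<open>If no power of \<open>h\<close> lies in \<open>J\<close>, then \<open>J\<close> extends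
  to an ideal \<open>P\<close> maximal among those avoiding these powers. Every coordinate is
  constant modulo \<open>P\<close>, and the constants form a common zero of \<open>J\<close>; if
  \<open>h\<close> vanished there, it would lie in \<open>P\<close>.\<close>

theorem nullstellensatz:
  assumes I: "finite I" and J: "pideal I J" and h: "h \<in> pfun I"
    and zeros: "\<And>x. (\<And>f. f \<in> J \<Longrightarrow> f x = 0) \<Longrightarrow> h x = 0"
  shows "\<exists>k. (\<lambda>x. h x ^ k) \<in> J"
proof (rule ccontr)
  assume "\<not> ?thesis"
  then obtain P where "J \<subseteq> P" and max: "maximal_avoiding I h P"
    using maximal_pideal_avoiding_powers[OF J h] by blast
  hence P: "pideal I P" "J \<subseteq> P" and avoid: "\<And>k. (\<lambda>x. h x ^ k) \<notin> P"
    by (simp_all add: maximal_avoiding_def)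
  note const = constant_modulo_maximal[OF I max]
  define x where "x i = (SOME z. (\<lambda>x. x i - z) \<in> P)" for i
  have x: "(\<lambda>y. y i - x i) \<in> P" if "i \<in> I" for i
    unfolding x_def using const[OF pfun.coord[OF that]] by (rule someI_ex)
  have eval: "(\<lambda>y. f y - f x) \<in> P" if "f \<in> pfun I" for f
    using that
  proof induction
    case (const c)
    show ?case using P(1) by (simp add: pideal_def)
  next
    case (coord i)
    show ?case by (rule x[OF coord])
  next
    case (add f g)
    from pideal_add[OF P(1) this(3,4)] show ?case by (simp add: algebra_simps)
  next
    case (mult f g)
    from pideal_add[OF P(1) pideal_mult[OF P(1) mult(1) mult(4)] pideal_mult[OF P(1) pfun.const[of "g x"] mult(3)]]
    show ?case by (simp add: algebra_simps)
  qed
  have "f x = 0" if "f \<in> J" for f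
  proof (rule ccontr)
    assume "f x \<noteq> 0"
    have "f \<in> P" "f \<in> pfun I" using that P by (auto simp: pideal_def)
    from pideal_diff[OF P(1) this(1) eval[OF this(2)]] have "(\<lambda>y. f x) \<in> P" by simp
    from pideal_mult[OF P(1) pfun.const[of "inverse (f x)"] this] have "(\<lambda>y. h y ^ 0) \<in> P" using \<open>f x \<noteq> 0\<close> by simp
    with avoid show False by blast
  qed
  hence "h x = 0" by (rule zeros)
  hence "(\<lambda>y. h y ^ 1) \<in> P" using eval[OF h] by simp
  with avoid show False by blast
qed

section \<open>A point is not cut out by fewer equations than coordinates\<close>

definition ideal_of :: "'i set \<Rightarrow> 'j set \<Rightarrow> ('j \<Rightarrow> ('i \<Rightarrow> complex) \<Rightarrow> complex) \<Rightarrow> (('i \<Rightarrow> complex) \<Rightarrow> complex) set" where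
  "ideal_of I J f = {g. \<exists>r. (\<forall>j\<in>J. r j \<in> pfun I) \<and> g = (\<lambda>x. \<Sum>j\<in>J. r j x * f j x)}"

lemma ideal_ofI:
  "(\<And>j. j \<in> J \<Longrightarrow> r j \<in> pfun I) \<Longrightarrow> (\<And>x. g x = (\<Sum>j\<in>J. r j x * f j x)) \<Longrightarrow> g \<in> ideal_of I J f"
  unfolding ideal_of_def by blast

lemma pideal_ideal_of:
  assumes "\<And>j. j \<in> J \<Longrightarrow> f j \<in> pfun I"
  shows "pideal I (ideal_of I J f)"
  unfolding pideal_def
proof (intro conjI ballI)
  show "ideal_of I J f \<subseteq> pfun I"
    by (auto simp: ideal_of_def intro!: pfun_sum pfun.mult assms)
  show "(\<lambda>_. 0) \<in> ideal_of I J f"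
    by (rule ideal_ofI[of _ "\<lambda>_ _. 0"]) (simp_all add: pfun.const)
next
  fix g h assume "g \<in> ideal_of I J f" "h \<in> ideal_of I J f"
  then obtain r s where "\<forall>j\<in>J. r j \<in> pfun I" "g = (\<lambda>x. \<Sum>j\<in>J. r j x * f j x)"
    "\<forall>j\<in>J. s j \<in> pfun I" "h = (\<lambda>x. \<Sum>j\<in>J. s j x * f j x)" by (auto simp: ideal_of_def)
  thus "(\<lambda>x. g x + h x) \<in> ideal_of I J f"
    by (intro ideal_ofI[of _ "\<lambda>j x. r j x + s j x"]) (auto simp: sum.distrib distrib_right intro: pfun.add)
next
  fix g h assume "g \<in> ideal_of I J f" "h \<in> pfun I"
  then obtain r where "\<forall>j\<in>J. r j \<in> pfun I" "g = (\<lambda>x. \<Sum>j\<in>J. r j x * f j x)" "h \<in> pfun I"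
    by (auto simp: ideal_of_def)
  thus "(\<lambda>x. h x * g x) \<in> ideal_of I J f"
    by (intro ideal_ofI[of _ "\<lambda>j x. h x * r j x"]) (auto simp: sum_distrib_left mult.assoc intro: pfun.mult)
qed

lemma mem_ideal_of:
  assumes "finite J" "j \<in> J"
  shows "f j \<in> ideal_of I J f"
proof (rule ideal_ofI[of _ "\<lambda>i x. if i = j then 1 else 0"])
  show "f j x = (\<Sum>i\<in>J. (if i = j then 1 else 0) * f i x)" for x
  proof -
    have "(\<Sum>i\<in>J. (if i = j then 1 else 0) * f i x) = (\<Sum>i\<in>J. if i = j then f j x else 0)"
      by (rule sum.cong) auto
    thus ?thesis using assms by simp
  qed
qed (simp add: pfun.const)

text \<open>Vanishing to order \<open>k\<close> at the origin, tested along lines.\<close>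

definition vanish_order :: "nat \<Rightarrow> (('i \<Rightarrow> complex) \<Rightarrow> complex) set" where
  "vanish_order k = {g. \<forall>x. \<exists>q. \<forall>t. g (\<lambda>i. t * x i) = t ^ k * poly q t}"

lemma vanish_order_add:
  assumes "f \<in> vanish_order k" "g \<in> vanish_order k"
  shows "(\<lambda>x. f x + g x) \<in> vanish_order k"
  unfolding vanish_order_def
proof safe
  fix x :: "'a \<Rightarrow> complex"
  obtain q r where "\<forall>t. f (\<lambda>i. t * x i) = t ^ k * poly q t" "\<forall>t. g (\<lambda>i. t * x i) = t ^ k * poly r t"
    using assms unfolding vanish_order_def by blast
  thus "\<exists>q. \<forall>t. f (\<lambda>i. t * x i) + g (\<lambda>i. t * x i) = t ^ k * poly q t"
    by (intro exI[of _ "q + r"]) (simp add: distrib_left)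
qed

lemma vanish_order_mult:
  assumes "f \<in> vanish_order k" "g \<in> vanish_order l"
  shows "(\<lambda>x. f x * g x) \<in> vanish_order (k + l)"
  unfolding vanish_order_def
proof safe
  fix x :: "'a \<Rightarrow> complex"
  obtain q r where "\<forall>t. f (\<lambda>i. t * x i) = t ^ k * poly q t" "\<forall>t. g (\<lambda>i. t * x i) = t ^ l * poly r t"
    using assms unfolding vanish_order_def by blast
  thus "\<exists>q. \<forall>t. f (\<lambda>i. t * x i) * g (\<lambda>i. t * x i) = t ^ (k + l) * poly q t"
    by (intro exI[of _ "q * r"]) (simp add: power_add)
qed

lemma vanish_order_0:
  assumes "f \<in> pfun I"
  shows "f \<in> vanish_order 0"
  unfolding vanish_order_def
proof safe
  fix x :: "'a \<Rightarrow> complex"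
  obtain q where "\<And>t. f (\<lambda>i. 0 + t * (x i - 0)) = poly q t"
    using pfun_line[OF assms, of "\<lambda>_. 0" x] by blast
  thus "\<exists>q. \<forall>t. f (\<lambda>i. t * x i) = t ^ 0 * poly q t" by auto
qed

lemma vanish_order_1:
  assumes "f \<in> pfun I" "f (\<lambda>_. 0) = 0"
  shows "f \<in> vanish_order 1"
  unfolding vanish_order_def
proof safe
  fix x :: "'a \<Rightarrow> complex"
  obtain q where q: "\<And>t. f (\<lambda>i. 0 + t * (x i - 0)) = poly q t"
    using pfun_line[OF assms(1), of "\<lambda>_. 0" x] by blast
  from q[of 0] assms(2) have "poly q 0 = 0" by simp
  then obtain r where "q = [:-0, 1:] * r" unfolding poly_eq_0_iff_dvd by blast
  with q show "\<exists>q. \<forall>t. f (\<lambda>i. t * x i) = t ^ 1 * poly q t"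
    by (intro exI[of _ r]) auto
qed

lemma vanish_order_sum:
  assumes "\<And>a. a \<in> A \<Longrightarrow> f a \<in> vanish_order k"
  shows "(\<lambda>x. \<Sum>a\<in>A. f a x) \<in> vanish_order k"
proof -
  have "(\<lambda>_. 0) \<in> vanish_order k" by (auto simp: vanish_order_def intro: exI[of _ 0])
  with assms show ?thesis
    by (induction A rule: infinite_finite_induct) (auto intro: vanish_order_add)
qed

lemma vanish_order_smult:
  assumes "f \<in> vanish_order k"
  shows "(\<lambda>x. c * f x) \<in> vanish_order k"
  using vanish_order_mult[OF vanish_order_0[OF pfun.const[of c "{}"]] assms] by simp

text \<open>On each line through the origin \<open>g\<close> is a polynomial of degree at most
  \<open>card I * d\<close>, so divisibility by a higher power of the parameter makes it
  zero.\<close>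

lemma vanish_order_high:
  assumes "finite I" "\<And>x. g x = (\<Sum>\<alpha>\<in>box I d. a \<alpha> * monom_at I \<alpha> x)"
    and "g \<in> vanish_order k" "card I * d < k" "\<alpha> \<in> box I d"
  shows "a \<alpha> = 0"
proof (rule monom_at_independent[OF assms(1) _ assms(5)])
  fix x :: "'a \<Rightarrow> complex"
  obtain q where q: "\<And>t. g (\<lambda>i. t * x i) = t ^ k * poly q t"
    using assms(3) unfolding vanish_order_def by blast
  define p where "p = (\<Sum>\<alpha>\<in>box I d. monom (a \<alpha> * monom_at I \<alpha> x) (\<Sum>i\<in>I. \<alpha> i))"
  have "monom_at I \<alpha> (\<lambda>i. t * x i) = t ^ (\<Sum>i\<in>I. \<alpha> i) * monom_at I \<alpha> x" for t \<alpha>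
    by (simp add: monom_at_def power_mult_distrib prod.distrib power_sum)
  hence "poly p t = g (\<lambda>i. t * x i)" for t
    by (simp add: p_def assms(2) poly_sum poly_monom mult_ac)
  hence "poly p t = poly (monom 1 k * q) t" for t by (simp add: q poly_monom)
  hence pq: "p = monom 1 k * q" by (simp add: poly_eq_poly_eq_iff[symmetric] fun_eq_iff)
  have "degree p \<le> card I * d"
    unfolding p_def
  proof (rule degree_sum_le[OF finite_box[OF assms(1)]])
    fix \<alpha> assume "\<alpha> \<in> box I d"
    hence "(\<Sum>i\<in>I. \<alpha> i) \<le> card I * d"
      using sum_bounded_above[of I \<alpha> d] by (auto simp: box_def PiE_iff)
    thus "degree (monom (a \<alpha> * monom_at I \<alpha> x) (\<Sum>i\<in>I. \<alpha> i)) \<le> card I * d"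
      using degree_monom_le order.trans by blast
  qed
  have "q = 0"
  proof (rule ccontr)
    assume "q \<noteq> 0"
    hence "degree p = k + degree q" by (simp add: pq degree_mult_eq degree_monom_eq)
    with \<open>degree p \<le> card I * d\<close> assms(4) show False by simp
  qed
  hence "g (\<lambda>i. 1 * x i) = 0" using q[of 1] by simp
  thus "(\<Sum>\<alpha>\<in>box I d. a \<alpha> * monom_at I \<alpha> x) = 0" by (simp add: assms(2))
qed

text \<open>Up to order \<open>k\<close> these are polynomials in the \<open>f j\<close>, of degree
  at most \<open>k\<close> in each, whose coefficients have degree at most \<open>M\<close> in each
  coordinate. As \<open>M\<close> stays fixed when \<open>k\<close> grows, their dimension is only
  of order \<open>k ^ card J\<close>.\<close>

definition expansions :: "'i set \<Rightarrow> 'j set \<Rightarrow> nat \<Rightarrow> ('j \<Rightarrow> ('i \<Rightarrow> complex) \<Rightarrow> complex) \<Rightarrow> nat \<Rightarrow>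
    (('i \<Rightarrow> complex) \<Rightarrow> complex) set" where
  "expansions I J M f k = {g. \<exists>c. \<exists>w\<in>vanish_order k. \<forall>x. g x =
      (\<Sum>(\<gamma>, \<beta>)\<in>box I M \<times> box J k. c (\<gamma>, \<beta>) * (monom_at I \<gamma> x * monom_at J \<beta> (\<lambda>j. f j x))) + w x}"

lemma expansions_add:
  assumes "g \<in> expansions I J M f k" "h \<in> expansions I J M f k"
  shows "(\<lambda>x. g x + h x) \<in> expansions I J M f k"
proof -
  obtain c w where g: "w \<in> vanish_order k" "\<forall>x. g x =
      (\<Sum>(\<gamma>, \<beta>)\<in>box I M \<times> box J k. c (\<gamma>, \<beta>) * (monom_at I \<gamma> x * monom_at J \<beta> (\<lambda>j. f j x))) + w x"
    using assms(1) unfolding expansions_def by blast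
  obtain d v where h: "v \<in> vanish_order k" "\<forall>x. h x =
      (\<Sum>(\<gamma>, \<beta>)\<in>box I M \<times> box J k. d (\<gamma>, \<beta>) * (monom_at I \<gamma> x * monom_at J \<beta> (\<lambda>j. f j x))) + v x"
    using assms(2) unfolding expansions_def by blast
  show ?thesis unfolding expansions_def mem_Collect_eq
  proof (intro exI[of _ "\<lambda>z. c z + d z"] bexI[OF _ vanish_order_add[OF g(1) h(1)]] allI)
    fix x
    show "g x + h x = (\<Sum>(\<gamma>, \<beta>)\<in>box I M \<times> box J k. (c (\<gamma>, \<beta>) + d (\<gamma>, \<beta>)) *
        (monom_at I \<gamma> x * monom_at J \<beta> (\<lambda>j. f j x))) + (w x + v x)"
      using g(2) h(2) by (simp add: case_prod_unfold distrib_right sum.distrib)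
  qed
qed

lemma expansions_vanish: "w \<in> vanish_order k \<Longrightarrow> w \<in> expansions I J M f k"
  unfolding expansions_def by (auto intro!: exI[of _ "\<lambda>_. 0"] bexI[of _ w])

lemma expansions_sum:
  assumes "\<And>a. a \<in> A \<Longrightarrow> g a \<in> expansions I J M f k"
  shows "(\<lambda>x. \<Sum>a\<in>A. g a x) \<in> expansions I J M f k"
proof -
  have "(\<lambda>_. 0) \<in> expansions I J M f k"
    by (rule expansions_vanish) (auto simp: vanish_order_def intro: exI[of _ 0])
  with assms show ?thesis
    by (induction A rule: infinite_finite_induct) (auto intro: expansions_add)
qed

lemma expansions_monomial:
  assumes "finite I" "finite J" "\<gamma> \<in> box I M" "\<beta> \<in> box J k"
  shows "(\<lambda>x. c * (monom_at I \<gamma> x * monom_at J \<beta> (\<lambda>j. f j x))) \<in> expansions I J M f k"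
  unfolding expansions_def mem_Collect_eq
proof (intro exI[of _ "\<lambda>z. if z = (\<gamma>, \<beta>) then c else 0"] bexI[of _ "\<lambda>_. 0"] allI)
  fix x
  have "(\<Sum>z\<in>box I M \<times> box J k. if z = (\<gamma>, \<beta>) then c * (monom_at I \<gamma> x * monom_at J \<beta> (\<lambda>j. f j x)) else 0) =
      c * (monom_at I \<gamma> x * monom_at J \<beta> (\<lambda>j. f j x))"
    using assms by (subst sum.delta) auto
  moreover have "(\<Sum>(\<gamma>', \<beta>')\<in>box I M \<times> box J k. (if (\<gamma>', \<beta>') = (\<gamma>, \<beta>) then c else 0) *
      (monom_at I \<gamma>' x * monom_at J \<beta>' (\<lambda>j. f j x))) =
    (\<Sum>z\<in>box I M \<times> box J k. if z = (\<gamma>, \<beta>) then c * (monom_at I \<gamma> x * monom_at J \<beta> (\<lambda>j. f j x)) else 0)"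
    by (rule sum.cong) (auto split: if_splits)
  ultimately show "c * (monom_at I \<gamma> x * monom_at J \<beta> (\<lambda>j. f j x)) =
    (\<Sum>(\<gamma>', \<beta>')\<in>box I M \<times> box J k. (if (\<gamma>', \<beta>') = (\<gamma>, \<beta>) then c else 0) *
      (monom_at I \<gamma>' x * monom_at J \<beta>' (\<lambda>j. f j x))) + 0" by simp
qed (auto simp: vanish_order_def intro: exI[of _ 0])

lemma expansions_times:
  assumes "finite I" "finite J" "j \<in> J" "f j \<in> vanish_order 1" "g \<in> expansions I J M f k"
  shows "(\<lambda>x. g x * f j x) \<in> expansions I J M f (Suc k)"
proof -
  obtain c w where g: "w \<in> vanish_order k" "\<And>x. g x =
      (\<Sum>(\<gamma>, \<beta>)\<in>box I M \<times> box J k. c (\<gamma>, \<beta>) * (monom_at I \<gamma> x * monom_at J \<beta> (\<lambda>j. f j x))) + w x"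
    using assms(5) unfolding expansions_def by blast
  define e where "e = (\<lambda>i\<in>J. if i = j then 1 else 0 :: nat)"
  have e: "e \<in> box J 1" by (auto simp: e_def box_def)
  have fj: "monom_at J e (\<lambda>j. f j x) = f j x" for x
  proof -
    have "monom_at J e (\<lambda>j. f j x) = (\<Prod>i\<in>J. if i = j then f j x else 1)"
      unfolding monom_at_def by (rule prod.cong) (auto simp: e_def)
    thus ?thesis using assms by simp
  qed
  have "monom_at J \<beta> (\<lambda>j. f j x) * f j x = monom_at J (\<lambda>i\<in>J. \<beta> i + e i) (\<lambda>j. f j x)" for \<beta> x
    by (metis fj monom_at_times)
  hence "g x * f j x = (\<Sum>z\<in>box I M \<times> box J k. c z *
      (monom_at I (fst z) x * monom_at J (\<lambda>i\<in>J. snd z i + e i) (\<lambda>j. f j x))) + w x * f j x" for x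
    by (simp add: g(2) distrib_right sum_distrib_right case_prod_unfold mult.assoc)
  moreover have "(\<lambda>x. (\<Sum>z\<in>box I M \<times> box J k. c z *
      (monom_at I (fst z) x * monom_at J (\<lambda>i\<in>J. snd z i + e i) (\<lambda>j. f j x))) + w x * f j x)
      \<in> expansions I J M f (Suc k)"
  proof (intro expansions_add expansions_sum expansions_monomial assms)
    show "(\<lambda>x. w x * f j x) \<in> expansions I J M f (Suc k)"
      using vanish_order_mult[OF g(1) assms(4)] by (intro expansions_vanish) simp
    fix z assume "z \<in> box I M \<times> box J k"
    thus "fst z \<in> box I M" "(\<lambda>i\<in>J. snd z i + e i) \<in> box J (Suc k)"
      using restrict_add_box[OF _ e, of "snd z" k] by auto
  qed
  ultimately show ?thesis by simp
qed

text \<open>A Hilbert-Samuel count: modulo functions vanishing to order \<open>k\<close>, the common zero being a single point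
  forces all functions into the span of \<open>O(k\<^bsup>card J\<^esup>)\<close> elements, whereas the monomials of degree below
  \<open>k\<close> are linearly independent and number about \<open>k\<^bsup>card I\<^esup>\<close>.\<close>

theorem unique_common_zero:
  assumes I: "finite I" and J: "finite J" and f: "\<And>j. j \<in> J \<Longrightarrow> f j \<in> pfun I"
    and f0: "\<And>j. j \<in> J \<Longrightarrow> f j (\<lambda>_. 0) = 0"
    and zero: "\<And>x i. (\<And>j. j \<in> J \<Longrightarrow> f j x = 0) \<Longrightarrow> i \<in> I \<Longrightarrow> x i = 0"
  shows "card I \<le> card J"
proof (rule ccontr)
  assume less: "\<not> card I \<le> card J"
  define A where "A = ideal_of I J f"
  have A: "pideal I A" unfolding A_def by (rule pideal_ideal_of[OF f])
  have "\<exists>k. (\<lambda>x. x i ^ k) \<in> A" if "i \<in> I" for i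
  proof (rule nullstellensatz[OF I A pfun.coord[OF that]])
    fix x assume "\<And>f. f \<in> A \<Longrightarrow> f x = 0"
    thus "x i = 0" using zero that mem_ideal_of[OF J] unfolding A_def by blast
  qed
  then obtain N where N: "\<And>i. i \<in> I \<Longrightarrow> (\<lambda>x. x i ^ N i) \<in> A" by metis
  \<comment> \<open>A bound for the Nullstellensatz exponents: a monomial with some exponent above
    \<open>M\<close> lies in the ideal.\<close>
  define M where "M = Max (N ` I)"
  have big: "(\<lambda>x. c * monom_at I \<alpha> x) \<in> A" if i: "i \<in> I" "\<alpha> i > M" for \<alpha> i c
  proof -
    have "N i \<le> M" unfolding M_def using i(1) I by (intro Max_ge) auto
    with i(2) have "N i \<le> \<alpha> i" by simp
    hence "monom_at I \<alpha> x = (x i ^ (\<alpha> i - N i) * monom_at (I - {i}) \<alpha> x) * x i ^ N i" for x :: "'a \<Rightarrow> complex"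
      using i I by (simp add: monom_at_def prod.remove power_add[symmetric] mult_ac)
    moreover have "(\<lambda>x. (c * (x i ^ (\<alpha> i - N i) * monom_at (I - {i}) \<alpha> x)) * x i ^ N i) \<in> A"
      by (rule pideal_mult[OF A _ N[OF i(1)]])
        (intro pfun.mult pfun.const pfun_power pfun_monom_at[where f = "\<lambda>j x. x j"] pfun.coord, use i in auto)
    ultimately show ?thesis by (simp add: mult.assoc)
  qed
  have exp: "pfun I \<subseteq> expansions I J M f k" for k
  proof (induction k)
    case 0
    show ?case by (auto intro: expansions_vanish vanish_order_0)
  next
    case (Suc k)
    \<comment> \<open>An element of the ideal combines the \<open>f j\<close> with coefficients that
      are already expanded to order \<open>k\<close>. Each \<open>f j\<close> vanishes at the origin
      and raises the order by one.\<close>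
    have AE: "A \<subseteq> expansions I J M f (Suc k)"
      unfolding A_def ideal_of_def
      using Suc by (auto intro!: expansions_sum expansions_times I J vanish_order_1[OF f f0])
    show ?case
    proof
      fix g assume "g \<in> pfun I"
      then obtain d c where g: "\<And>x. g x = (\<Sum>\<alpha>\<in>box I d. c \<alpha> * monom_at I \<alpha> x)"
        using pfun_poly_le[OF I] unfolding poly_le_def by blast
      have "(\<lambda>x. c \<alpha> * monom_at I \<alpha> x) \<in> expansions I J M f (Suc k)" if \<alpha>: "\<alpha> \<in> box I d" for \<alpha>
      proof (cases "\<alpha> \<in> box I M")
        case True
        have "(\<lambda>x. c \<alpha> * (monom_at I \<alpha> x * monom_at J (\<lambda>i\<in>J. 0) (\<lambda>j. f j x))) \<in> expansions I J M f (Suc k)"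
          by (rule expansions_monomial[OF I J True]) (simp add: box_def)
        thus ?thesis by (simp add: monom_at_def)
      next
        case False
        with \<alpha> obtain i where "i \<in> I" "\<alpha> i > M" by (fastforce simp: box_def PiE_iff)
        with big AE show ?thesis by blast
      qed
      hence "(\<lambda>x. \<Sum>\<alpha>\<in>box I d. c \<alpha> * monom_at I \<alpha> x) \<in> expansions I J M f (Suc k)"
        by (rule expansions_sum)
      moreover have "g = (\<lambda>x. \<Sum>\<alpha>\<in>box I d. c \<alpha> * monom_at I \<alpha> x)" using g by blast
      ultimately show "g \<in> expansions I J M f (Suc k)" by simp
    qed
  qed
  define D where "D = card I"
  define s where "s = card J"
  \<comment> \<open>With \<open>k = D Q + 1\<close>, just above the total degree of monomials in
    \<open>box I Q\<close>, one has \<open>Suc k \<le> Suc D * Suc Q\<close>. So the expansions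
    involve at most \<open>Suc M ^ D * Suc D ^ s * Suc Q ^ s\<close> terms. Taking \<open>Q\<close>
    to be the constant in front keeps this below \<open>Suc Q ^ Suc s\<close>.\<close>
  define Q where "Q = Suc M ^ D * Suc D ^ s"
  define k where "k = Suc (D * Q)"
  have "card (box I M \<times> box J k) < card (box I Q)"
  proof -
    have "card (box I M \<times> box J k) = Suc M ^ D * Suc k ^ s"
      using I J by (simp add: card_cartesian_product card_box D_def s_def)
    also have "\<dots> \<le> Suc M ^ D * (Suc D * Suc Q) ^ s"
      using less by (intro mult_left_mono power_mono) (auto simp: k_def D_def)
    also have "\<dots> = Q * Suc Q ^ s" by (simp only: Q_def power_mult_distrib mult.assoc)
    also have "\<dots> < Suc Q ^ Suc s" by simp
    also have "\<dots> \<le> Suc Q ^ D" using less by (intro power_increasing) (auto simp: D_def s_def)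
    finally show ?thesis using I by (simp add: card_box D_def)
  qed
  define R where "R \<alpha> c w \<longleftrightarrow> w \<in> vanish_order k \<and> (\<forall>x. monom_at I \<alpha> x =
      (\<Sum>(\<gamma>, \<beta>)\<in>box I M \<times> box J k. c (\<gamma>, \<beta>) * (monom_at I \<gamma> x * monom_at J \<beta> (\<lambda>j. f j x))) + w x)" for \<alpha> c w
  have "\<exists>c w. R \<alpha> c w" for \<alpha>
  proof -
    have "monom_at I \<alpha> \<in> pfun I" using pfun_monom_at[of I "\<lambda>j x. x j" I] pfun.coord by fast
    with exp[of k] have "monom_at I \<alpha> \<in> expansions I J M f k" by blast
    thus ?thesis unfolding expansions_def R_def by blast
  qed
  then obtain c w where R: "\<And>\<alpha>. R \<alpha> (c \<alpha>) (w \<alpha>)" by metis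
  hence w: "w \<alpha> \<in> vanish_order k" and c: "monom_at I \<alpha> x =
      (\<Sum>(\<gamma>, \<beta>)\<in>box I M \<times> box J k. c \<alpha> (\<gamma>, \<beta>) * (monom_at I \<gamma> x * monom_at J \<beta> (\<lambda>j. f j x))) + w \<alpha> x" for \<alpha> x
    unfolding R_def by blast+
  from \<open>card (box I M \<times> box J k) < card (box I Q)\<close>
  obtain a where a: "\<exists>\<alpha>\<in>box I Q. a \<alpha> \<noteq> 0"
    and ac: "\<forall>z\<in>box I M \<times> box J k. (\<Sum>\<alpha>\<in>box I Q. a \<alpha> * c \<alpha> z) = 0"
    using underdetermined_system[of "box I M \<times> box J k" "box I Q" c] I J by auto
  have sum: "(\<Sum>\<alpha>\<in>box I Q. a \<alpha> * w \<alpha> x) = (\<Sum>\<alpha>\<in>box I Q. a \<alpha> * monom_at I \<alpha> x)" for x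
  proof -
    let ?m = "\<lambda>z. monom_at I (fst z) x * monom_at J (snd z) (\<lambda>j. f j x)"
    have "a \<alpha> * monom_at I \<alpha> x = (\<Sum>z\<in>box I M \<times> box J k. (a \<alpha> * c \<alpha> z) * ?m z) + a \<alpha> * w \<alpha> x" for \<alpha>
      by (subst c) (simp add: case_prod_unfold distrib_left sum_distrib_left mult.assoc)
    hence "(\<Sum>\<alpha>\<in>box I Q. a \<alpha> * monom_at I \<alpha> x) =
        (\<Sum>\<alpha>\<in>box I Q. \<Sum>z\<in>box I M \<times> box J k. (a \<alpha> * c \<alpha> z) * ?m z) + (\<Sum>\<alpha>\<in>box I Q. a \<alpha> * w \<alpha> x)"
      by (simp add: sum.distrib)
    also have "(\<Sum>\<alpha>\<in>box I Q. \<Sum>z\<in>box I M \<times> box J k. (a \<alpha> * c \<alpha> z) * ?m z) =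
        (\<Sum>z\<in>box I M \<times> box J k. (\<Sum>\<alpha>\<in>box I Q. a \<alpha> * c \<alpha> z) * ?m z)"
      by (subst sum.swap) (simp add: sum_distrib_right)
    also have "\<dots> = 0" using ac by (intro sum.neutral) auto
    finally show ?thesis by simp
  qed
  have "(\<lambda>x. \<Sum>\<alpha>\<in>box I Q. a \<alpha> * w \<alpha> x) \<in> vanish_order k"
    by (intro vanish_order_sum vanish_order_smult w)
  with sum have "a \<alpha> = 0" if "\<alpha> \<in> box I Q" for \<alpha>
    using vanish_order_high[OF I sum _ _ that, where k = k] by (simp add: k_def D_def)
  with a show False by blast
qed

section \<open>Krull dimension of algebras of functions\<close>

text \<open>Serves the coordinate ring and the ring of invariants alike, so that Krull dimension can
  be studied for any algebra of functions containing the constants.\<close>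

locale function_algebra =
  fixes V :: "'x set" and R :: "('x \<Rightarrow> complex) ring" (structure)
  assumes ext: "f \<in> carrier R \<Longrightarrow> f \<in> extensional V"
    and const_closed: "(\<lambda>v\<in>V. c) \<in> carrier R"
    and plus_closed: "\<lbrakk>f \<in> carrier R; g \<in> carrier R\<rbrakk> \<Longrightarrow> (\<lambda>v\<in>V. f v + g v) \<in> carrier R"
    and times_closed: "\<lbrakk>f \<in> carrier R; g \<in> carrier R\<rbrakk> \<Longrightarrow> (\<lambda>v\<in>V. f v * g v) \<in> carrier R"
    and plus_eq: "f \<oplus> g = (\<lambda>v\<in>V. f v + g v)"
    and times_eq: "f \<otimes> g = (\<lambda>v\<in>V. f v * g v)"
    and zero_eq: "\<zero> = (\<lambda>v\<in>V. 0)"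
    and one_eq: "\<one> = (\<lambda>v\<in>V. 1)"
begin

lemma eqI: "f \<in> carrier R \<Longrightarrow> g \<in> carrier R \<Longrightarrow> (\<And>v. v \<in> V \<Longrightarrow> f v = g v) \<Longrightarrow> f = g"
  by (rule extensionalityI[OF ext ext])

lemma cring: "cring R"
proof (rule cringI)
  show "abelian_group R"
  proof (rule abelian_groupI)
    fix f assume f: "f \<in> carrier R"
    have "(\<lambda>v\<in>V. (\<lambda>v\<in>V. -1) v * f v) \<in> carrier R" by (intro times_closed const_closed f)
    thus "\<exists>g\<in>carrier R. g \<oplus> f = \<zero>"
      by (rule bexI[rotated]) (auto simp: plus_eq zero_eq fun_eq_iff)
    show "\<zero> \<oplus> f = f" using ext[OF f] by (auto simp: plus_eq zero_eq extensional_def fun_eq_iff)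
  qed (auto simp: plus_eq zero_eq plus_closed const_closed fun_eq_iff)
  show "comm_monoid R"
  proof (rule comm_monoidI)
    fix f assume f: "f \<in> carrier R"
    show "\<one> \<otimes> f = f" using ext[OF f] by (auto simp: times_eq one_eq extensional_def fun_eq_iff)
  qed (auto simp: times_eq one_eq times_closed const_closed fun_eq_iff)
qed (auto simp: plus_eq times_eq fun_eq_iff distrib_right)

sublocale cring R by (rule cring)

lemma uminus_eq: "f \<in> carrier R \<Longrightarrow> \<ominus> f = (\<lambda>v\<in>V. - f v)"
proof (rule minus_equality)
  assume f: "f \<in> carrier R"
  have "(\<lambda>v\<in>V. (\<lambda>v\<in>V. -1) v * f v) \<in> carrier R" by (intro times_closed const_closed f)
  also have "(\<lambda>v\<in>V. (\<lambda>v\<in>V. -1) v * f v) = (\<lambda>v\<in>V. - f v)" by (auto simp: fun_eq_iff)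
  finally show "(\<lambda>v\<in>V. - f v) \<in> carrier R" .
qed (auto simp: plus_eq zero_eq fun_eq_iff)

lemma sum_closed:
  assumes "\<And>a. a \<in> A \<Longrightarrow> (\<lambda>v\<in>V. F a v) \<in> carrier R"
  shows "(\<lambda>v\<in>V. \<Sum>a\<in>A. F a v) \<in> carrier R"
  using assms
proof (induction A rule: infinite_finite_induct)
  case (insert a A)
  have "(\<lambda>v\<in>V. (\<lambda>v\<in>V. F a v) v + (\<lambda>v\<in>V. \<Sum>a\<in>A. F a v) v) \<in> carrier R"
    by (intro plus_closed) (use insert in auto)
  also have "(\<lambda>v\<in>V. (\<lambda>v\<in>V. F a v) v + (\<lambda>v\<in>V. \<Sum>a\<in>A. F a v) v) = (\<lambda>v\<in>V. \<Sum>a\<in>insert a A. F a v)"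
    using insert by (auto simp: fun_eq_iff)
  finally show ?case .
qed (use const_closed[of 0] in auto)

lemma prod_closed:
  assumes "\<And>a. a \<in> A \<Longrightarrow> (\<lambda>v\<in>V. F a v) \<in> carrier R"
  shows "(\<lambda>v\<in>V. \<Prod>a\<in>A. F a v) \<in> carrier R"
  using assms
proof (induction A rule: infinite_finite_induct)
  case (insert a A)
  have "(\<lambda>v\<in>V. (\<lambda>v\<in>V. F a v) v * (\<lambda>v\<in>V. \<Prod>a\<in>A. F a v) v) \<in> carrier R"
    by (intro times_closed) (use insert in auto)
  also have "(\<lambda>v\<in>V. (\<lambda>v\<in>V. F a v) v * (\<lambda>v\<in>V. \<Prod>a\<in>A. F a v) v) = (\<lambda>v\<in>V. \<Prod>a\<in>insert a A. F a v)"
    using insert by (auto simp: fun_eq_iff)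
  finally show ?case .
qed (use const_closed[of 1] in auto)

lemma times_closed':
  assumes "(\<lambda>v\<in>V. F v) \<in> carrier R" "(\<lambda>v\<in>V. G v) \<in> carrier R"
  shows "(\<lambda>v\<in>V. F v * G v) \<in> carrier R"
proof -
  have "(\<lambda>v\<in>V. F v * G v) = (\<lambda>v\<in>V. (\<lambda>v\<in>V. F v) v * (\<lambda>v\<in>V. G v) v)" by (auto simp: fun_eq_iff)
  with times_closed[OF assms] show ?thesis by simp
qed

lemma power_closed:
  assumes "(\<lambda>v\<in>V. F v) \<in> carrier R"
  shows "(\<lambda>v\<in>V. F v ^ k) \<in> carrier R"
proof (induction k)
  case 0
  show ?case unfolding power_0 by (rule const_closed)
next
  case (Suc k)
  from times_closed'[OF assms Suc] show ?case unfolding power_Suc .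
qed

lemma restrict_carrier: "f \<in> carrier R \<Longrightarrow> (\<lambda>v\<in>V. f v) \<in> carrier R"
  using extensional_restrict[OF ext] by simp

lemma monom_closed:
  assumes "\<And>l. l \<in> I \<Longrightarrow> x l \<in> carrier R"
  shows "(\<lambda>v\<in>V. c * monom_at I \<beta> (\<lambda>l. x l v)) \<in> carrier R"
  unfolding monom_at_def
  by (intro times_closed' const_closed prod_closed power_closed restrict_carrier assms)

section \<open>Prime ideals and algebraic independence\<close>

text \<open>The ideal is the kernel of the pullback along \<open>\<sigma>\<close>, which takes
  values in a domain.\<close>

lemma vanishing_primeideal:
  fixes \<sigma> :: "('i \<Rightarrow> complex) \<Rightarrow> 'x"
  assumes "\<And>f. f \<in> carrier R \<Longrightarrow> (\<lambda>y. f (\<sigma> y)) \<in> pfun I" "\<And>y. \<sigma> y \<in> V"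
  shows "primeideal {f \<in> carrier R. \<forall>y. f (\<sigma> y) = 0} R"
proof (rule primeidealI)
  show "ideal {f \<in> carrier R. \<forall>y. f (\<sigma> y) = 0} R"
  proof (rule idealI[OF ring_axioms])
    show "subgroup {f \<in> carrier R. \<forall>y. f (\<sigma> y) = 0} (add_monoid R)"
    proof (rule add.subgroupI)
      fix a assume "a \<in> {f \<in> carrier R. \<forall>y. f (\<sigma> y) = 0}"
      thus "\<ominus> a \<in> {f \<in> carrier R. \<forall>y. f (\<sigma> y) = 0}"
        using a_inv_closed[of a] assms(2) by (auto simp: uminus_eq)
    next
      show "{f \<in> carrier R. \<forall>y. f (\<sigma> y) = 0} \<noteq> {}" using const_closed[of 0] assms(2) by auto
    qed (use assms(2) in \<open>auto simp: plus_eq plus_closed\<close>)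
  qed (use assms(2) in \<open>auto simp: times_eq times_closed\<close>)
  show "carrier R \<noteq> {f \<in> carrier R. \<forall>y. f (\<sigma> y) = 0}"
  proof
    assume eq: "carrier R = {f \<in> carrier R. \<forall>y. f (\<sigma> y) = 0}"
    have "(\<lambda>v\<in>V. 1) \<in> {f \<in> carrier R. \<forall>y. f (\<sigma> y) = 0}"
      unfolding eq[symmetric] by (rule const_closed)
    hence "(\<lambda>v\<in>V. 1 :: complex) (\<sigma> (\<lambda>_. 0)) = 0" by blast
    with assms(2) show False by simp
  qed
  fix a b assume "a \<in> carrier R" "b \<in> carrier R" "a \<otimes> b \<in> {f \<in> carrier R. \<forall>y. f (\<sigma> y) = 0}"
  thus "a \<in> {f \<in> carrier R. \<forall>y. f (\<sigma> y) = 0} \<or> b \<in> {f \<in> carrier R. \<forall>y. f (\<sigma> y) = 0}"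
    using pfun_domain[OF assms(1) assms(1), of a b] assms(2) by (auto simp: times_eq)
qed (rule cring)

text \<open>Elements witnessing strict inclusions in a chain of primes are algebraically independent: the
  lowest nonvanishing coefficient of a relation lies outside the next prime by induction, and the rest
  of the relation lies inside.\<close>

lemma prime_chain_independent:
  assumes "\<And>i. i \<le> r \<Longrightarrow> primeideal (P i) R" "\<And>i. i < r \<Longrightarrow> P i \<subseteq> P (Suc i)"
    and "\<And>l. l < r \<Longrightarrow> x l \<in> P (r - l) - P (r - Suc l)"
    and "\<exists>\<beta>\<in>box {..<r} d. a \<beta> \<noteq> 0"
  shows "(\<lambda>v\<in>V. \<Sum>\<beta>\<in>box {..<r} d. a \<beta> * monom_at {..<r} \<beta> (\<lambda>l. x l v)) \<notin> P 0"
  using assms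
proof (induction r arbitrary: P a)
  case 0
  interpret P: primeideal "P 0" R using 0 by simp
  have "box {..<0::nat} d = {\<lambda>_. undefined}" by (simp add: box_def)
  then obtain c where c: "c \<noteq> 0" "(\<lambda>v\<in>V. \<Sum>\<beta>\<in>box {..<0} d. a \<beta> * monom_at {..<0} \<beta> (\<lambda>l. x l v)) = (\<lambda>v\<in>V. c)"
    using 0(4) by (auto simp: monom_at_def)
  show ?case
  proof
    assume "(\<lambda>v\<in>V. \<Sum>\<beta>\<in>box {..<0} d. a \<beta> * monom_at {..<0} \<beta> (\<lambda>l. x l v)) \<in> P 0"
    hence "(\<lambda>v\<in>V. inverse c) \<otimes> (\<lambda>v\<in>V. c) \<in> P 0" using c const_closed by (auto intro: P.I_l_closed)
    moreover have "(\<lambda>v\<in>V. inverse c) \<otimes> (\<lambda>v\<in>V. c) = \<one>" using c by (auto simp: times_eq one_eq fun_eq_iff)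
    ultimately show False using P.one_imp_carrier P.I_notcarr by simp
  qed
next
  case (Suc r)
  interpret P0: primeideal "P 0" R using Suc.prems(1) by simp
  interpret P1: primeideal "P 1" R using Suc.prems(1) by simp
  have sub: "P 0 \<subseteq> P 1" using Suc.prems(2)[of 0] by simp
  \<comment> \<open>The witnesses are numbered from the top of the chain, so dropping
    \<open>P 0\<close> drops only the last one, \<open>x r\<close>.\<close>
  have xr: "x r \<in> P 1" "x r \<notin> P 0" using Suc.prems(3)[of r] by auto
  have xc: "x l \<in> carrier R" if "l < Suc r" for l
  proof -
    interpret P': primeideal "P (Suc r - l)" R by (rule Suc.prems(1)) simp
    show ?thesis using Suc.prems(3)[OF that] by (auto intro: P'.Icarr)
  qed
  \<comment> \<open>The relation is read as a polynomial in \<open>x r\<close>; \<open>G e\<close>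
    is its coefficient at \<open>x r ^ e\<close>, a relation among the other witnesses.\<close>
  define G where "G e = (\<lambda>v\<in>V. \<Sum>\<alpha>\<in>box {..<r} d. a (\<alpha>(r := e)) * monom_at {..<r} \<alpha> (\<lambda>l. x l v))" for e
  have Gc: "G e \<in> carrier R" for e
    unfolding G_def by (intro sum_closed monom_closed xc) auto
  define S where "S = {e. e \<le> d \<and> (\<exists>\<alpha>\<in>box {..<r} d. a (\<alpha>(r := e)) \<noteq> 0)}"
  obtain \<beta> where \<beta>: "\<beta> \<in> box {..<Suc r} d" "a \<beta> \<noteq> 0" using Suc.prems(4) by blast
  then obtain e \<alpha> where "\<beta> = \<alpha>(r := e)" "e \<le> d" "\<alpha> \<in> box {..<r} d"
    unfolding box_def lessThan_Suc PiE_insert_eq by auto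
  with \<beta> have "S \<noteq> {}" by (auto simp: S_def)
  have "finite S" by (simp add: S_def)
  define m where "m = Min S"
  have m: "m \<in> S" unfolding m_def using \<open>finite S\<close> \<open>S \<noteq> {}\<close> by (rule Min_in)
  have Glow: "G e v = 0" if "e < m" "v \<in> V" for e v
  proof -
    have "e \<notin> S" using Min_le[OF \<open>finite S\<close>, of e] that by (auto simp: m_def)
    moreover have "e \<le> d" using m that by (auto simp: S_def)
    ultimately show ?thesis using that by (simp add: G_def S_def)
  qed
  have Gm: "G m \<notin> P 1"
  proof -
    have "G m \<notin> (P \<circ> Suc) 0"
      unfolding G_def
    proof (rule Suc.IH)
      show "primeideal ((P \<circ> Suc) i) R" if "i \<le> r" for i using Suc.prems(1) that by simp
      show "(P \<circ> Suc) i \<subseteq> (P \<circ> Suc) (Suc i)" if "i < r" for i using Suc.prems(2) that by simp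
      show "x l \<in> (P \<circ> Suc) (r - l) - (P \<circ> Suc) (r - Suc l)" if "l < r" for l
        using Suc.prems(3)[of l] that by (simp add: Suc_diff_le Suc_diff_Suc)
      show "\<exists>\<alpha>\<in>box {..<r} d. a (\<alpha>(r := m)) \<noteq> 0" using m by (simp add: S_def)
    qed
    thus ?thesis by simp
  qed
  define H where "H = (\<lambda>v\<in>V. \<Sum>e\<in>{m<..d}. x r v ^ (e - Suc m) * G e v)"
  have Hc: "H \<in> carrier R"
    unfolding H_def by (intro sum_closed times_closed' power_closed restrict_carrier xc Gc) simp
  define Y where "Y = (\<lambda>v\<in>V. x r v ^ m)"
  have Yc: "Y \<in> carrier R" unfolding Y_def by (intro power_closed restrict_carrier xc) simp
  have xrc: "x r \<in> carrier R" by (rule xc) simp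
  \<comment> \<open>The relation factors as \<open>x r ^ m\<close> times
    \<open>G m + x r * H\<close>. The first factor is outside the prime \<open>P 0\<close>; the
    second is outside \<open>P 1\<close>, since \<open>x r\<close> lies there and \<open>G m\<close>
    does not.\<close>
  have eq: "(\<lambda>v\<in>V. \<Sum>\<beta>\<in>box {..<Suc r} d. a \<beta> * monom_at {..<Suc r} \<beta> (\<lambda>l. x l v)) = Y \<otimes> (G m \<oplus> x r \<otimes> H)"
  proof (rule extensionalityI[of _ V])
    fix v assume v: "v \<in> V"
    have "(\<Sum>\<beta>\<in>box {..<Suc r} d. a \<beta> * monom_at {..<Suc r} \<beta> (\<lambda>l. x l v)) =
        (\<Sum>e\<le>d. x r v ^ e * G e v)"
      using v by (simp add: lessThan_Suc sum_box_insert monom_at_insert G_def sum_distrib_left mult_ac)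
    also have "\<dots> = (\<Sum>e\<in>{m..d}. x r v ^ e * G e v)"
      by (rule sum.mono_neutral_right) (auto simp: Glow v)
    also have "\<dots> = x r v ^ m * G m v + (\<Sum>e\<in>{m<..d}. x r v ^ e * G e v)"
      using m by (subst sum.head) (auto simp: S_def)
    also have "(\<Sum>e\<in>{m<..d}. x r v ^ e * G e v) = (\<Sum>e\<in>{m<..d}. x r v ^ m * (x r v * (x r v ^ (e - Suc m) * G e v)))"
    proof (rule sum.cong[OF refl])
      fix e assume "e \<in> {m<..d}"
      then obtain k where "e = Suc (m + k)" using less_imp_Suc_add by auto
      thus "x r v ^ e * G e v = x r v ^ m * (x r v * (x r v ^ (e - Suc m) * G e v))"
        by (simp add: power_add mult_ac)
    qed
    also have "\<dots> = x r v ^ m * (x r v * H v)" using v by (simp add: H_def sum_distrib_left)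
    finally show "(\<lambda>v\<in>V. \<Sum>\<beta>\<in>box {..<Suc r} d. a \<beta> * monom_at {..<Suc r} \<beta> (\<lambda>l. x l v)) v =
        (Y \<otimes> (G m \<oplus> x r \<otimes> H)) v"
      using v by (simp add: times_eq plus_eq Y_def distrib_left)
  qed (auto simp: times_eq)
  have Y: "Y \<notin> P 0"
  proof -
    have "(\<lambda>v\<in>V. x r v ^ k) \<notin> P 0" for k
    proof (induction k)
      case 0
      show ?case
      proof
        assume "(\<lambda>v\<in>V. x r v ^ 0) \<in> P 0"
        hence "\<one> \<in> P 0" unfolding power_0 one_eq .
        with P0.one_imp_carrier P0.I_notcarr show False by simp
      qed
    next
      case (Suc k)
      have "(\<lambda>v\<in>V. x r v ^ Suc k) = x r \<otimes> (\<lambda>v\<in>V. x r v ^ k)" by (auto simp: times_eq fun_eq_iff)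
      moreover have "(\<lambda>v\<in>V. x r v ^ k) \<in> carrier R" by (intro power_closed restrict_carrier xrc)
      ultimately show ?case using P0.I_prime[OF xrc] Suc xr(2) by metis
    qed
    thus ?thesis by (simp add: Y_def)
  qed
  show ?case
  proof
    assume "(\<lambda>v\<in>V. \<Sum>\<beta>\<in>box {..<Suc r} d. a \<beta> * monom_at {..<Suc r} \<beta> (\<lambda>l. x l v)) \<in> P 0"
    hence "G m \<oplus> x r \<otimes> H \<in> P 0"
      using P0.I_prime[OF Yc, of "G m \<oplus> x r \<otimes> H"] Y xrc Hc Gc unfolding eq by auto
    with sub have *: "G m \<oplus> x r \<otimes> H \<in> P 1" by blast
    have xH: "x r \<otimes> H \<in> P 1" by (rule P1.I_r_closed[OF xr(1) Hc])
    have "(G m \<oplus> x r \<otimes> H) \<oplus> \<ominus> (x r \<otimes> H) \<in> P 1"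
      by (rule P1.a_closed[OF * P1.a_inv_closed[OF xH]])
    moreover have "(G m \<oplus> x r \<otimes> H) \<oplus> \<ominus> (x r \<otimes> H) = G m"
      using xrc Hc Gc by (simp add: a_assoc r_neg)
    ultimately show False using Gm by simp
  qed
qed

text \<open>A longer chain would give \<open>card I + 1\<close> algebraically independent elements.
  Pulled back to an affine space of dimension \<open>card I\<close> they satisfy a relation, by a
  count of monomials, and the assumption \<open>inj\<close> carries the relation back to the
  ring.\<close>

theorem krull_dim_le:
  fixes \<rho> :: "('i \<Rightarrow> complex) \<Rightarrow> 'x"
  assumes I: "finite I" and \<rho>: "\<And>y. \<rho> y \<in> V"
    and poly: "\<And>f. f \<in> carrier R \<Longrightarrow> (\<lambda>y. f (\<rho> y)) \<in> pfun I"
    and inj: "\<And>f. f \<in> carrier R \<Longrightarrow> (\<And>y. f (\<rho> y) = 0) \<Longrightarrow> f = \<zero>"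
  shows "krull_dim R \<le> enat (card I)"
  unfolding krull_dim_def
proof (rule Sup_least, safe)
  fix k and P :: "nat \<Rightarrow> ('x \<Rightarrow> complex) set"
  assume prime: "\<forall>i\<le>k. primeideal (P i) R" and strict: "\<forall>i<k. P i \<subset> P (Suc i)"
  define D where "D = card I"
  define r where "r = Suc D"
  show "enat k \<le> enat (card I)"
  proof (rule ccontr)
    assume "\<not> ?thesis"
    hence k: "r \<le> k" by (simp add: r_def D_def)
    have "\<exists>y. y \<in> P (r - l) - P (r - Suc l)" if "l < r" for l
    proof -
      have "P (r - Suc l) \<subset> P (r - l)"
        using strict[rule_format, of "r - Suc l"] that k by (simp add: Suc_diff_Suc)
      thus ?thesis by blast
    qed
    then obtain x where x: "\<And>l. l < r \<Longrightarrow> x l \<in> P (r - l) - P (r - Suc l)" by metis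
    have xc: "x l \<in> carrier R" if "l < r" for l
    proof -
      interpret P': primeideal "P (r - l)" R using prime k by simp
      show ?thesis using x[OF that] by (auto intro: P'.Icarr)
    qed
    obtain e0 where "\<And>l. l \<in> {..<r} \<Longrightarrow> (\<lambda>y. x l (\<rho> y)) \<in> poly_le I e0"
      using pfun_finite_poly_le[OF I, of "{..<r}" "\<lambda>l y. x l (\<rho> y)"] poly xc by auto
    \<comment> \<open>The successor keeps \<open>r * e\<close> positive, as the estimate of the box
      sizes requires.\<close>
    define e where "e = Suc e0"
    have le: "(\<lambda>y. x l (\<rho> y)) \<in> poly_le I e" if "l \<in> {..<r}" for l
      using poly_le_mono[OF I, of e0 e] \<open>l \<in> {..<r} \<Longrightarrow> (\<lambda>y. x l (\<rho> y)) \<in> poly_le I e0\<close> that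
      by (simp add: e_def)
    \<comment> \<open>By \<open>Suc (r e N) \<le> r e * Suc N\<close> there are at most
      \<open>(r e) ^ D * Suc N ^ D\<close> equations. Taking \<open>N\<close> to be the first factor
      keeps this below the number \<open>Suc N ^ Suc D\<close> of unknowns.\<close>
    define N where "N = (r * e) ^ D"
    have "\<exists>c. \<forall>y. monom_at {..<r} \<beta> (\<lambda>l. x l (\<rho> y)) = (\<Sum>\<alpha>\<in>box I (r * (e * N)). c \<alpha> * monom_at I \<alpha> y)"
      if "\<beta> \<in> box {..<r} N" for \<beta>
    proof -
      have "(\<lambda>y. monom_at {..<r} \<beta> (\<lambda>l. x l (\<rho> y))) \<in> poly_le I (r * (e * N))"
        using poly_le_monom_at[OF I _ le that] by simp
      thus ?thesis by (auto simp: poly_le_def fun_eq_iff)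
    qed
    then obtain c where c: "\<And>\<beta> y. \<beta> \<in> box {..<r} N \<Longrightarrow> monom_at {..<r} \<beta> (\<lambda>l. x l (\<rho> y)) =
        (\<Sum>\<alpha>\<in>box I (r * (e * N)). c \<beta> \<alpha> * monom_at I \<alpha> y)" by metis
    have "card (box I (r * (e * N))) < card (box {..<r} N)"
    proof -
      have "card (box I (r * (e * N))) = Suc (r * (e * N)) ^ D" using I by (simp add: card_box D_def)
      also have "\<dots> \<le> ((r * e) * Suc N) ^ D"
      proof (rule power_mono)
        have "1 \<le> r * e" by (simp add: r_def e_def)
        thus "Suc (r * (e * N)) \<le> (r * e) * Suc N" by (simp add: mult.assoc)
      qed simp
      also have "\<dots> = N * Suc N ^ D" by (simp only: N_def power_mult_distrib)
      also have "\<dots> < Suc N ^ r" by (simp add: r_def)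
      finally show ?thesis by (simp add: card_box)
    qed
    then obtain a where a: "\<exists>\<beta>\<in>box {..<r} N. a \<beta> \<noteq> 0"
      and ac: "\<forall>\<alpha>\<in>box I (r * (e * N)). (\<Sum>\<beta>\<in>box {..<r} N. a \<beta> * c \<beta> \<alpha>) = 0"
      using underdetermined_system[of "box I (r * (e * N))" "box {..<r} N" c] I by auto
    define F where "F = (\<lambda>v\<in>V. \<Sum>\<beta>\<in>box {..<r} N. a \<beta> * monom_at {..<r} \<beta> (\<lambda>l. x l v))"
    have Fc: "F \<in> carrier R" unfolding F_def by (intro sum_closed monom_closed xc) auto
    have "F (\<rho> y) = 0" for y
    proof -
      have "F (\<rho> y) = (\<Sum>\<beta>\<in>box {..<r} N. \<Sum>\<alpha>\<in>box I (r * (e * N)). (a \<beta> * c \<beta> \<alpha>) * monom_at I \<alpha> y)"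
        unfolding F_def restrict_apply if_P[OF \<rho>]
        by (intro sum.cong refl) (simp only: c sum_distrib_left mult.assoc)
      also have "\<dots> = (\<Sum>\<alpha>\<in>box I (r * (e * N)). (\<Sum>\<beta>\<in>box {..<r} N. a \<beta> * c \<beta> \<alpha>) * monom_at I \<alpha> y)"
        by (subst sum.swap) (simp add: sum_distrib_right)
      also have "\<dots> = 0" using ac by simp
      finally show ?thesis .
    qed
    hence "F = \<zero>" by (rule inj[OF Fc])
    interpret P0: primeideal "P 0" R using prime by simp
    have "P i \<subseteq> P (Suc i)" if "i < r" for i using strict[rule_format, of i] that k by auto
    hence "F \<notin> P 0"
      unfolding F_def using prime k by (intro prime_chain_independent[OF _ _ x a]) auto
    moreover have "\<zero> \<in> P 0" by (rule P0.zero_closed)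
    ultimately show False using \<open>F = \<zero>\<close> by simp
  qed
qed

end

section \<open>Invariants of tuples of matrices under simultaneous conjugation\<close>

text \<open>Carrying the inverse as a second matrix keeps conjugation inside plain matrix algebra;
  the group inverse of \<open>GL\<close> appears only at the interface.\<close>

definition inverse_mats :: "nat \<Rightarrow> 'a::semiring_1 mat \<Rightarrow> 'a mat \<Rightarrow> bool" where
  "inverse_mats p g h \<longleftrightarrow> g \<in> carrier_mat p p \<and> h \<in> carrier_mat p p \<and> g * h = 1\<^sub>m p \<and> h * g = 1\<^sub>m p"

lemma inverse_mats_GL:
  assumes "inverse_mats p g h"
  shows "g \<in> carrier (GL p)" "inv\<^bsub>GL p\<^esub> g = h"
proof -
  interpret ring "ring_mat TYPE(complex) p ()" by (rule ring_mat)
  have g: "g \<in> Units (ring_mat TYPE(complex) p ())"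
    using assms by (auto simp: inverse_mats_def Units_def ring_mat_simps)
  thus "g \<in> carrier (GL p)" by (simp add: GL_def units_of_carrier)
  have "h = inv\<^bsub>ring_mat TYPE(complex) p ()\<^esub> g"
    using assms by (intro inv_unique') (auto simp: inverse_mats_def ring_mat_simps)
  thus "inv\<^bsub>GL p\<^esub> g = h" using g by (simp add: GL_def units_of_inv)
qed

lemma GL_inverse_mats:
  assumes "g \<in> carrier (GL p)"
  shows "inverse_mats p g (inv\<^bsub>GL p\<^esub> g)"
proof -
  interpret ring "ring_mat TYPE(complex) p ()" by (rule ring_mat)
  have "g \<in> Units (ring_mat TYPE(complex) p ())"
    using assms by (simp add: GL_def units_of_carrier)
  then obtain h where "inverse_mats p g h"
    by (auto simp: inverse_mats_def Units_def ring_mat_simps)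
  with inverse_mats_GL(2)[OF this] show ?thesis by simp
qed

lemma similar_mat_wit_inverse_mats:
  assumes "similar_mat_wit A B P Q" "A \<in> carrier_mat p p"
  shows "inverse_mats p P Q" "A = P * B * Q" "B \<in> carrier_mat p p"
  using similar_mat_witD2[OF assms(2,1)] by (auto simp: inverse_mats_def)

lemma conj_cancel:
  assumes "inverse_mats p g h" "A \<in> carrier_mat p p" "B \<in> carrier_mat p p"
  shows "(g * A * h) * (g * B * h) = g * (A * B) * h"
proof -
  have c: "g \<in> carrier_mat p p" "h \<in> carrier_mat p p" and hg: "h * g = 1\<^sub>m p"
    using assms by (auto simp: inverse_mats_def)
  note assoc = assoc_mult_mat[of _ p p _ p _ p]
  have "h * (g * B * h) = h * (g * (B * h))" using c assms(3) by (subst assoc) auto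
  also have "\<dots> = (h * g) * (B * h)" using c assms(3) by (intro assoc[symmetric]) auto
  also have "\<dots> = B * h" unfolding hg using c assms(3) by (intro left_mult_one_mat) auto
  finally have *: "h * (g * B * h) = B * h" .
  have "(g * A * h) * (g * B * h) = (g * A) * (h * (g * B * h))" using c assms(2,3) by (intro assoc) auto
  also have "\<dots> = (g * A) * B * h" unfolding * using c assms(2,3) by (intro assoc[symmetric]) auto
  also have "(g * A) * B = g * (A * B)" using c assms(2,3) by (intro assoc) auto
  finally show ?thesis .
qed

definition mtrace :: "'a::comm_ring_1 mat \<Rightarrow> 'a" where
  "mtrace A = (\<Sum>i<dim_row A. A $$ (i, i))"

lemma mtrace_comm:
  assumes "A \<in> carrier_mat p p" "B \<in> carrier_mat p p"
  shows "mtrace (A * B) = mtrace (B * A)"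
proof -
  have "mtrace (A * B) = (\<Sum>i<p. \<Sum>j<p. A $$ (i, j) * B $$ (j, i))"
    using assms by (auto simp: mtrace_def scalar_prod_def atLeast0LessThan intro!: sum.cong)
  also have "\<dots> = (\<Sum>j<p. \<Sum>i<p. B $$ (j, i) * A $$ (i, j))"
    by (subst sum.swap) (simp add: mult.commute)
  also have "\<dots> = mtrace (B * A)"
    using assms by (auto simp: mtrace_def scalar_prod_def atLeast0LessThan intro!: sum.cong)
  finally show ?thesis .
qed

lemma mtrace_conj:
  assumes "inverse_mats p g h" "A \<in> carrier_mat p p"
  shows "mtrace (g * A * h) = mtrace A"
proof -
  have c: "g \<in> carrier_mat p p" "h \<in> carrier_mat p p" "h * g = 1\<^sub>m p"
    using assms by (auto simp: inverse_mats_def)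
  have "mtrace (g * A * h) = mtrace (h * (g * A))"
    using c assms(2) by (intro mtrace_comm) auto
  also have "h * (g * A) = A"
    using c assms(2) by (simp flip: assoc_mult_mat[of h p p g p A p])
  finally show ?thesis .
qed

lemma loop_repI: "(\<And>k. k < n \<Longrightarrow> A k \<in> carrier_mat p p) \<Longrightarrow> (\<lambda>k\<in>{..<n}. A k) \<in> loop_rep n p"
  by (auto simp: loop_rep_eq)

lemma loop_repD: "A \<in> loop_rep n p \<Longrightarrow> k < n \<Longrightarrow> A k \<in> carrier_mat p p"
  by (auto simp: loop_rep_eq)

lemma function_algebra_coord_ring:
  "function_algebra (Rep Q d) (coord_ring Q d)"
proof
  fix f assume "f \<in> carrier (coord_ring Q d)"
  hence "f \<in> poly_funs Q d" by (simp add: coord_ring_def)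
  thus "f \<in> extensional (Rep Q d)" by induction (simp_all only: restrict_extensional)
qed (auto simp: coord_ring_def intro: poly_funs.intros)

lemma carrier_SL_invariants:
  "f \<in> carrier (SL_invariants n p) \<longleftrightarrow> f \<in> poly_funs (loop_quiver n) (\<lambda>_. p) \<and>
    (\<forall>g\<in>carrier (SL p). \<forall>v\<in>loop_rep n p. f (simultaneous_conj n p g v) = f v)"
  by (auto simp: SL_invariants_def invariant_ring_def coord_ring_def)

lemma simultaneous_conj_eq:
  assumes "inverse_mats p g h" "A \<in> loop_rep n p"
  shows "simultaneous_conj n p g A = (\<lambda>k\<in>{..<n}. g * A k * h)"
  using assms by (simp add: simultaneous_conj_def inverse_mats_GL(2))

lemma conj_mem:
  assumes "inverse_mats p g h" "A \<in> loop_rep n p"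
  shows "(\<lambda>k\<in>{..<n}. g * A k * h) \<in> loop_rep n p"
proof (rule loop_repI)
  fix k assume "k < n"
  thus "g * A k * h \<in> carrier_mat p p"
    using assms loop_repD[OF assms(2)] by (auto simp: inverse_mats_def intro!: mult_carrier_mat)
qed

lemma SL_inverse_mats:
  assumes "g \<in> carrier (SL p)"
  obtains h where "inverse_mats p g h"
  using assms GL_inverse_mats[of g p] by (auto simp: SL_def)

lemma simultaneous_conj_mem:
  assumes "g \<in> carrier (SL p)" "A \<in> loop_rep n p"
  shows "simultaneous_conj n p g A \<in> loop_rep n p"
  using SL_inverse_mats[OF assms(1)] conj_mem[OF _ assms(2)] simultaneous_conj_eq[OF _ assms(2)] by metis

lemma function_algebra_SL_invariants:
  "function_algebra (loop_rep n p) (SL_invariants n p)"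
proof -
  interpret C: function_algebra "loop_rep n p" "coord_ring (loop_quiver n) (\<lambda>_. p)"
    by (rule function_algebra_coord_ring)
  have C: "carrier (coord_ring (loop_quiver n) (\<lambda>_. p)) = poly_funs (loop_quiver n) (\<lambda>_. p)"
    by (simp add: coord_ring_def)
  show ?thesis
  proof
    fix f assume "f \<in> carrier (SL_invariants n p)"
    thus "f \<in> extensional (loop_rep n p)" using C.ext C by (simp add: carrier_SL_invariants)
  next
    show "(\<lambda>v\<in>loop_rep n p. c) \<in> carrier (SL_invariants n p)" for c
      by (simp add: carrier_SL_invariants poly_funs.const simultaneous_conj_mem)
  next
    fix f g assume *: "f \<in> carrier (SL_invariants n p)" "g \<in> carrier (SL_invariants n p)"
    show "(\<lambda>v\<in>loop_rep n p. f v + g v) \<in> carrier (SL_invariants n p)"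
      using * by (simp add: carrier_SL_invariants poly_funs.add simultaneous_conj_mem)
    show "(\<lambda>v\<in>loop_rep n p. f v * g v) \<in> carrier (SL_invariants n p)"
      using * by (simp add: carrier_SL_invariants poly_funs.mult simultaneous_conj_mem)
  qed (simp_all add: SL_invariants_def invariant_ring_def coord_ring_def)
qed

lemma complex_root_exists:
  fixes z :: complex
  assumes "p > 0"
  shows "\<exists>c. c ^ p = z"
proof -
  have "degree (monom 1 p + [:-z:]) = p"
    using assms by (subst degree_add_eq_left) (simp_all add: degree_monom_eq)
  hence "\<not> constant (poly (monom 1 p + [:-z:]))" using assms by (simp add: constant_degree)
  then obtain c where "poly (monom 1 p + [:-z:]) c = 0" using fundamental_theorem_of_algebra by blast
  thus ?thesis by (intro exI[of _ c]) (simp add: poly_monom)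
qed

text \<open>Conjugation by \<open>g\<close> and by a scalar multiple of determinant \<open>1\<close> agree, so \<open>SL\<close>-invariants are
  \<open>GL\<close>-invariant.\<close>

lemma invariant_conj:
  assumes f: "f \<in> carrier (SL_invariants n p)" and gh: "inverse_mats p g h" and A: "A \<in> loop_rep n p"
  shows "f (\<lambda>k\<in>{..<n}. g * A k * h) = f A"
proof -
  have g: "g \<in> carrier_mat p p" and h: "h \<in> carrier_mat p p" and eqs: "g * h = 1\<^sub>m p" "h * g = 1\<^sub>m p"
    using gh by (auto simp: inverse_mats_def)
  have "det g * det h = 1" using g h eqs by (metis det_mult det_one)
  hence dg: "det g \<noteq> 0" by auto
  \<comment> \<open>A \<open>p\<close>-th root of \<open>det g\<close>, by which \<open>g\<close> is
    divided to reach determinant \<open>1\<close>. For \<open>p = 0\<close> the determinant is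
    already \<open>1\<close>.\<close>
  obtain c where c: "c ^ p = det g" "c \<noteq> 0"
  proof (cases "p = 0")
    case True
    hence "det g = 1" using g by (metis carrier_matD(1) det_dim_zero)
    with that[of 1] show thesis by simp
  next
    case False
    then obtain c where "c ^ p = det g" using complex_root_exists[of p "det g"] by auto
    moreover have "c \<noteq> 0" using calculation False dg by (auto simp: zero_power)
    ultimately show thesis by (rule that)
  qed
  have gh': "inverse_mats p (inverse c \<cdot>\<^sub>m g) (c \<cdot>\<^sub>m h)"
    using g h eqs c(2) by (auto simp: inverse_mats_def mult_smult_assoc_mat[of _ p p _ p] mult_smult_distrib[of _ p p _ p])
  have "det (inverse c \<cdot>\<^sub>m g) = 1" using g c dg by (simp add: power_inverse)
  hence "inverse c \<cdot>\<^sub>m g \<in> carrier (SL p)" using inverse_mats_GL(1)[OF gh'] by (simp add: SL_def)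
  hence "f (simultaneous_conj n p (inverse c \<cdot>\<^sub>m g) A) = f A"
    using f A by (simp add: carrier_SL_invariants)
  also have "simultaneous_conj n p (inverse c \<cdot>\<^sub>m g) A = (\<lambda>k\<in>{..<n}. g * A k * h)"
    unfolding simultaneous_conj_eq[OF gh' A]
  proof (rule restrict_ext)
    fix k assume "k \<in> {..<n}"
    hence Ak: "A k \<in> carrier_mat p p" using loop_repD[OF A] by simp
    have "inverse c \<cdot>\<^sub>m g * A k * (c \<cdot>\<^sub>m h) = c \<cdot>\<^sub>m (inverse c \<cdot>\<^sub>m (g * A k * h))"
      using g h Ak by (simp add: mult_smult_assoc_mat[of _ p p _ p] mult_smult_distrib[of _ p p _ p])
    also have "\<dots> = g * A k * h" using c(2) by (intro eq_matI) auto
    finally show "inverse c \<cdot>\<^sub>m g * A k * (c \<cdot>\<^sub>m h) = g * A k * h" .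
  qed
  finally show ?thesis .
qed

section \<open>Evaluation along curves and degenerations\<close>

lemma invariant_poly_curve:
  assumes "f \<in> carrier (SL_invariants n p)" "\<And>t. A t \<in> loop_rep n p"
    and "\<And>k i j. k < n \<Longrightarrow> i < p \<Longrightarrow> j < p \<Longrightarrow> \<exists>q. \<forall>t. A t k $$ (i, j) = poly q t"
  shows "\<exists>q. \<forall>t. f (A t) = poly q t"
proof -
  have "f \<in> poly_funs (loop_quiver n) (\<lambda>_. p)" using assms(1) by (simp add: carrier_SL_invariants)
  thus ?thesis
  proof induction
    case (const c)
    show ?case using assms(2) by (intro exI[of _ "[:c:]"]) simp
  next
    case (coord k i j)
    thus ?case using assms(2,3) by (simp add: loop_quiver_def)
  next
    case (add f h)
    then obtain q r where "\<forall>t. f (A t) = poly q t" "\<forall>t. h (A t) = poly r t" by blast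
    thus ?case using assms(2) by (intro exI[of _ "q + r"]) simp
  next
    case (mult f h)
    then obtain q r where "\<forall>t. f (A t) = poly q t" "\<forall>t. h (A t) = poly r t" by blast
    thus ?case using assms(2) by (intro exI[of _ "q * r"]) simp
  qed
qed

lemma invariant_pfun:
  assumes "f \<in> carrier (SL_invariants n p)" "\<And>x. \<rho> x \<in> loop_rep n p"
    and "\<And>k i j. k < n \<Longrightarrow> i < p \<Longrightarrow> j < p \<Longrightarrow> (\<lambda>x. \<rho> x k $$ (i, j)) \<in> pfun I"
  shows "(\<lambda>x. f (\<rho> x)) \<in> pfun I"
proof -
  have "f \<in> poly_funs (loop_quiver n) (\<lambda>_. p)" using assms(1) by (simp add: carrier_SL_invariants)
  thus ?thesis
    by induction (use assms(2,3) in \<open>auto simp: loop_quiver_def intro: pfun.intros\<close>)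
qed

text \<open>A polynomial in the parameter that is constant off a finite set is constant. This takes
  the place of Zariski density: genericity may fail at finitely many parameters.\<close>

lemma invariant_eq_on_curve:
  assumes f: "f \<in> carrier (SL_invariants n p)" and A: "\<And>t. A t \<in> loop_rep n p"
    and poly: "\<And>k i j. k < n \<Longrightarrow> i < p \<Longrightarrow> j < p \<Longrightarrow> \<exists>q. \<forall>t. A t k $$ (i, j) = poly q t"
    and fin: "finite T" and eq: "\<And>t. t \<notin> T \<Longrightarrow> f (A t) = c"
  shows "f (A t) = c"
proof -
  obtain q where q: "\<And>t. f (A t) = poly q t" using invariant_poly_curve[OF f A poly] by blast
  have "- T \<subseteq> {t. poly (q - [:c:]) t = 0}" using eq by (auto simp: q)
  moreover have "infinite (- T)" using fin infinite_UNIV_char_0[where 'a = complex] by (simp add: Compl_eq_Diff_UNIV)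
  ultimately have "infinite {t. poly (q - [:c:]) t = 0}" using finite_subset by blast
  hence "q - [:c:] = 0" using poly_roots_finite by blast
  thus ?thesis by (simp add: q)
qed

lemma inverse_mats_diag:
  fixes x :: "nat \<Rightarrow> 'a::field"
  assumes "\<And>i. x i \<noteq> 0"
  shows "inverse_mats p (mat_diag p x) (mat_diag p (\<lambda>i. inverse (x i)))"
  using assms by (simp add: inverse_mats_def)

lemma diag_conj:
  assumes "A \<in> carrier_mat p p" "i < p" "j < p"
  shows "(mat_diag p x * A * mat_diag p y) $$ (i, j) = x i * A $$ (i, j) * y j"
  using assms by (simp add: mat_diag_mult_left[OF assms(1)] mat_diag_mult_right[of _ p])

text \<open>The limit at \<open>t = 0\<close> of conjugation by \<open>diag (t\<^bsup>- w i\<^esup>)\<close>.\<close>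

lemma invariant_degeneration:
  fixes w :: "nat \<Rightarrow> nat"
  assumes f: "f \<in> carrier (SL_invariants n p)" and A: "A \<in> loop_rep n p"
    and zero: "\<And>k i j. k < n \<Longrightarrow> i < p \<Longrightarrow> j < p \<Longrightarrow> w j < w i \<Longrightarrow> A k $$ (i, j) = 0"
  shows "f A = f (\<lambda>k\<in>{..<n}. mat p p (\<lambda>(i, j). if w i = w j then A k $$ (i, j) else 0))"
proof -
  \<comment> \<open>The truncated subtraction differs from the true one only where
    \<open>zero\<close> makes the entry vanish. At \<open>t = 0\<close> the entries with
    \<open>w i = w j\<close> survive because \<open>0 ^ 0 = 1\<close>.\<close>
  define B where "B t = (\<lambda>k\<in>{..<n}. mat p p (\<lambda>(i, j). t ^ (w j - w i) * A k $$ (i, j)))" for t :: complex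
  have B: "B t \<in> loop_rep n p" for t unfolding B_def by (rule loop_repI) simp
  have "f (B t) = f A" if "t \<notin> {0}" for t
  proof -
    have t: "t \<noteq> 0" using that by simp
    have "B t = (\<lambda>k\<in>{..<n}. mat_diag p (\<lambda>i. inverse (t ^ w i)) * A k * mat_diag p (\<lambda>i. inverse (inverse (t ^ w i))))"
      unfolding B_def
    proof (intro restrict_ext eq_matI)
      fix k i j assume k: "k \<in> {..<n}"
      have Ak: "A k \<in> carrier_mat p p" using loop_repD[OF A] k by simp
      assume "i < dim_row (mat_diag p (\<lambda>i. inverse (t ^ w i)) * A k * mat_diag p (\<lambda>i. inverse (inverse (t ^ w i))))"
        and "j < dim_col (mat_diag p (\<lambda>i. inverse (t ^ w i)) * A k * mat_diag p (\<lambda>i. inverse (inverse (t ^ w i))))"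
      hence ij: "i < p" "j < p" by (simp_all add: mat_diag_def)
      have "t ^ (w j - w i) * A k $$ (i, j) = inverse (t ^ w i) * A k $$ (i, j) * t ^ w j"
      proof (cases "w j < w i")
        case True
        thus ?thesis using zero k ij by simp
      next
        case False
        thus ?thesis using t by (simp add: power_diff field_simps)
      qed
      thus "mat p p (\<lambda>(i, j). t ^ (w j - w i) * A k $$ (i, j)) $$ (i, j) =
        (mat_diag p (\<lambda>i. inverse (t ^ w i)) * A k * mat_diag p (\<lambda>i. inverse (inverse (t ^ w i)))) $$ (i, j)"
        unfolding diag_conj[OF Ak ij] using ij by simp
    qed (simp_all add: mat_diag_def)
    thus ?thesis
      using invariant_conj[OF f inverse_mats_diag A, of "\<lambda>i. inverse (t ^ w i)"] t by simp
  qed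
  hence *: "\<And>t. t \<notin> {0} \<Longrightarrow> f (B t) = f A" .
  have "f (B 0) = f A"
  proof (rule invariant_eq_on_curve[OF f B _ _ *, where T = "{0}"])
    fix k i j assume "k < n" "i < p" "j < p"
    thus "\<exists>q. \<forall>t. B t k $$ (i, j) = poly q t"
      by (intro exI[of _ "monom (A k $$ (i, j)) (w j - w i)"]) (simp add: B_def poly_monom mult.commute)
  qed auto
  also have "B 0 = (\<lambda>k\<in>{..<n}. mat p p (\<lambda>(i, j). if w i = w j then A k $$ (i, j) else 0))"
    unfolding B_def
  proof (intro restrict_ext eq_matI)
    fix k i j assume "k \<in> {..<n}" "i < dim_row (mat p p (\<lambda>(i, j). if w i = w j then A k $$ (i, j) else 0))"
      "j < dim_col (mat p p (\<lambda>(i, j). if w i = w j then A k $$ (i, j) else 0))"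
    thus "mat p p (\<lambda>(i, j). 0 ^ (w j - w i) * A k $$ (i, j)) $$ (i, j) =
        mat p p (\<lambda>(i, j). if w i = w j then A k $$ (i, j) else 0) $$ (i, j)"
      using zero[of k i j] by (cases "w i" "w j" rule: linorder_cases) auto
  qed auto
  finally show ?thesis ..
qed

section \<open>Covariants and the invariants they produce\<close>

text \<open>Equivariant polynomial maps from tuples to matrices. They are stable under products and
  differences, so words in the arrows and shifts by scalars are at hand, and their traces and
  determinants are invariants.\<close>

definition covariant :: "nat \<Rightarrow> nat \<Rightarrow> ((nat \<Rightarrow> complex mat) \<Rightarrow> complex mat) \<Rightarrow> bool" where
  "covariant n p F \<longleftrightarrow> (\<forall>A\<in>loop_rep n p. F A \<in> carrier_mat p p) \<and>
    (\<forall>i<p. \<forall>j<p. (\<lambda>A\<in>loop_rep n p. F A $$ (i, j)) \<in> poly_funs (loop_quiver n) (\<lambda>_. p)) \<and>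
    (\<forall>A\<in>loop_rep n p. \<forall>g h. inverse_mats p g h \<longrightarrow> F (\<lambda>k\<in>{..<n}. g * A k * h) = g * F A * h)"

lemma covariantI:
  assumes "\<And>A. A \<in> loop_rep n p \<Longrightarrow> F A \<in> carrier_mat p p"
    and "\<And>i j. i < p \<Longrightarrow> j < p \<Longrightarrow> (\<lambda>A\<in>loop_rep n p. F A $$ (i, j)) \<in> poly_funs (loop_quiver n) (\<lambda>_. p)"
    and "\<And>A g h. A \<in> loop_rep n p \<Longrightarrow> inverse_mats p g h \<Longrightarrow> F (\<lambda>k\<in>{..<n}. g * A k * h) = g * F A * h"
  shows "covariant n p F"
  using assms by (simp add: covariant_def)

lemma covariantD:
  assumes "covariant n p F"
  shows "A \<in> loop_rep n p \<Longrightarrow> F A \<in> carrier_mat p p"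
    and "i < p \<Longrightarrow> j < p \<Longrightarrow> (\<lambda>A\<in>loop_rep n p. F A $$ (i, j)) \<in> poly_funs (loop_quiver n) (\<lambda>_. p)"
    and "A \<in> loop_rep n p \<Longrightarrow> inverse_mats p g h \<Longrightarrow> F (\<lambda>k\<in>{..<n}. g * A k * h) = g * F A * h"
  using assms by (simp_all add: covariant_def)

lemma covariant_arrow:
  assumes "k < n"
  shows "covariant n p (\<lambda>A. A k)"
proof (rule covariantI)
  fix i j assume "i < p" "j < p"
  thus "(\<lambda>A\<in>loop_rep n p. A k $$ (i, j)) \<in> poly_funs (loop_quiver n) (\<lambda>_. p)"
    using poly_funs.coord[of k "loop_quiver n" i "\<lambda>_. p" j] assms by (simp add: loop_quiver_def)
qed (use assms loop_repD in auto)

lemma covariant_scalar: "covariant n p (\<lambda>A. c \<cdot>\<^sub>m 1\<^sub>m p)"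
proof (rule covariantI)
  fix i j assume "i < p" "j < p"
  thus "(\<lambda>A\<in>loop_rep n p. (c \<cdot>\<^sub>m 1\<^sub>m p) $$ (i, j)) \<in> poly_funs (loop_quiver n) (\<lambda>_. p)"
    using poly_funs.const by (cases "i = j") auto
next
  fix g h :: "complex mat" assume "inverse_mats p g h"
  hence "g \<in> carrier_mat p p" "h \<in> carrier_mat p p" "g * h = 1\<^sub>m p" by (auto simp: inverse_mats_def)
  thus "c \<cdot>\<^sub>m 1\<^sub>m p = g * (c \<cdot>\<^sub>m 1\<^sub>m p) * h"
    by (simp add: mult_smult_assoc_mat[of _ p p _ p] mult_smult_distrib[of _ p p _ p])
qed simp

lemma covariant_minus:
  assumes "covariant n p F" "covariant n p G"
  shows "covariant n p (\<lambda>A. F A - G A)"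
proof (rule covariantI)
  fix i j assume ij: "i < p" "j < p"
  have "(\<lambda>A\<in>loop_rep n p. (\<lambda>A\<in>loop_rep n p. F A $$ (i, j)) A +
      (\<lambda>A\<in>loop_rep n p. (\<lambda>A\<in>loop_rep n p. -1) A * (\<lambda>A\<in>loop_rep n p. G A $$ (i, j)) A) A)
      \<in> poly_funs (loop_quiver n) (\<lambda>_. p)"
    by (intro poly_funs.add poly_funs.mult poly_funs.const covariantD(2)[OF _ ij] assms)
  also have "(\<lambda>A\<in>loop_rep n p. (\<lambda>A\<in>loop_rep n p. F A $$ (i, j)) A +
      (\<lambda>A\<in>loop_rep n p. (\<lambda>A\<in>loop_rep n p. -1) A * (\<lambda>A\<in>loop_rep n p. G A $$ (i, j)) A) A) =
      (\<lambda>A\<in>loop_rep n p. (F A - G A) $$ (i, j))"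
  proof (rule extensionalityI[of _ "loop_rep n p"])
    fix A assume A: "A \<in> loop_rep n p"
    show "(\<lambda>A\<in>loop_rep n p. (\<lambda>A\<in>loop_rep n p. F A $$ (i, j)) A +
      (\<lambda>A\<in>loop_rep n p. (\<lambda>A\<in>loop_rep n p. -1) A * (\<lambda>A\<in>loop_rep n p. G A $$ (i, j)) A) A) A =
      (\<lambda>A\<in>loop_rep n p. (F A - G A) $$ (i, j)) A"
      using A ij covariantD(1)[OF assms(1) A] covariantD(1)[OF assms(2) A] by simp
  qed auto
  finally show "(\<lambda>A\<in>loop_rep n p. (F A - G A) $$ (i, j)) \<in> poly_funs (loop_quiver n) (\<lambda>_. p)" .
next
  fix A and g h :: "complex mat" assume A: "A \<in> loop_rep n p" and gh: "inverse_mats p g h"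
  have c: "g \<in> carrier_mat p p" "h \<in> carrier_mat p p" using gh by (auto simp: inverse_mats_def)
  show "F (\<lambda>k\<in>{..<n}. g * A k * h) - G (\<lambda>k\<in>{..<n}. g * A k * h) = g * (F A - G A) * h"
    unfolding covariantD(3)[OF assms(1) A gh] covariantD(3)[OF assms(2) A gh]
    using c covariantD(1)[OF assms(1) A] covariantD(1)[OF assms(2) A]
    by (simp add: mult_minus_distrib_mat[of _ p p _ p] minus_mult_distrib_mat[of _ p p _ _ p])
qed (use assms covariantD(1) in \<open>auto intro!: minus_carrier_mat\<close>)

lemma covariant_mult:
  assumes "covariant n p F" "covariant n p G"
  shows "covariant n p (\<lambda>A. F A * G A)"
proof (rule covariantI)
  interpret function_algebra "loop_rep n p" "coord_ring (loop_quiver n) (\<lambda>_. p)"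
    by (rule function_algebra_coord_ring)
  have C: "carrier (coord_ring (loop_quiver n) (\<lambda>_. p)) = poly_funs (loop_quiver n) (\<lambda>_. p)"
    by (simp add: coord_ring_def)
  fix i j assume ij: "i < p" "j < p"
  have "(\<lambda>A\<in>loop_rep n p. \<Sum>l<p. F A $$ (i, l) * G A $$ (l, j)) \<in> poly_funs (loop_quiver n) (\<lambda>_. p)"
    unfolding C[symmetric]
    by (intro sum_closed times_closed'; unfold C)
      (use ij covariantD(2)[OF assms(1)] covariantD(2)[OF assms(2)] in auto)
  also have "(\<lambda>A\<in>loop_rep n p. \<Sum>l<p. F A $$ (i, l) * G A $$ (l, j)) =
      (\<lambda>A\<in>loop_rep n p. (F A * G A) $$ (i, j))"
  proof (rule restrict_ext)
    fix A assume A: "A \<in> loop_rep n p"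
    show "(\<Sum>l<p. F A $$ (i, l) * G A $$ (l, j)) = (F A * G A) $$ (i, j)"
      using ij covariantD(1)[OF assms(1) A] covariantD(1)[OF assms(2) A]
      by (simp add: scalar_prod_def atLeast0LessThan)
  qed
  finally show "(\<lambda>A\<in>loop_rep n p. (F A * G A) $$ (i, j)) \<in> poly_funs (loop_quiver n) (\<lambda>_. p)" .
next
  fix A and g h :: "complex mat" assume A: "A \<in> loop_rep n p" and gh: "inverse_mats p g h"
  show "F (\<lambda>k\<in>{..<n}. g * A k * h) * G (\<lambda>k\<in>{..<n}. g * A k * h) = g * (F A * G A) * h"
    unfolding covariantD(3)[OF assms(1) A gh] covariantD(3)[OF assms(2) A gh]
    using conj_cancel[OF gh covariantD(1)[OF assms(1) A] covariantD(1)[OF assms(2) A]] .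
qed (use assms covariantD(1) in \<open>auto intro!: mult_carrier_mat\<close>)

lemma invariantI:
  assumes "(\<lambda>A\<in>loop_rep n p. \<phi> A) \<in> poly_funs (loop_quiver n) (\<lambda>_. p)"
    and "\<And>A g h. A \<in> loop_rep n p \<Longrightarrow> inverse_mats p g h \<Longrightarrow> \<phi> (\<lambda>k\<in>{..<n}. g * A k * h) = \<phi> A"
  shows "(\<lambda>A\<in>loop_rep n p. \<phi> A) \<in> carrier (SL_invariants n p)"
  unfolding carrier_SL_invariants
proof (intro conjI ballI)
  fix g A assume g: "g \<in> carrier (SL p)" and A: "A \<in> loop_rep n p"
  obtain h where gh: "inverse_mats p g h" using SL_inverse_mats[OF g] .
  show "(\<lambda>A\<in>loop_rep n p. \<phi> A) (simultaneous_conj n p g A) = (\<lambda>A\<in>loop_rep n p. \<phi> A) A"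
    using A assms(2)[OF A gh] conj_mem[OF gh A] by (simp add: simultaneous_conj_eq[OF gh A])
qed (rule assms(1))

lemma mtrace_invariant:
  assumes "covariant n p F"
  shows "(\<lambda>A\<in>loop_rep n p. mtrace (F A)) \<in> carrier (SL_invariants n p)"
proof (rule invariantI)
  interpret function_algebra "loop_rep n p" "coord_ring (loop_quiver n) (\<lambda>_. p)"
    by (rule function_algebra_coord_ring)
  have C: "carrier (coord_ring (loop_quiver n) (\<lambda>_. p)) = poly_funs (loop_quiver n) (\<lambda>_. p)"
    by (simp add: coord_ring_def)
  have "(\<lambda>A\<in>loop_rep n p. \<Sum>i<p. F A $$ (i, i)) \<in> poly_funs (loop_quiver n) (\<lambda>_. p)"
    unfolding C[symmetric] by (intro sum_closed; unfold C) (use covariantD(2)[OF assms] in auto)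
  also have "(\<lambda>A\<in>loop_rep n p. \<Sum>i<p. F A $$ (i, i)) = (\<lambda>A\<in>loop_rep n p. mtrace (F A))"
    using covariantD(1)[OF assms] by (intro restrict_ext) (auto simp: mtrace_def)
  finally show "(\<lambda>A\<in>loop_rep n p. mtrace (F A)) \<in> poly_funs (loop_quiver n) (\<lambda>_. p)" .
next
  fix A and g h :: "complex mat" assume "A \<in> loop_rep n p" "inverse_mats p g h"
  thus "mtrace (F (\<lambda>k\<in>{..<n}. g * A k * h)) = mtrace (F A)"
    by (simp add: covariantD(3)[OF assms] mtrace_conj covariantD(1)[OF assms])
qed

lemma det_invariant:
  assumes "covariant n p F"
  shows "(\<lambda>A\<in>loop_rep n p. det (F A)) \<in> carrier (SL_invariants n p)"
proof (rule invariantI)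
  interpret function_algebra "loop_rep n p" "coord_ring (loop_quiver n) (\<lambda>_. p)"
    by (rule function_algebra_coord_ring)
  have C: "carrier (coord_ring (loop_quiver n) (\<lambda>_. p)) = poly_funs (loop_quiver n) (\<lambda>_. p)"
    by (simp add: coord_ring_def)
  have "(\<lambda>A\<in>loop_rep n p. \<Sum>\<pi>\<in>{\<pi>. \<pi> permutes {0..<p}}. signof \<pi> * (\<Prod>i = 0..<p. F A $$ (i, \<pi> i)))
      \<in> poly_funs (loop_quiver n) (\<lambda>_. p)"
    unfolding C[symmetric]
  proof (intro sum_closed times_closed' const_closed prod_closed)
    fix \<pi> i assume "\<pi> \<in> {\<pi>. \<pi> permutes {0..<p}}" "i \<in> {0..<p}"
    hence "i < p" "\<pi> i < p" using permutes_in_image[of \<pi> "{0..<p}" i] by auto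
    thus "(\<lambda>A\<in>loop_rep n p. F A $$ (i, \<pi> i)) \<in> carrier (coord_ring (loop_quiver n) (\<lambda>_. p))"
      unfolding C by (rule covariantD(2)[OF assms])
  qed
  also have "(\<lambda>A\<in>loop_rep n p. \<Sum>\<pi>\<in>{\<pi>. \<pi> permutes {0..<p}}. signof \<pi> * (\<Prod>i = 0..<p. F A $$ (i, \<pi> i))) =
      (\<lambda>A\<in>loop_rep n p. det (F A))"
    using covariantD(1)[OF assms] by (intro restrict_ext det_def'[symmetric])
  finally show "(\<lambda>A\<in>loop_rep n p. det (F A)) \<in> poly_funs (loop_quiver n) (\<lambda>_. p)" .
next
  fix A and g h :: "complex mat" assume A: "A \<in> loop_rep n p" and gh: "inverse_mats p g h"
  have "similar_mat (g * F A * h) (F A)"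
    using gh covariantD(1)[OF assms A] unfolding similar_mat_def inverse_mats_def
    by (intro exI[of _ g] exI[of _ h] similar_mat_witI[of _ _ p]) auto
  thus "det (F (\<lambda>k\<in>{..<n}. g * A k * h)) = det (F A)"
    using det_similar covariantD(3)[OF assms A gh] by metis
qed

section \<open>One loop\<close>

abbreviation single :: "'a mat \<Rightarrow> nat \<Rightarrow> 'a mat" where
  "single A \<equiv> \<lambda>k\<in>{..<1}. A"

lemma loop_rep_1E:
  assumes "A \<in> loop_rep 1 p"
  obtains "A = single (A 0)" "A 0 \<in> carrier_mat p p"
proof
  show "A = single (A 0)" using assms by (auto simp: loop_rep_eq PiE_iff extensional_def)
  show "A 0 \<in> carrier_mat p p" using loop_repD[OF assms] by simp
qed

lemma single_mem: "A \<in> carrier_mat p p \<Longrightarrow> single A \<in> loop_rep 1 p"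
  by (rule loop_repI)

text \<open>Schur triangularization, followed by a degeneration with pairwise distinct weights,
  which retains only the diagonal.\<close>

lemma invariant_eigenvalues:
  assumes f: "f \<in> carrier (SL_invariants 1 p)" and A: "A \<in> carrier_mat p p"
    and es: "char_poly A = (\<Prod>e\<leftarrow>es. [:- e, 1:])"
  shows "f (single A) = f (single (mat_diag p (\<lambda>i. es ! i)))"
proof -
  obtain B P Q where schur: "schur_decomposition A es = (B, P, Q)" by (cases "schur_decomposition A es")
  from schur_decomposition[OF A es schur] have sim: "similar_mat_wit A B P Q"
    and ut: "upper_triangular B" and diag: "diag_mat B = es" by auto
  note PQ = similar_mat_wit_inverse_mats[OF sim A]
  have "f (single A) = f (\<lambda>k\<in>{..<1}. P * single B k * Q)"
    using PQ(2) by (intro arg_cong[of _ _ f] restrict_ext) simp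
  also have "\<dots> = f (single B)" by (rule invariant_conj[OF f PQ(1) single_mem[OF PQ(3)]])
  also have "\<dots> = f (\<lambda>k\<in>{..<1}. mat p p (\<lambda>(i, j). if i = j then single B k $$ (i, j) else 0))"
    using PQ(3) ut by (intro invariant_degeneration[OF f single_mem[OF PQ(3)], where w = "\<lambda>i. i"]) auto
  also have "\<dots> = f (single (mat_diag p (\<lambda>i. es ! i)))"
    using PQ(3) by (intro arg_cong[of _ _ f] restrict_ext eq_matI) (auto simp: diag_mat_def mat_diag_def diag[symmetric])
  finally show ?thesis .
qed

text \<open>The value at \<open>t\<close> of the characteristic polynomial of the first matrix.
  Values stand in for coefficients because each is directly the determinant of a covariant.\<close>

definition shifted_det :: "nat \<Rightarrow> nat \<Rightarrow> nat \<Rightarrow> (nat \<Rightarrow> complex mat) \<Rightarrow> complex" where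
  "shifted_det n p t = (\<lambda>A\<in>loop_rep n p. det (of_nat t \<cdot>\<^sub>m 1\<^sub>m p - A 0))"

lemma shifted_det_invariant:
  assumes "n > 0"
  shows "shifted_det n p t \<in> carrier (SL_invariants n p)"
  unfolding shifted_det_def
  by (intro det_invariant covariant_minus covariant_scalar covariant_arrow assms)

lemma det_minus_mat_diag:
  fixes c :: "'a :: comm_ring_1"
  shows "det (c \<cdot>\<^sub>m 1\<^sub>m p - mat_diag p x) = (\<Prod>i<p. c - x i)"
proof -
  have "det (c \<cdot>\<^sub>m 1\<^sub>m p - mat_diag p x) = prod_list (diag_mat (c \<cdot>\<^sub>m 1\<^sub>m p - mat_diag p x))"
    by (rule det_upper_triangular[of _ p]) (auto simp: mat_diag_def)
  also have "diag_mat (c \<cdot>\<^sub>m 1\<^sub>m p - mat_diag p x) = map (\<lambda>i. c - x i) [0..<p]"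
    by (auto simp: diag_mat_def mat_diag_def)
  finally show ?thesis by (simp add: prod.distinct_set_conv_list[symmetric] atLeast0LessThan)
qed

lemma shifted_det_diag: "shifted_det 1 p t (single (mat_diag p x)) = (\<Prod>i<p. of_nat t - x i)"
  using single_mem[OF mat_diag_dim] by (simp add: shifted_det_def det_minus_mat_diag)

lemma shifted_det_char_poly:
  assumes "A \<in> carrier_mat p p"
  shows "shifted_det 1 p t (single A) = poly (char_poly A) (of_nat t)"
proof -
  obtain es where es: "char_poly A = (\<Prod>e\<leftarrow>es. [:- e, 1:])" "length es = p"
    using char_poly_factorized[OF assms] by blast
  have "shifted_det 1 p t (single A) = (\<Prod>i<p. of_nat t - es ! i)"
    using invariant_eigenvalues[OF shifted_det_invariant assms es(1)] shifted_det_diag by simp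
  also have "\<dots> = prod_list (map (\<lambda>e. of_nat t - e) es)"
    using es(2) by (simp add: prod.list_conv_set_nth atLeast0LessThan)
  also have "\<dots> = poly (char_poly A) (of_nat t)"
    by (simp add: es(1) poly_prod_list o_def)
  finally show ?thesis .
qed

text \<open>Both polynomials are monic of degree \<open>p\<close>, so their difference has degree
  below \<open>p\<close> and cannot have \<open>p\<close> roots unless it is zero.\<close>

lemma char_poly_determined:
  assumes A: "A \<in> carrier_mat p p" and B: "B \<in> carrier_mat p p"
    and eq: "\<And>t. t < p \<Longrightarrow> poly (char_poly A) (of_nat t) = poly (char_poly B) (of_nat t :: complex)"
  shows "char_poly A = char_poly B"
proof (rule ccontr)
  define q where "q = char_poly A - char_poly B"
  assume "\<not> ?thesis"
  hence q: "q \<noteq> 0" by (simp add: q_def)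
  have "degree q \<le> p" unfolding q_def
    using degree_monic_char_poly[OF A] degree_monic_char_poly[OF B] by (intro degree_diff_le) auto
  moreover have "coeff q p = 0" unfolding q_def
    using degree_monic_char_poly[OF A] degree_monic_char_poly[OF B] by simp
  ultimately have "degree q < p" using q by (metis leading_coeff_0_iff le_neq_implies_less)
  have "of_nat ` {..<p} \<subseteq> {z. poly q z = 0}" using eq by (auto simp: q_def)
  hence "card (of_nat ` {..<p} :: complex set) \<le> card {z. poly q z = 0}"
    by (intro card_mono poly_roots_finite q)
  also have "\<dots> \<le> degree q" by (rule card_poly_roots_bound[OF q])
  finally have "p \<le> degree q" by (simp add: card_image inj_on_def)
  with \<open>degree q < p\<close> show False by simp
qed

lemma shifted_dets_separating:
  "separating_set (loop_rep 1 p) (SL_invariants 1 p) (shifted_det 1 p ` {..<p})"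
  unfolding separating_set_def
proof (intro conjI ballI iffI)
  show "shifted_det 1 p ` {..<p} \<subseteq> carrier (SL_invariants 1 p)" using shifted_det_invariant by auto
next
  fix v w f
  assume v: "v \<in> loop_rep 1 p" and w: "w \<in> loop_rep 1 p" and f: "f \<in> carrier (SL_invariants 1 p)"
    and eq: "\<forall>s\<in>shifted_det 1 p ` {..<p}. s v = s w"
  obtain v1: "v = single (v 0)" and v0: "v 0 \<in> carrier_mat p p" using loop_rep_1E[OF v] .
  obtain w1: "w = single (w 0)" and w0: "w 0 \<in> carrier_mat p p" using loop_rep_1E[OF w] .
  have "poly (char_poly (v 0)) (of_nat t) = poly (char_poly (w 0)) (of_nat t)" if "t < p" for t
    using eq that shifted_det_char_poly[OF v0, of t] shifted_det_char_poly[OF w0, of t] v1 w1 by auto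
  hence cp: "char_poly (v 0) = char_poly (w 0)" by (rule char_poly_determined[OF v0 w0])
  obtain es where es: "char_poly (v 0) = (\<Prod>e\<leftarrow>es. [:- e, 1:])"
    using char_poly_factorized[OF v0] by blast
  show "f v = f w"
    using invariant_eigenvalues[OF f v0 es] invariant_eigenvalues[OF f w0 es[unfolded cp]] v1 w1 by simp
next
  fix v w s
  assume "\<forall>f\<in>carrier (SL_invariants 1 p). f v = f w" "s \<in> shifted_det 1 p ` {..<p}"
  thus "s v = s w" using shifted_det_invariant[of 1 p] by auto
qed

lemma card_shifted_dets: "card (shifted_det 1 p ` {..<p}) = p"
proof -
  have "inj_on (shifted_det 1 p) {..<p}"
  proof (rule inj_onI, rule ccontr)
    fix t u assume t: "t \<in> {..<p}" and eq: "shifted_det 1 p t = shifted_det 1 p u" and "t \<noteq> u"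
    have "(\<Prod>i<p. of_nat t - of_nat t :: complex) = (\<Prod>i<p. of_nat u - of_nat t)"
      using fun_cong[OF eq, of "single (mat_diag p (\<lambda>_. of_nat t))"] by (simp only: shifted_det_diag)
    with t \<open>t \<noteq> u\<close> show False by (auto simp: zero_power)
  qed
  thus ?thesis by (simp add: card_image)
qed

text \<open>For the upper bound, an invariant is determined on diagonal matrices. For the lower
  bound, freezing the eigenvalues one after another gives a chain of vanishing ideals.\<close>

lemma krull_dim_SL_invariants_1: "krull_dim (SL_invariants 1 p) = enat p"
proof (rule antisym)
  interpret function_algebra "loop_rep 1 p" "SL_invariants 1 p" by (rule function_algebra_SL_invariants)
  note diag = single_mem[OF mat_diag_dim[of p]]
  have diag_pfun: "(\<lambda>y. single (mat_diag p (X y)) k $$ (i, j)) \<in> pfun I"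
    if "k < 1" "i < p" "j < p" "\<And>j. j < p \<Longrightarrow> (\<lambda>y. X y j) \<in> pfun I" for k i j X and I :: "nat set"
    using that by (cases "i = j") (auto simp: mat_diag_def intro: pfun.const)
  have "krull_dim (SL_invariants 1 p) \<le> enat (card {..<p})"
  proof (rule krull_dim_le[where \<rho> = "\<lambda>y. single (mat_diag p y)"])
    fix f assume f: "f \<in> carrier (SL_invariants 1 p)"
    show "(\<lambda>y. f (single (mat_diag p y))) \<in> pfun {..<p}"
      by (rule invariant_pfun[OF f diag]) (rule diag_pfun, auto intro: pfun.coord)
    assume zero: "\<And>y. f (single (mat_diag p y)) = 0"
    show "f = \<zero>\<^bsub>SL_invariants 1 p\<^esub>"
    proof (rule eqI[OF f zero_closed])
      fix v assume v: "v \<in> loop_rep 1 p"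
      obtain v1: "v = single (v 0)" and v0: "v 0 \<in> carrier_mat p p" using loop_rep_1E[OF v] .
      obtain es where "char_poly (v 0) = (\<Prod>e\<leftarrow>es. [:- e, 1:])" using char_poly_factorized[OF v0] by blast
      from invariant_eigenvalues[OF f v0 this] zero v1 have "f v = 0" by simp
      thus "f v = \<zero>\<^bsub>SL_invariants 1 p\<^esub> v" using v unfolding zero_eq by simp
    qed
  qed (use diag in auto)
  thus "krull_dim (SL_invariants 1 p) \<le> enat p" by simp
  define X where "X i y j = (if j < p - i then y j else of_nat j :: complex)" for i and y :: "nat \<Rightarrow> complex" and j
  define P where "P i = {f \<in> carrier (SL_invariants 1 p). \<forall>y. f (single (mat_diag p (X i y))) = 0}" for i
  have X: "(\<lambda>y. X i y j) \<in> pfun {..<p}" if "j < p" for i j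
    using that unfolding X_def by (cases "j < p - i") (auto intro: pfun.coord pfun.const)
  have prime: "primeideal (P i) (SL_invariants 1 p)" for i
    unfolding P_def
  proof (rule vanishing_primeideal[where I = "{..<p}"])
    fix f assume f: "f \<in> carrier (SL_invariants 1 p)"
    show "(\<lambda>y. f (single (mat_diag p (X i y)))) \<in> pfun {..<p}"
      by (rule invariant_pfun[OF f diag]) (rule diag_pfun, auto intro: X)
  qed (rule diag)
  have strict: "P i \<subset> P (Suc i)" if "i < p" for i
  proof
    define l where "l = p - Suc i"
    have l: "p - i = Suc l" "l < p" "p - Suc i = l" using that by (auto simp: l_def)
    have "X (Suc i) y = X i (y(l := of_nat l))" for y
      by (auto simp: X_def l less_Suc_eq fun_eq_iff)
    thus "P i \<subseteq> P (Suc i)" by (auto simp: P_def)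
    have zero: "shifted_det 1 p l (single (mat_diag p (X (Suc i) y))) = 0" for y
      unfolding shifted_det_diag by (rule prod_zero) (use l in \<open>auto simp: X_def intro!: bexI[of _ l]\<close>)
    have "shifted_det 1 p l \<in> P (Suc i)"
      unfolding P_def mem_Collect_eq by (intro conjI allI zero shifted_det_invariant) simp
    moreover have "shifted_det 1 p l (single (mat_diag p (X i (\<lambda>_. -1)))) \<noteq> 0"
    proof -
      have "of_nat l - X i (\<lambda>_. -1) j \<noteq> 0" for j
      proof (cases "j < Suc l")
        case True
        have "of_nat l + 1 \<noteq> (0 :: complex)" by (metis of_nat_Suc of_nat_neq_0 add.commute)
        with True show ?thesis by (simp add: X_def l)
      qed (simp add: X_def l)
      thus ?thesis unfolding shifted_det_diag by simp
    qed
    hence "shifted_det 1 p l \<notin> P i" by (auto simp: P_def)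
    ultimately show "P i \<noteq> P (Suc i)" by blast
  qed
  show "enat p \<le> krull_dim (SL_invariants 1 p)"
    unfolding krull_dim_def by (rule Sup_upper) (use prime strict in blast)
qed

lemma polynomial_separating_set_1:
  "polynomial_separating_set (loop_rep 1 p) (SL_invariants 1 p) (shifted_det 1 p ` {..<p})"
  by (simp add: polynomial_separating_set_def shifted_dets_separating card_shifted_dets
      krull_dim_SL_invariants_1 del: One_nat_def)

section \<open>Indecomposables of one loop\<close>

lemma rep_iso_similar:
  assumes "A \<in> carrier_mat p p" "similar_mat A J"
  shows "rep_iso (loop_quiver 1) (\<lambda>_. p) (single A) (single J)"
proof -
  obtain P Q where "similar_mat_wit A J P Q" using assms(2) by (auto simp: similar_mat_def)
  from similar_mat_wit_sym[OF this] have sym: "similar_mat_wit J A Q P" .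
  have J: "J \<in> carrier_mat p p"
    using \<open>similar_mat_wit A J P Q\<close> assms(1) by (rule similar_mat_wit_inverse_mats(3))
  note QP = similar_mat_wit_inverse_mats[OF sym J]
  have "single J = simultaneous_conj 1 p Q (single A)"
    unfolding simultaneous_conj_eq[OF QP(1) single_mem[OF assms(1)]]
    using QP(2) by (intro restrict_ext) simp
  thus ?thesis
    using rep_iso_loop_quiver_iff[OF single_mem[OF assms(1)]] inverse_mats_GL(1)[OF QP(1)] by blast
qed

text \<open>A Jordan matrix with several blocks is the direct sum of its first block and the rest,
  both of positive dimension.\<close>

lemma indecomposable_loop_jordan_block:
  assumes "indecomposable (loop_quiver 1) (\<lambda>_. p) A"
  shows "\<exists>c. rep_iso (loop_quiver 1) (\<lambda>_. p) A (single (jordan_block p c))"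
proof -
  from assms have A: "A \<in> loop_rep 1 p" and p: "p > 0"
    by (auto simp: indecomposable_def nonzero_dim_def)
  obtain A1: "A = single (A 0)" and A0: "A 0 \<in> carrier_mat p p" using loop_rep_1E[OF A] .
  obtain as where "char_poly (A 0) = (\<Prod>a\<leftarrow>as. [:- a, 1:])" using char_poly_factorized[OF A0] by blast
  then obtain n_as where "jordan_nf (A 0) n_as" using jordan_nf_exists[OF A0] by blast
  hence pos: "0 \<notin> fst ` set n_as" and sim: "similar_mat (A 0) (jordan_matrix n_as)"
    by (auto simp: jordan_nf_def)
  have iso: "rep_iso (loop_quiver 1) (\<lambda>_. p) A (single (jordan_matrix n_as))"
    using rep_iso_similar[OF A0 sim] A1 by simp
  have "jordan_matrix n_as \<in> carrier_mat p p"
    using sim A0 by (auto simp: similar_mat_def dest: similar_mat_wit_inverse_mats(3))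
  hence p_eq: "p = sum_list (map fst n_as)" by (metis carrier_matD(1) jordan_matrix_dim(1))
  show ?thesis
  proof (cases n_as)
    case Nil
    with p p_eq show ?thesis by simp
  next
    case (Cons b bs)
    obtain m a where b: "b = (m, a)" by (cases b)
    show ?thesis
    proof (cases "bs = []")
      case True
      have "jordan_matrix n_as = jordan_block p a"
        using p_eq by (simp add: jordan_matrix_def Cons True b Let_def diag_block_mat.simps)
          (auto intro!: eq_matI)
      with iso show ?thesis by auto
    next
      case False
      define l where "l = sum_list (map fst bs)"
      have m: "m > 0" using pos by (auto simp: Cons b)
      obtain c cs where "bs = c # cs" using False by (cases bs) auto
      hence l: "l > 0" using pos by (cases "fst c") (force simp: l_def Cons)+
      have "single (jordan_matrix n_as) = Defs.direct_sum (loop_quiver 1) (\<lambda>_. m) (\<lambda>_. l)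
          (single (jordan_block m a)) (single (jordan_matrix bs))"
        unfolding Defs.direct_sum_def Cons b jordan_matrix_Cons l_def
        by (auto simp: loop_quiver_def fun_eq_iff)
      with iso have "rep_iso (loop_quiver 1) (\<lambda>_. p) A (Defs.direct_sum (loop_quiver 1) (\<lambda>_. m) (\<lambda>_. l)
          (single (jordan_block m a)) (single (jordan_matrix bs)))" by simp
      moreover have "single (jordan_block m a) \<in> loop_rep 1 m" "single (jordan_matrix bs) \<in> loop_rep 1 l"
        by (rule single_mem, simp add: l_def)+
      moreover have "(\<lambda>_. m) \<in> dim_vectors (loop_quiver 1)" "(\<lambda>_. l) \<in> dim_vectors (loop_quiver 1)"
        by (auto simp: dim_vectors_def loop_quiver_def)
      moreover have "nonzero_dim (loop_quiver 1) (\<lambda>_. m)" "nonzero_dim (loop_quiver 1) (\<lambda>_. l)"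
        using m l by (auto simp: nonzero_dim_def loop_quiver_def)
      moreover have "p = m + l" using p_eq by (simp add: Cons b l_def)
      ultimately have "\<not> indecomposable (loop_quiver 1) (\<lambda>_. p) A"
        unfolding indecomposable_def by blast
      with assms show ?thesis by blast
    qed
  qed
qed

lemma tame_loop_quiver_1: "tame_rep_type (loop_quiver 1)"
  unfolding tame_rep_type_def
proof
  fix d :: "unit \<Rightarrow> nat"
  obtain p where d: "d = (\<lambda>_. p)" by (rule that[of "d ()"]) auto
  \<comment> \<open>The Jordan block whose eigenvalue is the indeterminate \<open>[:0, 1:]\<close>;
    specialization gives all Jordan blocks of this size.\<close>
  define M :: "nat \<Rightarrow> complex poly mat"
    where "M = single (mat p p (\<lambda>(i, j). if i = j then [:0, 1:] else if Suc i = j then 1 else 0))"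
  have "M \<in> arrow_mats (loop_quiver 1) d"
    by (auto simp: M_def d arrow_mats_def loop_quiver_def)
  moreover have "family_member (loop_quiver 1) M c = single (jordan_block p c)" for c
    unfolding family_member_def M_def
    by (intro ext) (auto simp: loop_quiver_def jordan_block_def intro!: eq_matI)
  ultimately show "\<exists>\<F>::(nat \<Rightarrow> complex poly mat) set. finite \<F> \<and> \<F> \<subseteq> arrow_mats (loop_quiver 1) d \<and>
      (\<forall>A. indecomposable (loop_quiver 1) d A \<longrightarrow>
        (\<exists>M\<in>\<F>. \<exists>c. rep_iso (loop_quiver 1) d A (family_member (loop_quiver 1) M c)))"
    using indecomposable_loop_jordan_block unfolding d by (intro exI[of _ "{M}"]) auto
qed

section \<open>At least two loops\<close>

lemma mat_1_conj:
  assumes "inverse_mats 1 g h" "A \<in> carrier_mat 1 1"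
  shows "g * A * h = (A :: complex mat)"
proof -
  have c: "g \<in> carrier_mat 1 1" "h \<in> carrier_mat 1 1" "g * h = 1\<^sub>m 1"
    using assms by (auto simp: inverse_mats_def)
  have A: "A = A $$ (0, 0) \<cdot>\<^sub>m 1\<^sub>m 1" using assms(2) by (intro eq_matI) auto
  have "g * (A $$ (0, 0) \<cdot>\<^sub>m 1\<^sub>m 1) * h = A $$ (0, 0) \<cdot>\<^sub>m (g * h)"
    using c(1,2) by (simp add: mult_smult_assoc_mat[of _ 1 1 _ 1] mult_smult_distrib[of _ 1 1 _ 1] del: One_nat_def)
  thus ?thesis unfolding c(3) using A by metis
qed

section \<open>One-dimensional representations\<close>

lemma rep_iso_dim_1:
  assumes "A \<in> loop_rep n 1"
  shows "rep_iso (loop_quiver n) (\<lambda>_. 1) A B \<longleftrightarrow> B = A"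
proof -
  have "simultaneous_conj n 1 g A = A" if g: "g \<in> carrier (GL 1)" for g
  proof -
    note gh = GL_inverse_mats[OF g]
    have "simultaneous_conj n 1 g A = (\<lambda>k\<in>{..<n}. A k)"
      unfolding simultaneous_conj_eq[OF gh assms]
      using mat_1_conj[OF gh loop_repD[OF assms]] by (intro restrict_ext) simp
    also have "\<dots> = A" using assms by (simp add: loop_rep_eq PiE_iff extensional_restrict)
    finally show ?thesis .
  qed
  moreover have "1\<^sub>m 1 \<in> carrier (GL 1)"
    by (rule inverse_mats_GL(1)[of 1 "1\<^sub>m 1" "1\<^sub>m 1"]) (simp add: inverse_mats_def)
  ultimately show ?thesis using rep_iso_loop_quiver_iff[OF assms] by metis
qed

lemma indecomposable_dim_1:
  assumes "A \<in> loop_rep n 1"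
  shows "indecomposable (loop_quiver n) (\<lambda>_. 1) A"
  using assms by (auto simp: indecomposable_def nonzero_dim_def loop_quiver_def)

definition pair_rep :: "nat \<Rightarrow> complex \<Rightarrow> complex \<Rightarrow> nat \<Rightarrow> complex mat" where
  "pair_rep n a b = (\<lambda>k\<in>{..<n}. mat 1 1 (\<lambda>_. if k = 0 then a else if k = 1 then b else 0))"

lemma pair_rep_mem: "pair_rep n a b \<in> loop_rep n 1"
  unfolding pair_rep_def by (rule loop_repI) simp

lemma dim_vector_1: "(\<lambda>_. 1) \<in> dim_vectors (loop_quiver n)"
  by (auto simp: dim_vectors_def loop_quiver_def)

lemma not_finite_rep_type:
  assumes "n \<ge> 1"
  shows "\<not> finite_rep_type (loop_quiver n)"
proof
  define cls where "cls a = ((\<lambda>_. 1) :: unit \<Rightarrow> nat,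
    {B \<in> loop_rep n 1. rep_iso (loop_quiver n) (\<lambda>_. 1) (pair_rep n a 0) B})" for a
  assume "finite_rep_type (loop_quiver n)"
  moreover have "range cls \<subseteq> {(d, {B \<in> Rep (loop_quiver n) d. rep_iso (loop_quiver n) d A B}) | d A.
      d \<in> dim_vectors (loop_quiver n) \<and> indecomposable (loop_quiver n) d A}"
    unfolding cls_def using dim_vector_1 indecomposable_dim_1[OF pair_rep_mem] by blast
  ultimately have "finite (range cls)" unfolding finite_rep_type_def by (rule finite_subset[rotated])
  moreover have "inj cls"
  proof (rule injI)
    fix a b assume "cls a = cls b"
    hence "{B \<in> loop_rep n 1. B = pair_rep n a 0} = {B \<in> loop_rep n 1. B = pair_rep n b 0}"
      by (simp only: cls_def prod.inject rep_iso_dim_1[OF pair_rep_mem])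
    hence "pair_rep n a 0 = pair_rep n b 0" using pair_rep_mem by blast
    hence "pair_rep n a 0 0 $$ (0, 0) = pair_rep n b 0 0 $$ (0, 0)" by simp
    thus "a = b" using assms by (simp add: pair_rep_def)
  qed
  ultimately show False using infinite_UNIV_char_0[where 'a = complex] finite_imageD by blast
qed

text \<open>Already in dimension \<open>1\<close> the isomorphism classes fill the plane, which finitely many polynomial
  curves do not cover.\<close>

lemma not_tame_rep_type:
  assumes "n \<ge> 2"
  shows "\<not> tame_rep_type (loop_quiver n)"
proof
  assume "tame_rep_type (loop_quiver n)"
  then obtain \<F> :: "(nat \<Rightarrow> complex poly mat) set" where fin: "finite \<F>"
    and F: "\<F> \<subseteq> arrow_mats (loop_quiver n) (\<lambda>_. 1)"
    and cover: "\<And>A. indecomposable (loop_quiver n) (\<lambda>_. 1) A \<Longrightarrow>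
      \<exists>M\<in>\<F>. \<exists>c. rep_iso (loop_quiver n) (\<lambda>_. 1) A (family_member (loop_quiver n) M c)"
    using dim_vector_1[of n] unfolding tame_rep_type_def by (metis (no_types, lifting))
  define q where "q M = M 0 $$ (0, 0)" for M :: "nat \<Rightarrow> complex poly mat"
  define r where "r M = M 1 $$ (0, 0)" for M :: "nat \<Rightarrow> complex poly mat"
  have on_curve: "\<exists>M\<in>\<F>. \<exists>c. a = poly (q M) c \<and> b = poly (r M) c" for a b
  proof -
    obtain M c where M: "M \<in> \<F>"
      and iso: "rep_iso (loop_quiver n) (\<lambda>_. 1) (pair_rep n a b) (family_member (loop_quiver n) M c)"
      using cover[OF indecomposable_dim_1[OF pair_rep_mem]] by blast
    have eq: "family_member (loop_quiver n) M c k $$ (0, 0) = pair_rep n a b k $$ (0, 0)" for k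
      using iso rep_iso_dim_1[OF pair_rep_mem] by simp
    have "M \<in> {..<n} \<rightarrow>\<^sub>E carrier_mat 1 1"
      using M F by (auto simp: arrow_mats_def loop_quiver_def)
    from PiE_mem[OF this, of 0] PiE_mem[OF this, of 1] assms
    have "M 0 \<in> carrier_mat 1 1" "M 1 \<in> carrier_mat 1 1" by simp_all
    hence "poly (q M) c = a" "poly (r M) c = b"
      using eq[of 0] eq[of 1] assms
      by (auto simp: family_member_def loop_quiver_def pair_rep_def q_def r_def)
    with M show ?thesis by blast
  qed
  \<comment> \<open>Avoiding the values at \<open>0\<close> ensures that no \<open>q M\<close> is
    the constant \<open>a\<close>, so each curve meets the line over \<open>a\<close> in finitely
    many points.\<close>
  obtain a where a: "a \<notin> (\<lambda>M. poly (q M) 0) ` \<F>"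
    using fin ex_new_if_finite[OF infinite_UNIV_char_0[where 'a = complex]] by blast
  have "UNIV \<subseteq> (\<Union>M\<in>\<F>. poly (r M) ` {c. poly (q M - [:a:]) c = 0})"
  proof
    fix b show "b \<in> (\<Union>M\<in>\<F>. poly (r M) ` {c. poly (q M - [:a:]) c = 0})"
      using on_curve[of a b] by auto
  qed
  moreover have "finite {c. poly (q M - [:a:]) c = 0}" if "M \<in> \<F>" for M
  proof (rule poly_roots_finite)
    show "q M - [:a:] \<noteq> 0" using a that by (auto simp: image_iff)
  qed
  ultimately show False
    using fin infinite_UNIV_char_0[where 'a = complex] by (meson finite_UN_I finite_imageI finite_subset)
qed

section \<open>A slice for conjugation and the Krull dimension for 4 x 4 matrices\<close>

lemma sum_list_map_1: "(\<And>z. z \<in> set xs \<Longrightarrow> h z = 1) \<Longrightarrow> sum_list (map h xs) = length xs"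
  by (induction xs) auto

lemma jordan_matrix_diagonal:
  assumes "\<And>m a. (m, a) \<in> set n_as \<Longrightarrow> m = 1"
    and "i < length n_as" "j < length n_as" "i \<noteq> j"
  shows "jordan_matrix n_as $$ (i, j) = 0"
  using assms
proof (induction n_as arbitrary: i j)
  case (Cons b n_as)
  obtain a where b: "b = (1, a)" using Cons.prems(1) by (cases b) auto
  have "fst z = 1" if "z \<in> set n_as" for z using Cons.prems(1)[of "fst z" "snd z"] that by simp
  hence len: "sum_list (map fst n_as) = length n_as" by (rule sum_list_map_1)
  have "jordan_matrix n_as $$ (i - 1, j - 1) = 0" if "i > 0" "j > 0"
  proof (rule Cons.IH)
    show "m = 1" if "(m, a) \<in> set n_as" for m a using Cons.prems(1)[of m a] that by simp
  qed (use Cons.prems(2-4) that in auto)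
  thus ?case
    using Cons.prems(2-4) unfolding b jordan_matrix_Cons len by (cases i; cases j) (auto simp: len)
qed simp

text \<open>A Jordan block of size at least \<open>2\<close> would make its eigenvalue a multiple
  root of the characteristic polynomial, so all blocks have size \<open>1\<close>.\<close>

lemma diagonalizable_of_distinct:
  fixes A :: "complex mat"
  assumes A: "A \<in> carrier_mat p p" and es: "char_poly A = (\<Prod>e\<leftarrow>es. [:- e, 1:])" and dist: "distinct es"
  obtains P Q x where "similar_mat_wit A (mat_diag p x) P Q"
proof -
  obtain n_as where jnf: "jordan_nf A n_as" using jordan_nf_exists[OF A es] by blast
  hence sim: "similar_mat A (jordan_matrix n_as)" and pos: "0 \<notin> fst ` set n_as"
    by (auto simp: jordan_nf_def)
  have one: "m = 1" if "(m, a) \<in> set n_as" for m a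
  proof (rule ccontr)
    assume "m \<noteq> 1"
    moreover have "m \<noteq> 0" using pos that by force
    ultimately have "[:- a, 1:] ^ 2 dvd [:- a, 1:] ^ m" by (intro le_imp_power_dvd) simp
    also have "[:- a, 1:] ^ m dvd (\<Prod>(n, a)\<leftarrow>n_as. [:- a, 1:] ^ n)"
    proof -
      obtain xs ys where "n_as = xs @ (m, a) # ys" using \<open>(m, a) \<in> set n_as\<close> by (meson split_list)
      thus ?thesis by (simp del: mult_pCons_left mult_pCons_right)
    qed
    also have "\<dots> = (\<Prod>e\<leftarrow>es. [:- e, 1:])" using jordan_nf_char_poly[OF jnf] es by simp
    finally have dvd: "[:- a, 1:] ^ 2 dvd (\<Prod>e\<leftarrow>es. [:- e, 1:])" .
    then obtain r where r: "(\<Prod>e\<leftarrow>es. [:- e, 1:]) = [:- a, 1:] ^ 2 * r" by (elim dvdE)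
    have "poly (\<Prod>e\<leftarrow>es. [:- e, 1:]) a = 0" unfolding r poly_mult poly_power by simp
    hence "a \<in> set es" by (auto simp: poly_prod_list prod_list_zero_iff)
    then obtain xs ys where split: "es = xs @ a # ys" by (meson split_list)
    have "[:- a, 1:] * [:- a, 1:] dvd [:- a, 1:] * (\<Prod>e\<leftarrow>xs @ ys. [:- e, 1:])"
      using dvd unfolding split by (simp add: power2_eq_square mult_ac del: mult_pCons_left mult_pCons_right)
    hence "[:- a, 1:] dvd (\<Prod>e\<leftarrow>xs @ ys. [:- e, 1:])"
      by (subst (asm) dvd_mult_cancel_left) simp
    hence "poly (\<Prod>e\<leftarrow>xs @ ys. [:- e, 1:]) a = 0" by (simp only: poly_eq_0_iff_dvd)
    hence "a \<in> set (xs @ ys)" unfolding poly_prod_list prod_list_zero_iff by auto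
    with dist split show False by auto
  qed
  obtain P Q where PQ: "similar_mat_wit A (jordan_matrix n_as) P Q" using sim by (auto simp: similar_mat_def)
  have J: "jordan_matrix n_as \<in> carrier_mat p p" by (rule similar_mat_wit_inverse_mats(3)[OF PQ A])
  have "fst z = 1" if "z \<in> set n_as" for z using one[of "fst z" "snd z"] that by simp
  hence "sum_list (map fst n_as) = length n_as" by (rule sum_list_map_1)
  hence "length n_as = p" using carrier_matD(1)[OF J] by simp
  hence "jordan_matrix n_as = mat_diag p (\<lambda>i. jordan_matrix n_as $$ (i, i))"
    using J jordan_matrix_diagonal[OF one] by (intro eq_matI) (auto simp: mat_diag_def)
  with PQ that show thesis by metis
qed

text \<open>A generic tuple can be conjugated so that its first matrix is diagonal and the off-diagonal entries
  in the first row of its second matrix are \<open>1\<close>.\<close>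

definition slice_coords :: "nat \<Rightarrow> (nat \<times> nat \<times> nat) set" where
  "slice_coords n = {0} \<times> (\<lambda>i. (i, i)) ` {..<4} \<union>
    {1} \<times> ({..<4} \<times> {..<4} - {0} \<times> {1..<4}) \<union> {2..<n} \<times> ({..<4} \<times> {..<4})"

definition slice :: "nat \<Rightarrow> (nat \<times> nat \<times> nat \<Rightarrow> complex) \<Rightarrow> nat \<Rightarrow> complex mat" where
  "slice n y = (\<lambda>k\<in>{..<n}. mat 4 4 (\<lambda>(i, j).
    if k = 0 \<and> i \<noteq> j then 0 else if k = 1 \<and> i = 0 \<and> j > 0 then 1 else y (k, i, j)))"

lemma finite_slice_coords: "finite (slice_coords n)"
  by (simp add: slice_coords_def)

text \<open>The count is 4 + 13 + 16 (n - 2): a diagonal, a matrix with three normalized entries,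
  and the remaining matrices.\<close>

lemma card_slice_coords:
  assumes "n \<ge> 2"
  shows "card (slice_coords n) = 16 * (n - 1) + 1"
proof -
  have "card ((\<lambda>i. (i, i)) ` {..<4::nat}) = 4" by (subst card_image) (auto simp: inj_on_def)
  moreover have "card ({..<4::nat} \<times> {..<4::nat} - {0} \<times> {1..<4}) = 13"
    by (subst card_Diff_subset) (auto simp: card_cartesian_product)
  moreover have "card (slice_coords n) = card ({0::nat} \<times> (\<lambda>i. (i, i)) ` {..<4::nat}) +
      card ({1::nat} \<times> ({..<4::nat} \<times> {..<4::nat} - {0} \<times> {1..<4})) + card ({2..<n} \<times> ({..<4::nat} \<times> {..<4::nat}))"
    unfolding slice_coords_def by (subst card_Un_disjoint, (force+)[3])+ simp
  ultimately show ?thesis using assms by (simp add: card_cartesian_product)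
qed

lemma slice_mem: "slice n y \<in> loop_rep n 4"
  unfolding slice_def by (rule loop_repI) simp

text \<open>Conjugation by a diagonal matrix fixes the first matrix, and \<open>z\<close> is chosen
  to scale the entries \<open>(0, j)\<close> of the second one to \<open>1\<close>.\<close>

lemma invariant_zero_diag_nonzero_row:
  assumes f: "f \<in> carrier (SL_invariants n 4)" and zero: "\<And>y. f (slice n y) = 0" and n: "n \<ge> 2"
    and A: "A \<in> loop_rep n 4" and A0: "A 0 = mat_diag 4 x"
    and row: "\<And>j. 0 < j \<Longrightarrow> j < 4 \<Longrightarrow> A 1 $$ (0, j) \<noteq> 0"
  shows "f A = 0"
proof -
  define z where "z j = (if 0 < j \<and> j < 4 then A 1 $$ (0, j) else 1)" for j
  have z: "z j \<noteq> 0" for j using row by (auto simp: z_def)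
  define B where "B = (\<lambda>k\<in>{..<n}. mat_diag 4 z * A k * mat_diag 4 (\<lambda>i. inverse (z i)))"
  have B: "B k $$ (i, j) = z i * A k $$ (i, j) * inverse (z j)" if "k < n" "i < 4" "j < 4" for k i j
    using that diag_conj[OF loop_repD[OF A]] by (simp add: B_def)
  have Bk: "B k \<in> carrier_mat 4 4" if "k < n" for k
    using conj_mem[OF inverse_mats_diag A, of z] z loop_repD that unfolding B_def by blast
  have "B = slice n (\<lambda>(k, i, j). B k $$ (i, j))"
  proof (rule extensionalityI[of _ "{..<n}"])
    fix k assume "k \<in> {..<n}"
    hence k: "k < n" by simp
    show "B k = slice n (\<lambda>(k, i, j). B k $$ (i, j)) k"
    proof (rule eq_matI)
      fix i j assume "i < dim_row (slice n (\<lambda>(k, i, j). B k $$ (i, j)) k)"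
        "j < dim_col (slice n (\<lambda>(k, i, j). B k $$ (i, j)) k)"
      hence ij: "i < 4" "j < 4" using k by (simp_all add: slice_def)
      show "B k $$ (i, j) = slice n (\<lambda>(k, i, j). B k $$ (i, j)) k $$ (i, j)"
      proof (cases "k = 0 \<and> i \<noteq> j \<or> k = 1 \<and> i = 0 \<and> j > 0")
        case True
        thus ?thesis using k ij row[of j] by (auto simp: B slice_def A0 mat_diag_def z_def)
      next
        case False
        thus ?thesis using k ij by (auto simp: slice_def)
      qed
    qed (use k Bk[OF k] in \<open>simp_all add: slice_def\<close>)
  qed (auto simp: B_def slice_def)
  moreover have "f B = f A" unfolding B_def by (rule invariant_conj[OF f inverse_mats_diag A]) (rule z)
  ultimately show ?thesis using zero by metis
qed

text \<open>Adding \<open>t\<close> to all entries of the second matrix makes its first row nowhere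
  zero for all but finitely many \<open>t\<close>.\<close>

lemma invariant_zero_diag:
  assumes f: "f \<in> carrier (SL_invariants n 4)" and zero: "\<And>y. f (slice n y) = 0" and n: "n \<ge> 2"
    and A: "A \<in> loop_rep n 4" and A0: "A 0 = mat_diag 4 x"
  shows "f A = 0"
proof -
  define B where "B t = (\<lambda>k\<in>{..<n}. mat 4 4 (\<lambda>(i, j). A k $$ (i, j) + (if k = 1 then t else 0)))" for t :: complex
  have B: "B t \<in> loop_rep n 4" for t unfolding B_def by (rule loop_repI) simp
  have "f (B 0) = 0"
  proof (rule invariant_eq_on_curve[OF f B, where T = "(\<lambda>j. - A 1 $$ (0, j)) ` {..<4}"])
    fix k i j assume "k < n" "i < (4::nat)" "j < (4::nat)"
    thus "\<exists>q. \<forall>t. B t k $$ (i, j) = poly q t"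
      by (intro exI[of _ "[:A k $$ (i, j), if k = 1 then 1 else 0:]"]) (simp add: B_def)
  next
    fix t assume t: "t \<notin> (\<lambda>j. - A 1 $$ (0, j)) ` {..<4}"
    show "f (B t) = 0"
    proof (rule invariant_zero_diag_nonzero_row[OF f zero n B])
      show "B t 0 = mat_diag 4 x" using n by (auto simp: B_def A0 mat_diag_def intro!: eq_matI)
      fix j :: nat assume "0 < j" "j < 4"
      thus "B t 1 $$ (0, j) \<noteq> 0" using t n by (auto simp: B_def add_eq_0_iff image_iff)
    qed
  qed simp
  moreover have "B 0 = A"
  proof (rule extensionalityI[of _ "{..<n}"])
    fix k assume "k \<in> {..<n}"
    thus "B 0 k = A k" using loop_repD[OF A, of k] by (intro eq_matI) (auto simp: B_def)
  qed (use A in \<open>auto simp: B_def loop_rep_eq PiE_iff\<close>)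
  ultimately show ?thesis by simp
qed

lemma invariant_zero_diagonalizable:
  assumes f: "f \<in> carrier (SL_invariants n 4)" and zero: "\<And>y. f (slice n y) = 0" and n: "n \<ge> 2"
    and A: "A \<in> loop_rep n 4" and sim: "similar_mat_wit (A 0) (mat_diag 4 x) P Q"
  shows "f A = 0"
proof -
  have A0: "A 0 \<in> carrier_mat 4 4" using loop_repD[OF A] n by simp
  have QP: "inverse_mats 4 Q P" "Q * A 0 * P = mat_diag 4 x"
    using similar_mat_wit_inverse_mats[OF similar_mat_wit_sym[OF sim] mat_diag_dim] by simp_all
  have "f (\<lambda>k\<in>{..<n}. Q * A k * P) = 0"
    by (rule invariant_zero_diag[OF f zero n conj_mem[OF QP(1) A]]) (use n QP(2) in simp)
  thus ?thesis using invariant_conj[OF f QP(1) A] by simp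
qed

text \<open>Adding \<open>t * i\<close> to the \<open>i\<close>-th diagonal entry separates the
  eigenvalues for all but finitely many \<open>t\<close>, which brings the first matrix into the
  diagonalizable case.\<close>

lemma invariant_zero_upper_triangular:
  assumes f: "f \<in> carrier (SL_invariants n 4)" and zero: "\<And>y. f (slice n y) = 0" and n: "n \<ge> 2"
    and A: "A \<in> loop_rep n 4" and ut: "upper_triangular (A 0)"
  shows "f A = 0"
proof -
  have A0: "A 0 \<in> carrier_mat 4 4" using loop_repD[OF A] n by simp
  define B where "B t = (\<lambda>k\<in>{..<n}. mat 4 4 (\<lambda>(i, j). A k $$ (i, j) +
    (if k = 0 \<and> i = j then t * of_nat i else 0)))" for t :: complex
  have B: "B t \<in> loop_rep n 4" for t unfolding B_def by (rule loop_repI) simp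
  \<comment> \<open>The parameters at which two diagonal entries coincide. Pairs with
    \<open>i = j\<close> contribute the value \<open>0\<close>, by the convention on division, and
    merely enlarge the finite exceptional set.\<close>
  define T where "T = (\<lambda>(i, j). (A 0 $$ (j, j) - A 0 $$ (i, i)) / (of_nat i - of_nat j)) ` ({..<4} \<times> {..<4})"
  have "f (B 0) = 0"
  proof (rule invariant_eq_on_curve[OF f B, where T = T])
    fix k i j assume "k < n" "i < (4::nat)" "j < (4::nat)"
    thus "\<exists>q. \<forall>t. B t k $$ (i, j) = poly q t"
      by (intro exI[of _ "[:A k $$ (i, j), if k = 0 \<and> i = j then of_nat i else 0:]"]) (simp add: B_def)
  next
    fix t assume t: "t \<notin> T"
    have B0: "B t 0 \<in> carrier_mat 4 4" "upper_triangular (B t 0)"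
      using n ut A0 by (auto simp: B_def intro!: upper_triangularI dest: upper_triangularD)
    define b where "b i = A 0 $$ (i, i) + t * of_nat i" for i
    have diag: "diag_mat (B t 0) = map b [0..<4]" using n by (simp add: B_def diag_mat_def b_def)
    have "inj_on b {0..<4}"
    proof (rule inj_onI, rule ccontr)
      fix i j assume ij: "i \<in> {0..<4}" "j \<in> {0..<4}" "b i = b j" "i \<noteq> j"
      hence "t = (A 0 $$ (j, j) - A 0 $$ (i, i)) / (of_nat i - of_nat j)"
        by (simp add: b_def field_simps)
      hence "t \<in> T" unfolding T_def using ij(1,2) by (intro image_eqI[of _ _ "(i, j)"]) auto
      with t show False by blast
    qed
    hence "distinct (map b [0..<4])" by (simp add: distinct_map)
    moreover have "char_poly (B t 0) = (\<Prod>e\<leftarrow>map b [0..<4]. [:- e, 1:])"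
      using char_poly_upper_triangular[OF B0] diag by simp
    ultimately obtain P Q x where "similar_mat_wit (B t 0) (mat_diag 4 x) P Q"
      using diagonalizable_of_distinct[OF B0(1)] by blast
    thus "f (B t) = 0" by (rule invariant_zero_diagonalizable[OF f zero n B])
  qed (simp add: T_def)
  moreover have "B 0 = A"
  proof (rule extensionalityI[of _ "{..<n}"])
    fix k assume "k \<in> {..<n}"
    thus "B 0 k = A k" using loop_repD[OF A, of k] by (intro eq_matI) (auto simp: B_def)
  qed (use A in \<open>auto simp: B_def loop_rep_eq PiE_iff\<close>)
  ultimately show ?thesis by simp
qed

text \<open>Schur form reduces to a triangular first matrix. This completes the proof that
  restriction to the slice is injective on invariants.\<close>

lemma invariant_zero:
  assumes f: "f \<in> carrier (SL_invariants n 4)" and zero: "\<And>y. f (slice n y) = 0" and n: "n \<ge> 2"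
    and A: "A \<in> loop_rep n 4"
  shows "f A = 0"
proof -
  have A0: "A 0 \<in> carrier_mat 4 4" using loop_repD[OF A] n by simp
  obtain es where es: "char_poly (A 0) = (\<Prod>e\<leftarrow>es. [:- e, 1:])" using char_poly_factorized[OF A0] by blast
  obtain B P Q where schur: "schur_decomposition (A 0) es = (B, P, Q)" by (cases "schur_decomposition (A 0) es")
  from schur_decomposition[OF A0 es schur] have sim: "similar_mat_wit (A 0) B P Q"
    and ut: "upper_triangular B" by auto
  have B: "B \<in> carrier_mat 4 4" by (rule similar_mat_wit_inverse_mats(3)[OF sim A0])
  have QP: "inverse_mats 4 Q P" "B = Q * A 0 * P"
    using similar_mat_wit_inverse_mats[OF similar_mat_wit_sym[OF sim] B] by simp_all
  have "f (\<lambda>k\<in>{..<n}. Q * A k * P) = 0"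
    by (rule invariant_zero_upper_triangular[OF f zero n conj_mem[OF QP(1) A]]) (use n QP(2) ut in simp)
  thus ?thesis using invariant_conj[OF f QP(1) A] by simp
qed

lemma krull_dim_SL_invariants_le:
  assumes "n \<ge> 2"
  shows "krull_dim (SL_invariants n 4) \<le> enat (16 * (n - 1) + 1)"
proof -
  interpret function_algebra "loop_rep n 4" "SL_invariants n 4" by (rule function_algebra_SL_invariants)
  have "krull_dim (SL_invariants n 4) \<le> enat (card (slice_coords n))"
  proof (rule krull_dim_le[OF finite_slice_coords slice_mem])
    fix f assume f: "f \<in> carrier (SL_invariants n 4)"
    show "(\<lambda>y. f (slice n y)) \<in> pfun (slice_coords n)"
    proof (rule invariant_pfun[OF f slice_mem])
      fix k i j assume kij: "k < n" "i < (4::nat)" "j < (4::nat)"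
      have "(k, i, j) \<in> slice_coords n" if "\<not> (k = 0 \<and> i \<noteq> j)" "\<not> (k = 1 \<and> i = 0 \<and> j > 0)"
        using that kij by (cases "k < 2") (auto simp: slice_coords_def less_2_cases_iff)
      thus "(\<lambda>y. slice n y k $$ (i, j)) \<in> pfun (slice_coords n)"
        using kij pfun.coord pfun.const
        by (cases "k = 0 \<and> i \<noteq> j"; cases "k = 1 \<and> i = 0 \<and> j > 0") (auto simp: slice_def)
    qed
    assume zero: "\<And>y. f (slice n y) = 0"
    show "f = \<zero>\<^bsub>SL_invariants n 4\<^esub>"
    proof (rule eqI[OF f zero_closed])
      fix v assume v: "v \<in> loop_rep n 4"
      thus "f v = \<zero>\<^bsub>SL_invariants n 4\<^esub> v"
        using invariant_zero[OF f zero assms v] unfolding zero_eq by simp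
    qed
  qed
  thus ?thesis by (simp add: card_slice_coords[OF assms])
qed

section \<open>Cycle invariants from spectral projections\<close>

definition row_mat :: "nat \<Rightarrow> (nat \<Rightarrow> 'a::comm_ring_1) \<Rightarrow> 'a mat" where
  "row_mat i r = mat 4 4 (\<lambda>(a, b). if a = i then r b else 0)"

text \<open>Multiplying row matrices follows a path of entries and the trace closes it, so traces of
  words become products of entries along cycles.\<close>

lemma row_mat_times: "j < 4 \<Longrightarrow> row_mat i r * row_mat j s = row_mat i (\<lambda>b. r j * s b)"
proof (rule eq_matI)
  fix a b assume "j < 4" "a < dim_row (row_mat i (\<lambda>b. r j * s b))" "b < dim_col (row_mat i (\<lambda>b. r j * s b))"
  thus "(row_mat i r * row_mat j s) $$ (a, b) = row_mat i (\<lambda>b. r j * s b) $$ (a, b)"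
    by (simp add: row_mat_def scalar_prod_def if_distrib sum.If_cases cong: if_cong)
qed (simp_all add: row_mat_def)

lemma mtrace_row_mat: "i < 4 \<Longrightarrow> mtrace (row_mat i r) = r i"
  by (simp add: row_mat_def mtrace_def)

text \<open>If the first matrix is \<open>diag (0, 1, 2, 3)\<close>, then this is a nonzero multiple of its \<open>i\<close>-th spectral
  projection, by Lagrange interpolation.\<close>

definition spectral_proj :: "nat \<Rightarrow> (nat \<Rightarrow> complex mat) \<Rightarrow> complex mat" where
  "spectral_proj i A = foldr (\<lambda>j M. (A 0 - of_nat j \<cdot>\<^sub>m 1\<^sub>m 4) * M) (filter (\<lambda>j. j \<noteq> i) [0..<4]) (1\<^sub>m 4)"

lemma covariant_spectral_proj:
  assumes "n > 0"
  shows "covariant n 4 (spectral_proj i)"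
proof -
  have "covariant n 4 (\<lambda>A. foldr (\<lambda>j M. (A 0 - of_nat j \<cdot>\<^sub>m 1\<^sub>m 4) * M) js (1\<^sub>m 4))" for js
  proof (induction js)
    case Nil
    have "1 \<cdot>\<^sub>m 1\<^sub>m 4 = (1\<^sub>m 4 :: complex mat)" by (intro eq_matI) auto
    thus ?case using covariant_scalar[of n 4 1] by simp
  next
    case (Cons j js)
    show ?case unfolding foldr_Cons o_def
      by (intro covariant_mult covariant_minus covariant_arrow covariant_scalar assms Cons)
  qed
  thus ?thesis unfolding spectral_proj_def .
qed

lemma spectral_proj_times:
  assumes i: "i < 4"
  obtains c where "c \<noteq> 0" "\<And>A B. A 0 = mat_diag 4 of_nat \<Longrightarrow> B \<in> carrier_mat 4 4 \<Longrightarrow>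
    spectral_proj i A * B = row_mat i (\<lambda>b. c * B $$ (i, b))"
proof
  define js where "js = filter (\<lambda>j. j \<noteq> i) [0..<4]"
  define c where "c a = (\<Prod>j\<leftarrow>js. of_nat a - of_nat j :: complex)" for a
  show "c i \<noteq> 0" by (auto simp: c_def js_def prod_list_zero_iff)
  fix A :: "nat \<Rightarrow> complex mat" and B :: "complex mat"
  assume A: "A 0 = mat_diag 4 of_nat" and B: "B \<in> carrier_mat 4 4"
  have d: "mat_diag 4 of_nat - of_nat j \<cdot>\<^sub>m 1\<^sub>m 4 = mat_diag 4 (\<lambda>a. of_nat a - of_nat j :: complex)" for j
    by (rule eq_matI) (auto simp: mat_diag_def)
  have "foldr (\<lambda>j M. (mat_diag 4 of_nat - of_nat j \<cdot>\<^sub>m 1\<^sub>m 4) * M) ks (1\<^sub>m 4) =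
      mat_diag 4 (\<lambda>a. \<Prod>j\<leftarrow>ks. of_nat a - of_nat j :: complex)" for ks
    by (induction ks) (simp_all add: d)
  hence "spectral_proj i A = mat_diag 4 c" by (simp add: spectral_proj_def A js_def c_def[abs_def])
  moreover have "c a = 0" if "a < 4" "a \<noteq> i" for a
    using that by (auto simp: c_def js_def prod_list_zero_iff image_iff)
  ultimately show "spectral_proj i A * B = row_mat i (\<lambda>b. c i * B $$ (i, b))"
    using B by (intro eq_matI) (auto simp: mat_diag_mult_left[OF B] row_mat_def)
qed

text \<open>Spectral projections isolate single rows of the arrows. The traces of products of one,
  two or three such rows are entry products along cycles, up to nonzero scalars common to both
  tuples.\<close>

lemma cycles_agree:
  assumes A: "A \<in> loop_rep n 4" "A 0 = mat_diag 4 of_nat" and B: "B \<in> loop_rep n 4" "B 0 = mat_diag 4 of_nat"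
    and eq: "\<And>f. f \<in> carrier (SL_invariants n 4) \<Longrightarrow> f A = f B"
    and ijl: "i < 4" "j < 4" "l < 4" and k: "k < n" "k' < n" "k'' < n"
  shows "A k $$ (i, i) = B k $$ (i, i)"
    and "A k $$ (i, j) * A k' $$ (j, i) = B k $$ (i, j) * B k' $$ (j, i)"
    and "A k $$ (i, j) * A k' $$ (j, l) * A k'' $$ (l, i) = B k $$ (i, j) * B k' $$ (j, l) * B k'' $$ (l, i)"
proof -
  define e where "e i k A = spectral_proj i A * A k" for i k and A :: "nat \<Rightarrow> complex mat"
  have cov: "covariant n 4 (e i k)" if "k < n" for i k
    unfolding e_def using that by (intro covariant_mult covariant_spectral_proj covariant_arrow) auto
  define R where "R i c \<longleftrightarrow> c \<noteq> 0 \<and> (\<forall>A\<in>loop_rep n 4. \<forall>k<n. A 0 = mat_diag 4 of_nat \<longrightarrow>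
      e i k A = row_mat i (\<lambda>b. c * A k $$ (i, b)))" for i c
  have "\<exists>c. R i c" if "i < 4" for i
    using spectral_proj_times[OF that] unfolding R_def e_def by (metis loop_repD)
  then obtain c where "\<And>i. i < 4 \<Longrightarrow> R i (c i)" by metis
  hence c: "\<And>i. i < 4 \<Longrightarrow> c i \<noteq> 0" and row: "\<And>i k A. i < 4 \<Longrightarrow> A \<in> loop_rep n 4 \<Longrightarrow> k < n \<Longrightarrow>
      A 0 = mat_diag 4 of_nat \<Longrightarrow> e i k A = row_mat i (\<lambda>b. c i * A k $$ (i, b))"
    unfolding R_def by blast+
  note rowA = row[OF _ A(1) _ A(2)] and rowB = row[OF _ B(1) _ B(2)]
  have tr: "mtrace (F A) = mtrace (F B)" if "covariant n 4 F" for F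
    using eq[OF mtrace_invariant[OF that]] A(1) B(1) by simp
  show "A k $$ (i, i) = B k $$ (i, i)"
    using tr[OF cov[OF k(1), of i]] c[OF ijl(1)] ijl k by (simp add: rowA rowB mtrace_row_mat)
  show "A k $$ (i, j) * A k' $$ (j, i) = B k $$ (i, j) * B k' $$ (j, i)"
    using tr[OF covariant_mult[OF cov[OF k(1), of i] cov[OF k(2), of j]]] c ijl k
    by (simp add: rowA rowB mtrace_row_mat row_mat_times)
  show "A k $$ (i, j) * A k' $$ (j, l) * A k'' $$ (l, i) = B k $$ (i, j) * B k' $$ (j, l) * B k'' $$ (l, i)"
    using tr[OF covariant_mult[OF covariant_mult[OF cov[OF k(1), of i] cov[OF k(2), of j]] cov[OF k(3), of l]]]
      c ijl k by (simp add: rowA rowB mtrace_row_mat row_mat_times mult.assoc)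
qed

section \<open>A transversal family of pairs\<close>

text \<open>At parameter \<open>0\<close> the two families below are extensions of the same three simple representations,
  of dimensions \<open>1\<close>, \<open>2\<close>, \<open>1\<close>, in the same order, but with different extension classes. The parameters
  move transversally to the locus of such pairs, which has codimension two more than the dimension
  of the quotient. A coordinate \<open>(0, 0, 0, j)\<close> moves the spectrum of the first matrix, \<open>(1, k, i, j)\<close> and
  \<open>(2, k, i, j)\<close> move the entry \<open>(i, j)\<close> of the \<open>k\<close>-th matrix on the left and on the right.\<close>

definition upper_pos :: "(nat \<times> nat) set" where
  "upper_pos = {(0, 1), (0, 2), (1, 3), (2, 3), (0, 3)}"

definition lower_pos :: "(nat \<times> nat) set" where
  "lower_pos = {(1, 0), (2, 0), (3, 1), (3, 2), (3, 0)}"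

text \<open>Moving upper entries stays inside the locus of extensions. Diagonal block entries move
  on the left only, since moving both sides together keeps the composition factors equal. For
  \<open>k = 1\<close> the entry \<open>(1, 2)\<close> is fixed because torus conjugation in the
  two-dimensional block rescales it.\<close>

definition free_pos :: "nat \<Rightarrow> (nat \<times> nat) set" where
  "free_pos k = {..<4} \<times> {..<4} - (upper_pos \<union> (if k = 1 then {(1, 2)} else {}))"

definition pair_coords :: "nat \<Rightarrow> (nat \<times> nat \<times> nat \<times> nat) set" where
  "pair_coords n = {0} \<times> {0} \<times> {0} \<times> {..<4} \<union> {1} \<times> Sigma {1..<n} free_pos \<union> {2} \<times> {1..<n} \<times> lower_pos"

text \<open>The first matrix is perturbed by a rank-one matrix with equal rows: a diagonal
  perturbation could merely permute the spectrum and create further common zeros. The units at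
  \<open>(1, 2)\<close> and \<open>(2, 1)\<close> make the middle block simple; it is attached
  through index \<open>1\<close> here and through index \<open>2\<close> on the right.\<close>

definition left_rep :: "nat \<Rightarrow> (nat \<times> nat \<times> nat \<times> nat \<Rightarrow> complex) \<Rightarrow> nat \<Rightarrow> complex mat" where
  "left_rep n x = (\<lambda>k\<in>{..<n}. mat 4 4 (\<lambda>(i, j).
    if k = 0 then (if i = j then of_nat i else 0) + x (0, 0, 0, j)
    else (if k = 1 \<and> (i, j) \<in> {(0, 1), (1, 3), (1, 2), (2, 1)} then 1 else 0) +
      (if (i, j) \<in> free_pos k then x (1, k, i, j) else 0)))"

definition right_rep :: "nat \<Rightarrow> (nat \<times> nat \<times> nat \<times> nat \<Rightarrow> complex) \<Rightarrow> nat \<Rightarrow> complex mat" where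
  "right_rep n x = (\<lambda>k\<in>{..<n}. mat 4 4 (\<lambda>(i, j).
    if k = 0 then (if i = j then of_nat i else 0)
    else (if k = 1 \<and> (i, j) \<in> {(0, 2), (2, 3), (1, 2), (2, 1)} then 1 else 0) +
      (if (i, j) \<in> lower_pos then x (2, k, i, j) else 0)))"

lemma mem_free_pos:
  "(i, j) \<in> free_pos k \<longleftrightarrow> i < 4 \<and> j < 4 \<and> (i, j) \<notin> upper_pos \<and> \<not> (k = 1 \<and> i = 1 \<and> j = 2)"
  by (auto simp: free_pos_def)

lemma left_rep_mem: "left_rep n x \<in> loop_rep n 4"
  unfolding left_rep_def by (rule loop_repI) simp

lemma right_rep_mem: "right_rep n x \<in> loop_rep n 4"
  unfolding right_rep_def by (rule loop_repI) simp

lemma finite_free_pos: "finite (free_pos k)"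
  by (simp add: free_pos_def)

lemma finite_pair_coords: "finite (pair_coords n)"
  by (simp add: pair_coords_def finite_free_pos lower_pos_def)

text \<open>The count is 4 + 10 + 11 (n - 2) + 5 (n - 1), two more than for the slice.\<close>

lemma card_pair_coords:
  assumes "n \<ge> 2"
  shows "card (pair_coords n) = 16 * (n - 1) + 3"
proof -
  have "card (free_pos k) = (if k = 1 then 10 else 11)" for k
    unfolding free_pos_def
    by (subst card_Diff_subset) (auto simp: upper_pos_def card_cartesian_product)
  moreover have "{1..<n} = insert 1 {2..<n}" using assms by auto
  ultimately have "card (Sigma {1..<n} free_pos) = 10 + 11 * (n - 2)"
    by (subst card_SigmaI) (simp_all add: finite_free_pos)
  moreover have "card lower_pos = 5" by (simp add: lower_pos_def)
  moreover have "card (pair_coords n) = card ({0::nat} \<times> {0::nat} \<times> {0::nat} \<times> {..<4::nat}) +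
      card ({1::nat} \<times> Sigma {1..<n} free_pos) + card ({2::nat} \<times> {1..<n} \<times> lower_pos)"
    unfolding pair_coords_def
    by (subst card_Un_disjoint; (auto simp: finite_free_pos lower_pos_def)?)+
  ultimately show ?thesis using assms by (simp add: card_cartesian_product)
qed

lemma less_4_cases: "i < 4 \<longleftrightarrow> i = 0 \<or> i = 1 \<or> i = 2 \<or> i = (3::nat)"
  by auto

text \<open>Both tuples are block triangular for the weights 0, 1, 1, 2 with the same diagonal
  blocks, so both degenerate to the same semisimple tuple.\<close>

lemma left_right_rep_0:
  assumes f: "f \<in> carrier (SL_invariants n 4)"
  shows "f (left_rep n (\<lambda>_. 0)) = f (right_rep n (\<lambda>_. 0))"
proof -
  define w :: "nat \<Rightarrow> nat" where "w i = (if i = 0 then 0 else if i = 3 then 2 else 1)" for i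
  have lower: "(i, j) \<in> lower_pos" if "i < 4" "j < 4" "w j < w i" for i j
    using that unfolding less_4_cases by (elim disjE) (simp_all add: w_def lower_pos_def)
  have level: "i = j \<or> (i, j) = (1, 2) \<or> (i, j) = (2, 1)" if "i < 4" "j < 4" "w i = w j" for i j
    using that unfolding less_4_cases by (elim disjE) (simp_all add: w_def)
  have L: "left_rep n (\<lambda>_. 0) k $$ (i, j) = (if k = 0 then if i = j then of_nat i else 0
      else if k = 1 \<and> (i, j) \<in> {(0, 1), (1, 3), (1, 2), (2, 1)} then 1 else 0)"
    if "k < n" "i < 4" "j < 4" for k i j using that by (simp add: left_rep_def)
  have R: "right_rep n (\<lambda>_. 0) k $$ (i, j) = (if k = 0 then if i = j then of_nat i else 0
      else if k = 1 \<and> (i, j) \<in> {(0, 2), (2, 3), (1, 2), (2, 1)} then 1 else 0)"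
    if "k < n" "i < 4" "j < 4" for k i j using that by (simp add: right_rep_def)
  have "f (left_rep n (\<lambda>_. 0)) =
      f (\<lambda>k\<in>{..<n}. mat 4 4 (\<lambda>(i, j). if w i = w j then left_rep n (\<lambda>_. 0) k $$ (i, j) else 0))"
  proof (rule invariant_degeneration[OF f left_rep_mem])
    fix k i j assume kij: "k < n" "i < (4::nat)" "j < (4::nat)" "w j < w i"
    have "(i, j) \<in> lower_pos" by (rule lower) (use kij in auto)
    thus "left_rep n (\<lambda>_. 0) k $$ (i, j) = 0" unfolding L[OF kij(1-3)] by (auto simp: lower_pos_def)
  qed
  also have "(\<lambda>k\<in>{..<n}. mat 4 4 (\<lambda>(i, j). if w i = w j then left_rep n (\<lambda>_. 0) k $$ (i, j) else 0)) =
      (\<lambda>k\<in>{..<n}. mat 4 4 (\<lambda>(i, j). if w i = w j then right_rep n (\<lambda>_. 0) k $$ (i, j) else 0))"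
  proof (rule restrict_ext)
    fix k assume "k \<in> {..<n}"
    hence k: "k < n" by simp
    have "left_rep n (\<lambda>_. 0) k $$ (i, j) = right_rep n (\<lambda>_. 0) k $$ (i, j)"
      if "i < 4" "j < 4" "w i = w j" for i j
      unfolding L[OF k that(1,2)] R[OF k that(1,2)] using level[OF that] by auto
    thus "mat 4 4 (\<lambda>(i, j). if w i = w j then left_rep n (\<lambda>_. 0) k $$ (i, j) else 0) =
        mat 4 4 (\<lambda>(i, j). if w i = w j then right_rep n (\<lambda>_. 0) k $$ (i, j) else 0)"
      by (intro eq_matI) auto
  qed
  also have "f \<dots> = f (right_rep n (\<lambda>_. 0))"
  proof (rule invariant_degeneration[OF f right_rep_mem, symmetric])
    fix k i j assume kij: "k < n" "i < (4::nat)" "j < (4::nat)" "w j < w i"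
    have "(i, j) \<in> lower_pos" by (rule lower) (use kij in auto)
    thus "right_rep n (\<lambda>_. 0) k $$ (i, j) = 0" unfolding R[OF kij(1-3)] by (auto simp: lower_pos_def)
  qed
  finally show ?thesis .
qed

text \<open>Each \<open>i < 4\<close> must be an eigenvalue of the left matrix. Because the
  perturbation has equal rows, an eigenvector for \<open>i\<close> is supported at index
  \<open>i\<close> alone, and its \<open>i\<close>-th equation kills
  \<open>x (0, 0, 0, i)\<close>.\<close>

lemma spectrum_agree:
  assumes n: "n > 0" and eq: "\<And>f. f \<in> carrier (SL_invariants n 4) \<Longrightarrow> f (left_rep n x) = f (right_rep n x)"
    and i: "i < 4"
  shows "x (0, 0, 0, i) = 0"
proof -
  define M where "M = of_nat i \<cdot>\<^sub>m 1\<^sub>m 4 - left_rep n x 0"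
  have M: "M \<in> carrier_mat 4 4" unfolding M_def by (intro minus_carrier_mat loop_repD[OF left_rep_mem n])
  have "right_rep n x 0 = mat_diag 4 of_nat"
    using n by (intro eq_matI) (auto simp: right_rep_def mat_diag_def)
  hence "shifted_det n 4 i (right_rep n x) = (\<Prod>a<4. of_nat i - of_nat a)"
    by (simp add: shifted_det_def right_rep_mem det_minus_mat_diag)
  also have "\<dots> = 0" by (rule prod_zero) (use i in auto)
  finally have "det M = 0"
    using eq[OF shifted_det_invariant[OF n, of 4 i]] by (simp add: shifted_det_def left_rep_mem M_def)
  then obtain u where u: "u \<in> carrier_vec 4" "u \<noteq> 0\<^sub>v 4" "M *\<^sub>v u = 0\<^sub>v 4"
    using det_0_iff_vec_prod_zero_field[OF M] by blast
  define s where "s = (\<Sum>b\<in>{0..<4}. x (0, 0, 0, b) * u $ b)"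
  have rows: "(of_nat i - of_nat a) * u $ a = s" if "a < 4" for a
  proof -
    have "0 = (M *\<^sub>v u) $ a" using u that by simp
    also have "\<dots> = (\<Sum>b\<in>{0..<4}. M $$ (a, b) * u $ b)"
      using M u(1) that by (simp add: scalar_prod_def)
    also have "\<dots> = (\<Sum>b\<in>{0..<4}. (if b = a then (of_nat i - of_nat a) * u $ a else 0) - x (0, 0, 0, b) * u $ b)"
      using n that by (intro sum.cong refl) (auto simp: M_def left_rep_def algebra_simps)
    also have "\<dots> = (of_nat i - of_nat a) * u $ a - s"
      using that by (simp add: sum_subtractf s_def)
    finally show ?thesis by simp
  qed
  have "s = 0" using rows[OF i] by simp
  hence zero: "u $ a = 0" if "a < 4" "a \<noteq> i" for a using rows[OF that(1)] that by simp
  have "s = (\<Sum>b\<in>{0..<4}. if b = i then x (0, 0, 0, i) * u $ i else 0)"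
    unfolding s_def using zero by (intro sum.cong) auto
  hence "x (0, 0, 0, i) * u $ i = 0" using \<open>s = 0\<close> i by simp
  moreover have "u $ i \<noteq> 0"
  proof
    assume "u $ i = 0"
    hence "u = 0\<^sub>v 4" using u(1) zero by (intro eq_vecI) auto
    with u(2) show False by blast
  qed
  ultimately show ?thesis by simp
qed

text \<open>Once the spectra are matched, every other coordinate is isolated by one cycle whose
  remaining entries are \<open>1\<close> on its own side. For a lower entry the cycle meets a zero
  upper entry on the opposite side; for a diagonal block entry the opposite product is
  known.\<close>

lemma left_right_rep_separated:
  assumes n: "n \<ge> 2" and eq: "\<And>f. f \<in> carrier (SL_invariants n 4) \<Longrightarrow> f (left_rep n x) = f (right_rep n x)"
    and c: "c \<in> pair_coords n"
  shows "x c = 0"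
proof -
  have n1: "0 < n" "1 < n" using n by auto
  have spec: "x (0, 0, 0, i) = 0" if "i < 4" for i by (rule spectrum_agree[OF n1(1) eq that])
  have L0: "left_rep n x 0 = mat_diag 4 of_nat"
    using n1 spec by (intro eq_matI) (auto simp: left_rep_def mat_diag_def)
  have R0: "right_rep n x 0 = mat_diag 4 of_nat"
    using n1 by (intro eq_matI) (auto simp: right_rep_def mat_diag_def)
  note cycles = cycles_agree[OF left_rep_mem L0 right_rep_mem R0 eq]
  have L: "left_rep n x k $$ (i, j) =
      (if k = 1 \<and> (i, j) \<in> {(0, 1), (1, 3), (1, 2), (2, 1)} then 1 else 0) +
      (if (i, j) \<in> free_pos k then x (1, k, i, j) else 0)" if "k \<in> {1..<n}" "i < 4" "j < 4" for k i j
    using that by (simp add: left_rep_def)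
  have R: "right_rep n x k $$ (i, j) =
      (if k = 1 \<and> (i, j) \<in> {(0, 2), (2, 3), (1, 2), (2, 1)} then 1 else 0) +
      (if (i, j) \<in> lower_pos then x (2, k, i, j) else 0)" if "k \<in> {1..<n}" "i < 4" "j < 4" for k i j
    using that by (simp add: right_rep_def)
  note LR = L R mem_free_pos upper_pos_def lower_pos_def
  have diag: "x (1, k, i, i) = 0" if "k \<in> {1..<n}" "i < 4" for k i
    using cycles(1)[of i 0 0 k 0 0] that n1 by (auto simp: LR less_4_cases)
  have x21: "x (1, k, 2, 1) = 0" if "k \<in> {1..<n}" for k
    using cycles(2)[of 1 2 0 1 k 0] that n1 by (simp add: LR)
  have x12: "x (1, k, 1, 2) = 0" if "k \<in> {2..<n}" for k
    using cycles(2)[of 1 2 0 k 1 0] that n1 x21[of 1] by (simp add: LR)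
  have x10: "x (1, k, 1, 0) = 0" if "k \<in> {1..<n}" for k
    using cycles(2)[of 0 1 0 1 k 0] that n1 by (simp add: LR)
  have y20: "x (2, k, 2, 0) = 0" if "k \<in> {1..<n}" for k
    using cycles(2)[of 0 2 0 1 k 0] that n1 by (simp add: LR)
  have x31: "x (1, k, 3, 1) = 0" if "k \<in> {1..<n}" for k
    using cycles(2)[of 1 3 0 1 k 0] that n1 by (simp add: LR)
  have y32: "x (2, k, 3, 2) = 0" if "k \<in> {1..<n}" for k
    using cycles(2)[of 2 3 0 1 k 0] that n1 by (simp add: LR)
  \<comment> \<open>No unit entry joins these indices directly on the side in question, so the path
    of units takes two steps through the middle block and the cycles have length three.\<close>
  have x20: "x (1, k, 2, 0) = 0" if "k \<in> {1..<n}" for k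
    using cycles(3)[of 0 1 2 1 1 k] that n1 by (simp add: LR)
  have y10: "x (2, k, 1, 0) = 0" if "k \<in> {1..<n}" for k
    using cycles(3)[of 0 2 1 1 1 k] that n1 by (simp add: LR)
  have x32: "x (1, k, 3, 2) = 0" if "k \<in> {1..<n}" for k
    using cycles(3)[of 2 1 3 1 1 k] that n1 x21[of 1] by (simp add: LR)
  have y31: "x (2, k, 3, 1) = 0" if "k \<in> {1..<n}" for k
    using cycles(3)[of 1 2 3 1 1 k] that n1 by (simp add: LR)
  have x30: "x (1, k, 3, 0) = 0" if "k \<in> {1..<n}" for k
    using cycles(3)[of 0 1 3 1 1 k] that n1 by (simp add: LR)
  have y30: "x (2, k, 3, 0) = 0" if "k \<in> {1..<n}" for k
    using cycles(3)[of 0 2 3 1 1 k] that n1 by (simp add: LR)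
  consider i where "c = (0, 0, 0, i)" "i < 4"
    | k i j where "c = (1, k, i, j)" "k \<in> {1..<n}" "(i, j) \<in> free_pos k"
    | k i j where "c = (2, k, i, j)" "k \<in> {1..<n}" "(i, j) \<in> lower_pos"
    using c unfolding pair_coords_def by auto
  thus ?thesis
  proof cases
    case 1
    thus ?thesis using spec by simp
  next
    case (2 k i j)
    have "(i, j) \<in> {(0, 0), (1, 1), (2, 2), (3, 3), (2, 1), (1, 0), (2, 0), (3, 0), (3, 1), (3, 2)} \<or>
        (i, j) = (1, 2) \<and> k \<noteq> 1"
      using 2(3) unfolding mem_free_pos upper_pos_def less_4_cases by auto
    moreover have "k \<in> {2..<n}" if "k \<noteq> 1" using 2(2) that by auto
    ultimately show ?thesis
      using 2(2) diag[of k] x21[of k] x12[of k] x10[of k] x20[of k] x30[of k] x31[of k] x32[of k]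
      unfolding 2(1) by auto
  next
    case (3 k i j)
    thus ?thesis using y10[of k] y20[of k] y30[of k] y31[of k] y32[of k] by (auto simp: lower_pos_def)
  qed
qed

section \<open>Size of separating sets\<close>

text \<open>The differences of the elements of \<open>S\<close> on the two families vanish at the
  origin, and since \<open>S\<close> separates, they vanish jointly only where all coordinates are
  zero. So there are at least as many of them as coordinates.\<close>

lemma card_separating_set_ge:
  assumes n: "n \<ge> 2" and S: "separating_set (loop_rep n 4) (SL_invariants n 4) S" and "finite S"
  shows "16 * (n - 1) + 3 \<le> card S"
proof -
  have inv: "s \<in> carrier (SL_invariants n 4)" if "s \<in> S" for s
    using S that by (auto simp: separating_set_def)
  have "card (pair_coords n) \<le> card S"
  proof (rule unique_common_zero[where f = "\<lambda>s x. s (left_rep n x) - s (right_rep n x)"])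
    fix s assume s: "s \<in> S"
    show "(\<lambda>x. s (left_rep n x) - s (right_rep n x)) \<in> pfun (pair_coords n)"
    proof (intro pfun_diff invariant_pfun[OF inv[OF s]] left_rep_mem right_rep_mem)
      fix k i j assume kij: "k < n" "i < (4::nat)" "j < (4::nat)"
      have "(0, 0, 0, j) \<in> pair_coords n" using kij by (simp add: pair_coords_def)
      moreover have "(1, k, i, j) \<in> pair_coords n" if "k \<noteq> 0" "(i, j) \<in> free_pos k"
        using kij that by (simp add: pair_coords_def)
      ultimately show "(\<lambda>x. left_rep n x k $$ (i, j)) \<in> pfun (pair_coords n)"
        using kij by (cases "k = 0"; cases "(i, j) \<in> free_pos k")
          (auto simp: left_rep_def intro!: pfun.add pfun.const pfun.coord)
      have "(2, k, i, j) \<in> pair_coords n" if "k \<noteq> 0" "(i, j) \<in> lower_pos"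
        using kij that by (simp add: pair_coords_def)
      thus "(\<lambda>x. right_rep n x k $$ (i, j)) \<in> pfun (pair_coords n)"
        using kij by (cases "k = 0"; cases "(i, j) \<in> lower_pos")
          (auto simp: right_rep_def intro!: pfun.add pfun.const pfun.coord)
    qed
    show "s (left_rep n (\<lambda>_. 0)) - s (right_rep n (\<lambda>_. 0)) = 0"
      using left_right_rep_0[OF inv[OF s]] by simp
  next
    fix x c assume zero: "\<And>s. s \<in> S \<Longrightarrow> s (left_rep n x) - s (right_rep n x) = 0" and c: "c \<in> pair_coords n"
    hence "\<forall>s\<in>S. s (left_rep n x) = s (right_rep n x)" by simp
    hence "\<forall>f\<in>carrier (SL_invariants n 4). f (left_rep n x) = f (right_rep n x)"
      using S left_rep_mem right_rep_mem unfolding separating_set_def by blast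
    thus "x c = 0" using left_right_rep_separated[OF n _ c] by blast
  qed (use finite_pair_coords \<open>finite S\<close> in auto)
  thus ?thesis by (simp add: card_pair_coords[OF n])
qed

lemma no_small_separating_set:
  assumes n: "n \<ge> 2"
  shows "\<not> polynomial_separating_set (loop_rep n 4) (SL_invariants n 4) S"
    and "\<not> hypersurface_separating_set (loop_rep n 4) (SL_invariants n 4) S"
proof -
  obtain k where k: "krull_dim (SL_invariants n 4) = enat k" "k \<le> 16 * (n - 1) + 1"
    using krull_dim_SL_invariants_le[OF n] by (cases "krull_dim (SL_invariants n 4)") auto
  show "\<not> polynomial_separating_set (loop_rep n 4) (SL_invariants n 4) S"
    using card_separating_set_ge[OF n, of S] k by (auto simp: polynomial_separating_set_def)
  show "\<not> hypersurface_separating_set (loop_rep n 4) (SL_invariants n 4) S"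
    using card_separating_set_ge[OF n, of S] k by (auto simp: hypersurface_separating_set_def one_enat_def)
qed

theorem theorem1p15:
  fixes n :: nat
  assumes "n \<ge> 1"
  shows "finite_rep_type (loop_quiver n) \<or> tame_rep_type (loop_quiver n) \<longleftrightarrow>
    (\<forall>p \<ge> 1. \<exists>S.
      polynomial_separating_set (loop_rep n p) (SL_invariants n p) S \<or>
      hypersurface_separating_set (loop_rep n p) (SL_invariants n p) S)"
proof (cases "n = 1")
  case True
  show ?thesis unfolding True using tame_loop_quiver_1 polynomial_separating_set_1 by blast
next
  case False
  with assms have n: "n \<ge> 2" by simp
  have "\<not> (\<exists>S. polynomial_separating_set (loop_rep n 4) (SL_invariants n 4) S \<or>
      hypersurface_separating_set (loop_rep n 4) (SL_invariants n 4) S)"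
    using no_small_separating_set[OF n] by blast
  moreover have "(1::nat) \<le> 4" by simp
  ultimately show ?thesis using not_finite_rep_type[OF assms] not_tame_rep_type[OF n] by blast
qed

end
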